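(* The category $\mathbf{Pfn}_F$, with the near product $\boxtimes$ and the diagonals and projections of $\mathbf{Set}_F$, is a $P$-category.
   Context: $F$ is an endofunctor on $\mathbf{Set}$. An $F$-coalgebra is a set $A$ with a map $\alpha:A\to FA$; a morphism $(A,\alpha)\to(B,\beta)$ is a map $\varphi$ with $\beta\varphi=F(\varphi)\alpha$; these form $\mathbf{Set}_F$. A subcoalgebra of $A$ is a subset carrying a (necessarily unique) coalgebra structure making the inclusion a morphism. Standing assumptions: $F$ is nontrivial ($FX=\emptyset$ implies $X=\emptyset$), weakly preserves pullbacks (sends pullback squares to squares having the pullback property except possibly uniqueness), and is either bounded (there is a cardinal $\kappa$ such that every element of every coalgebra lies in a subcoalgebra of cardinality at most $\kappa$) or accessible (preserves $\kappa$-filtered colimits for some $\kappa$). Then $\mathbf{Set}_F$ is complete and its monomorphisms are exactly the injective morphisms. $\mathbf{Pfn}_F$ is the category with the $F$-coalgebras as objects, in which a morphism $X\to Y$ is an equivalence class $\{m,\varphi\}$ of pairs with $m:U\to X$ a monomorphism and $\varphi:U\to Y$ a morphism of $\mathbf{Set}_F$, where $(m,\varphi)\sim(m',\varphi')$ if $m=m'\theta$ and $\varphi=\varphi'\theta$ for an isomorphism $\theta$. Composition is by pullback: $\{m',\varphi'\}\circ\{m,\varphi\}=\{mq,\varphi'r\}$, where $q,r$ are the projections of the pullback of $\varphi$ and $m'$ (with $q$ the pullback of $m'$). $\mathbf{Set}_F$ is embedded by $\varphi\mapsto\{1,\varphi\}$. $\boxtimes$ is given by $X\boxtimes Y=X\times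 Y$ (product in $\mathbf{Set}_F$) and $\{m,\varphi\}\boxtimes\{m',\varphi'\}=\{m\times m',\varphi\times\varphi'\}$. An infranatural transformation $\phi:G\to H$ of functors is a family of components $\phi_X:GX\to HX$; its naturalizer $\mathrm{nat}\,\phi$ is the largest subcategory, containing all objects, on which it is natural. A $P$-category is a category $\mathbf{C}$ with a functor $\boxtimes:\mathbf{C}^2\to\mathbf{C}$ (near product), a natural transformation $\Delta_X:X\to X\boxtimes X$, and infranatural transformations $p_i:\boxtimes\to\pi_i$ to the $i$-th projection functor ($i=0,1$) such that, with $\langle f,g\rangle=(f\boxtimes g)\Delta_X$ for $f:X\to Y$, $g:X\to Z$: (i) $p_{i\,X,X}\Delta_X=1_X$ and $(p_{0\,X,X}\boxtimes p_{1\,X,X})\Delta_{X\boxtimes X}=1_{X\boxtimes X}$; (ii) if $\mathbf{P}$ is the smallest subcategory closed under $\boxtimes$ containing all components of $p_0,p_1$, then $\mathbf{C}\times\mathbf{P}\subseteq\mathrm{nat}\,p_0$ and $\mathbf{P}\times\mathbf{C}\subseteq\mathrm{nat}\,p_1$; (iii) $\langle p_{0\,X,Y}p_{0\,X\boxtimes Y,Z},\langle p_{1\,X,Y}p_{0\,X\boxtimes Y,Z},p_{1\,X\boxtimes Y,Z}\rangle\rangle:(X\boxtimes Y)\boxtimes Z\to X\boxtimes(Y\boxtimes Z)$ is a natural isomorphism; (iv) $\langle p_{1\,X,Y},p_{0\,X,Y}\rangle:X\boxtimes Y\to Y\boxtimes X$ is a natural isomorphism; and the isomorphisms in (iii), (iv)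 make $\boxtimes$ coherently associative and commutative (pentagon and hexagon conditions, and the composite of the two transpositions is the identity). *)

theory Defs
  imports Main "HOL-Library.FuncSet"
begin

unbundle cardinal_syntax

section \<open>Categories, functors, natural transformations\<close>

record ('o, 'a) cat =
  Obj :: "'o set"
  Arr :: "'a set"
  Dom :: "'a \<Rightarrow> 'o"
  Cod :: "'a \<Rightarrow> 'o"
  Ide :: "'o \<Rightarrow> 'a" ("\<one>\<index>")
  Comp :: "'a \<Rightarrow> 'a \<Rightarrow> 'a" (infixr "\<cdot>\<index>" 70)

definition hom :: "('o, 'a) cat \<Rightarrow> 'o \<Rightarrow> 'o \<Rightarrow> 'a set" where
  "hom C X Y = {f \<in> Arr C. Dom C f = X \<and> Cod C f = Y}"

locale category =
  fixes C :: "('o, 'a) cat" (structure)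
  assumes Dom_Obj: "f \<in> Arr C \<Longrightarrow> Dom C f \<in> Obj C"
    and Cod_Obj: "f \<in> Arr C \<Longrightarrow> Cod C f \<in> Obj C"
    and Ide_hom: "X \<in> Obj C \<Longrightarrow> \<one> X \<in> hom C X X"
    and Comp_hom: "f \<in> hom C X Y \<Longrightarrow> g \<in> hom C Y Z \<Longrightarrow> g \<cdot> f \<in> hom C X Z"
    and Comp_Ide: "f \<in> hom C X Y \<Longrightarrow> f \<cdot> \<one> X = f"
    and Ide_Comp: "f \<in> hom C X Y \<Longrightarrow> \<one> Y \<cdot> f = f"
    and Comp_assoc: "f \<in> hom C W X \<Longrightarrow> g \<in> hom C X Y \<Longrightarrow> h \<in> hom C Y Z \<Longrightarrow>
                       (h \<cdot> g) \<cdot> f = h \<cdot> (g \<cdot> f)"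

definition prod_cat :: "('o, 'a) cat \<Rightarrow> ('p, 'b) cat \<Rightarrow> ('o \<times> 'p, 'a \<times> 'b) cat" where
  "prod_cat C D = \<lparr>Obj = Obj C \<times> Obj D, Arr = Arr C \<times> Arr D,
     Dom = (\<lambda>(f, g). (Dom C f, Dom D g)), Cod = (\<lambda>(f, g). (Cod C f, Cod D g)),
     Ide = (\<lambda>(X, Y). (\<one>\<^bsub>C\<^esub> X, \<one>\<^bsub>D\<^esub> Y)),
     Comp = (\<lambda>(g, g') (f, f'). (g \<cdot>\<^bsub>C\<^esub> f, g' \<cdot>\<^bsub>D\<^esub> f'))\<rparr>"

text \<open>A subcategory is given by its set of arrows; its objects are those whose identity belongs
  to that set.\<close>

definition subcategory :: "('o, 'a) cat \<Rightarrow> 'a set \<Rightarrow> bool" where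
  "subcategory C S \<longleftrightarrow> S \<subseteq> Arr C
     \<and> (\<forall>f\<in>S. \<one>\<^bsub>C\<^esub> (Dom C f) \<in> S \<and> \<one>\<^bsub>C\<^esub> (Cod C f) \<in> S)
     \<and> (\<forall>f\<in>S. \<forall>g\<in>S. Dom C g = Cod C f \<longrightarrow> g \<cdot>\<^bsub>C\<^esub> f \<in> S)"

definition wide_subcategory :: "('o, 'a) cat \<Rightarrow> 'a set \<Rightarrow> bool" where
  "wide_subcategory C S \<longleftrightarrow> subcategory C S \<and> (\<forall>X\<in>Obj C. \<one>\<^bsub>C\<^esub> X \<in> S)"

definition subcat :: "('o, 'a) cat \<Rightarrow> 'a set \<Rightarrow> ('o, 'a) cat" where
  "subcat C S = C\<lparr>Obj := {X \<in> Obj C. \<one>\<^bsub>C\<^esub> X \<in> S}, Arr := S\<rparr>"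

record ('o, 'a, 'p, 'b) fctr =
  omap :: "'o \<Rightarrow> 'p"
  amap :: "'a \<Rightarrow> 'b"

definition is_functor :: "('o, 'a) cat \<Rightarrow> ('p, 'b) cat \<Rightarrow> ('o, 'a, 'p, 'b) fctr \<Rightarrow> bool" where
  "is_functor C D G \<longleftrightarrow> category C \<and> category D
     \<and> (\<forall>X\<in>Obj C. omap G X \<in> Obj D)
     \<and> (\<forall>f\<in>Arr C. amap G f \<in> hom D (omap G (Dom C f)) (omap G (Cod C f)))
     \<and> (\<forall>X\<in>Obj C. amap G (\<one>\<^bsub>C\<^esub> X) = \<one>\<^bsub>D\<^esub> (omap G X))
     \<and> (\<forall>f\<in>Arr C. \<forall>g\<in>Arr C. Dom C g = Cod C f \<longrightarrow>
           amap G (g \<cdot>\<^bsub>C\<^esub> f) = amap G g \<cdot>\<^bsub>D\<^esub> amap G f)"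

definition id_fctr :: "('o, 'a, 'o, 'a) fctr" where
  "id_fctr = \<lparr>omap = \<lambda>X. X, amap = \<lambda>f. f\<rparr>"

definition comp_fctr ::
  "('p, 'b, 'q, 'c) fctr \<Rightarrow> ('o, 'a, 'p, 'b) fctr \<Rightarrow> ('o, 'a, 'q, 'c) fctr" where
  "comp_fctr H G = \<lparr>omap = omap H \<circ> omap G, amap = amap H \<circ> amap G\<rparr>"

definition fst_fctr :: "('o \<times> 'p, 'a \<times> 'b, 'o, 'a) fctr" where
  "fst_fctr = \<lparr>omap = fst, amap = fst\<rparr>"

definition snd_fctr :: "('o \<times> 'p, 'a \<times> 'b, 'p, 'b) fctr" where
  "snd_fctr = \<lparr>omap = snd, amap = snd\<rparr>"

definition pair_fctr ::
  "('o, 'a, 'p, 'b) fctr \<Rightarrow> ('o, 'a, 'q, 'c) fctr \<Rightarrow> ('o, 'a, 'p \<times> 'q, 'b \<times> 'c) fctr" where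
  "pair_fctr G H = \<lparr>omap = \<lambda>X. (omap G X, omap H X), amap = \<lambda>f. (amap G f, amap H f)\<rparr>"

definition infranatural ::
  "('o, 'a) cat \<Rightarrow> ('p, 'b) cat \<Rightarrow> ('o, 'a, 'p, 'b) fctr \<Rightarrow> ('o, 'a, 'p, 'b) fctr \<Rightarrow>
   ('o \<Rightarrow> 'b) \<Rightarrow> bool" where
  "infranatural C D G H \<phi> \<longleftrightarrow> is_functor C D G \<and> is_functor C D H
     \<and> (\<forall>X\<in>Obj C. \<phi> X \<in> hom D (omap G X) (omap H X))"

definition natural_on ::
  "('o, 'a) cat \<Rightarrow> ('p, 'b) cat \<Rightarrow> ('o, 'a, 'p, 'b) fctr \<Rightarrow> ('o, 'a, 'p, 'b) fctr \<Rightarrow>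
   ('o \<Rightarrow> 'b) \<Rightarrow> 'a set \<Rightarrow> bool" where
  "natural_on C D G H \<phi> S \<longleftrightarrow>
     (\<forall>f\<in>S. amap H f \<cdot>\<^bsub>D\<^esub> \<phi> (Dom C f) = \<phi> (Cod C f) \<cdot>\<^bsub>D\<^esub> amap G f)"

definition natural ::
  "('o, 'a) cat \<Rightarrow> ('p, 'b) cat \<Rightarrow> ('o, 'a, 'p, 'b) fctr \<Rightarrow> ('o, 'a, 'p, 'b) fctr \<Rightarrow>
   ('o \<Rightarrow> 'b) \<Rightarrow> bool" where
  "natural C D G H \<phi> \<longleftrightarrow> infranatural C D G H \<phi> \<and> natural_on C D G H \<phi> (Arr C)"

definition naturalizer ::
  "('o, 'a) cat \<Rightarrow> ('p, 'b) cat \<Rightarrow> ('o, 'a, 'p, 'b) fctr \<Rightarrow> ('o, 'a, 'p, 'b) fctr \<Rightarrow>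
   ('o \<Rightarrow> 'b) \<Rightarrow> 'a set" where
  "naturalizer C D G H \<phi> = \<Union>{S. wide_subcategory C S \<and> natural_on C D G H \<phi> S}"

text \<open>The union is itself a wide subcategory on which \<open>\<phi>\<close> is natural, hence the largest one.\<close>

lemma naturalizer_eq:
  assumes "infranatural C D G H \<phi>"
  shows "naturalizer C D G H \<phi> = {f \<in> Arr C. natural_on C D G H \<phi> {f}}" (is "_ = ?N")
    and "wide_subcategory C (naturalizer C D G H \<phi>)"
    and "natural_on C D G H \<phi> (naturalizer C D G H \<phi>)"
proof -
  have G: "is_functor C D G" and H: "is_functor C D H"
    and \<phi>: "\<And>X. X \<in> Obj C \<Longrightarrow> \<phi> X \<in> hom D (omap G X) (omap H X)"
    using assms by (auto simp: infranatural_def)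
  interpret C: category C using G by (simp add: is_functor_def)
  interpret D: category D using G by (simp add: is_functor_def)
  have Ar: "f \<in> Arr C \<Longrightarrow> amap K f \<in> hom D (omap K (Dom C f)) (omap K (Cod C f))"
    if "K = G \<or> K = H" for K f
    using G H that unfolding is_functor_def by blast
  have ide: "\<one>\<^bsub>C\<^esub> X \<in> ?N" if X: "X \<in> Obj C" for X
  proof -
    have i: "\<one>\<^bsub>C\<^esub> X \<in> Arr C" "Dom C (\<one>\<^bsub>C\<^esub> X) = X" "Cod C (\<one>\<^bsub>C\<^esub> X) = X"
      using C.Ide_hom[OF X] by (auto simp: hom_def)
    have "amap G (\<one>\<^bsub>C\<^esub> X) = \<one>\<^bsub>D\<^esub> (omap G X)" "amap H (\<one>\<^bsub>C\<^esub> X) = \<one>\<^bsub>D\<^esub> (omap H X)"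
      using G H X by (auto simp: is_functor_def)
    then show ?thesis
      using i D.Comp_Ide[OF \<phi>[OF X]] D.Ide_Comp[OF \<phi>[OF X]] by (simp add: natural_on_def)
  qed
  have comp: "g \<cdot>\<^bsub>C\<^esub> f \<in> ?N" if f: "f \<in> ?N" and g: "g \<in> ?N" and gf: "Dom C g = Cod C f" for f g
  proof -
    have fA: "f \<in> Arr C" and gA: "g \<in> Arr C" using f g by auto
    have c: "g \<cdot>\<^bsub>C\<^esub> f \<in> hom C (Dom C f) (Cod C g)"
      by (rule C.Comp_hom[where Y = "Cod C f"]) (use fA gA gf in \<open>auto simp: hom_def\<close>)
    have m: "amap K (g \<cdot>\<^bsub>C\<^esub> f) = amap K g \<cdot>\<^bsub>D\<^esub> amap K f" if "K = G \<or> K = H" for K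
      using G H fA gA gf that unfolding is_functor_def by blast
    have p: "\<phi> (Dom C f) \<in> hom D (omap G (Dom C f)) (omap H (Dom C f))"
      "\<phi> (Cod C f) \<in> hom D (omap G (Cod C f)) (omap H (Cod C f))"
      "\<phi> (Cod C g) \<in> hom D (omap G (Cod C g)) (omap H (Cod C g))"
      using \<phi> C.Dom_Obj C.Cod_Obj fA gA by auto
    have a: "amap G f \<in> hom D (omap G (Dom C f)) (omap G (Cod C f))"
      "amap H f \<in> hom D (omap H (Dom C f)) (omap H (Cod C f))"
      "amap G g \<in> hom D (omap G (Cod C f)) (omap G (Cod C g))"
      "amap H g \<in> hom D (omap H (Cod C f)) (omap H (Cod C g))"
      using Ar[OF _ fA] Ar[OF _ gA] gf by auto
    have "amap H (g \<cdot>\<^bsub>C\<^esub> f) \<cdot>\<^bsub>D\<^esub> \<phi> (Dom C f) = amap H g \<cdot>\<^bsub>D\<^esub> (amap H f \<cdot>\<^bsub>D\<^esub> \<phi> (Dom C f))"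
      using m[of H] D.Comp_assoc[OF p(1) a(2) a(4)] by simp
    also have "\<dots> = amap H g \<cdot>\<^bsub>D\<^esub> (\<phi> (Cod C f) \<cdot>\<^bsub>D\<^esub> amap G f)"
      using f by (simp add: natural_on_def)
    also have "\<dots> = (amap H g \<cdot>\<^bsub>D\<^esub> \<phi> (Dom C g)) \<cdot>\<^bsub>D\<^esub> amap G f"
      using D.Comp_assoc[OF a(1) p(2) a(4)] gf by simp
    also have "\<dots> = (\<phi> (Cod C g) \<cdot>\<^bsub>D\<^esub> amap G g) \<cdot>\<^bsub>D\<^esub> amap G f"
      using g by (simp add: natural_on_def)
    also have "\<dots> = \<phi> (Cod C g) \<cdot>\<^bsub>D\<^esub> amap G (g \<cdot>\<^bsub>C\<^esub> f)"
      using m[of G] D.Comp_assoc[OF a(1) a(3) p(3)] by simp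
    finally show ?thesis using c by (auto simp: natural_on_def hom_def)
  qed
  have N: "wide_subcategory C ?N"
    unfolding wide_subcategory_def subcategory_def
    using ide comp C.Dom_Obj C.Cod_Obj by blast
  have nN: "natural_on C D G H \<phi> ?N"
    by (auto simp: natural_on_def)
  show eq: "naturalizer C D G H \<phi> = ?N"
  proof
    show "naturalizer C D G H \<phi> \<subseteq> ?N"
      by (auto simp: naturalizer_def natural_on_def wide_subcategory_def subcategory_def)
    show "?N \<subseteq> naturalizer C D G H \<phi>"
      unfolding naturalizer_def using N nN by blast
  qed
  show "wide_subcategory C (naturalizer C D G H \<phi>)" "natural_on C D G H \<phi> (naturalizer C D G H \<phi>)"
    using N nN unfolding eq .
qed

definition is_iso :: "('o, 'a) cat \<Rightarrow> 'a \<Rightarrow> bool" where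
  "is_iso C f \<longleftrightarrow> f \<in> Arr C \<and> (\<exists>g \<in> hom C (Cod C f) (Dom C f).
     g \<cdot>\<^bsub>C\<^esub> f = \<one>\<^bsub>C\<^esub> (Dom C f) \<and> f \<cdot>\<^bsub>C\<^esub> g = \<one>\<^bsub>C\<^esub> (Cod C f))"

definition is_mono :: "('o, 'a) cat \<Rightarrow> 'a \<Rightarrow> bool" where
  "is_mono C m \<longleftrightarrow> m \<in> Arr C \<and> (\<forall>f\<in>Arr C. \<forall>g\<in>Arr C.
     Cod C f = Dom C m \<and> Cod C g = Dom C m \<and> Dom C f = Dom C g
       \<and> m \<cdot>\<^bsub>C\<^esub> f = m \<cdot>\<^bsub>C\<^esub> g \<longrightarrow> f = g)"

definition natural_iso ::
  "('o, 'a) cat \<Rightarrow> ('p, 'b) cat \<Rightarrow> ('o, 'a, 'p, 'b) fctr \<Rightarrow> ('o, 'a, 'p, 'b) fctr \<Rightarrow>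
   ('o \<Rightarrow> 'b) \<Rightarrow> bool" where
  "natural_iso C D G H \<phi> \<longleftrightarrow> natural C D G H \<phi> \<and> (\<forall>X\<in>Obj C. is_iso D (\<phi> X))"


section \<open>Limits and colimits\<close>

definition commuting_square :: "('o, 'a) cat \<Rightarrow> 'a \<Rightarrow> 'a \<Rightarrow> 'a \<Rightarrow> 'a \<Rightarrow> bool" where
  "commuting_square C f g p q \<longleftrightarrow> {f, g, p, q} \<subseteq> Arr C \<and> Cod C f = Cod C g \<and> Dom C p = Dom C q
     \<and> Cod C p = Dom C f \<and> Cod C q = Dom C g \<and> f \<cdot>\<^bsub>C\<^esub> p = g \<cdot>\<^bsub>C\<^esub> q"

definition is_pullback :: "('o, 'a) cat \<Rightarrow> 'a \<Rightarrow> 'a \<Rightarrow> 'a \<Rightarrow> 'a \<Rightarrow> bool" where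
  "is_pullback C f g p q \<longleftrightarrow> commuting_square C f g p q
     \<and> (\<forall>p' q'. commuting_square C f g p' q' \<longrightarrow>
          (\<exists>!h. h \<in> hom C (Dom C p') (Dom C p) \<and> p \<cdot>\<^bsub>C\<^esub> h = p' \<and> q \<cdot>\<^bsub>C\<^esub> h = q'))"

definition is_weak_pullback :: "('o, 'a) cat \<Rightarrow> 'a \<Rightarrow> 'a \<Rightarrow> 'a \<Rightarrow> 'a \<Rightarrow> bool" where
  "is_weak_pullback C f g p q \<longleftrightarrow> commuting_square C f g p q
     \<and> (\<forall>p' q'. commuting_square C f g p' q' \<longrightarrow>
          (\<exists>h. h \<in> hom C (Dom C p') (Dom C p) \<and> p \<cdot>\<^bsub>C\<^esub> h = p' \<and> q \<cdot>\<^bsub>C\<^esub> h = q'))"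

definition is_product :: "('o, 'a) cat \<Rightarrow> 'o \<Rightarrow> 'o \<Rightarrow> 'o \<Rightarrow> 'a \<Rightarrow> 'a \<Rightarrow> bool" where
  "is_product C X Y P p q \<longleftrightarrow> P \<in> Obj C \<and> p \<in> hom C P X \<and> q \<in> hom C P Y
     \<and> (\<forall>W f g. f \<in> hom C W X \<and> g \<in> hom C W Y \<longrightarrow>
          (\<exists>!h. h \<in> hom C W P \<and> p \<cdot>\<^bsub>C\<^esub> h = f \<and> q \<cdot>\<^bsub>C\<^esub> h = g))"

text \<open>The chosen product; meaningful only where a product exists.\<close>

definition product :: "('o, 'a) cat \<Rightarrow> 'o \<Rightarrow> 'o \<Rightarrow> 'o \<times> 'a \<times> 'a" where
  "product C X Y = (SOME (P, p, q). is_product C X Y P p q)"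

definition prod_ob :: "('o, 'a) cat \<Rightarrow> 'o \<Rightarrow> 'o \<Rightarrow> 'o" where
  "prod_ob C X Y = fst (product C X Y)"

definition proj0 :: "('o, 'a) cat \<Rightarrow> 'o \<Rightarrow> 'o \<Rightarrow> 'a" where
  "proj0 C X Y = fst (snd (product C X Y))"

definition proj1 :: "('o, 'a) cat \<Rightarrow> 'o \<Rightarrow> 'o \<Rightarrow> 'a" where
  "proj1 C X Y = snd (snd (product C X Y))"

definition tuple :: "('o, 'a) cat \<Rightarrow> 'a \<Rightarrow> 'a \<Rightarrow> 'a" where
  "tuple C f g = (THE h. h \<in> hom C (Dom C f) (prod_ob C (Cod C f) (Cod C g))
     \<and> proj0 C (Cod C f) (Cod C g) \<cdot>\<^bsub>C\<^esub> h = f \<and> proj1 C (Cod C f) (Cod C g) \<cdot>\<^bsub>C\<^esub> h = g)"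

definition diagonal :: "('o, 'a) cat \<Rightarrow> 'o \<Rightarrow> 'a" where
  "diagonal C X = tuple C (\<one>\<^bsub>C\<^esub> X) (\<one>\<^bsub>C\<^esub> X)"

definition prod_ar :: "('o, 'a) cat \<Rightarrow> 'a \<Rightarrow> 'a \<Rightarrow> 'a" where
  "prod_ar C f g = tuple C (f \<cdot>\<^bsub>C\<^esub> proj0 C (Dom C f) (Dom C g)) (g \<cdot>\<^bsub>C\<^esub> proj1 C (Dom C f) (Dom C g))"

definition is_cocone ::
  "('j, 'k) cat \<Rightarrow> ('o, 'a) cat \<Rightarrow> ('j, 'k, 'o, 'a) fctr \<Rightarrow> 'o \<Rightarrow> ('j \<Rightarrow> 'a) \<Rightarrow> bool" where
  "is_cocone J C D V \<iota> \<longleftrightarrow> V \<in> Obj C \<and> (\<forall>j\<in>Obj J. \<iota> j \<in> hom C (omap D j) V)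
     \<and> (\<forall>a\<in>Arr J. \<iota> (Cod J a) \<cdot>\<^bsub>C\<^esub> amap D a = \<iota> (Dom J a))"

definition is_colimit ::
  "('j, 'k) cat \<Rightarrow> ('o, 'a) cat \<Rightarrow> ('j, 'k, 'o, 'a) fctr \<Rightarrow> 'o \<Rightarrow> ('j \<Rightarrow> 'a) \<Rightarrow> bool" where
  "is_colimit J C D V \<iota> \<longleftrightarrow> is_cocone J C D V \<iota>
     \<and> (\<forall>W \<zeta>. is_cocone J C D W \<zeta> \<longrightarrow>
          (\<exists>!h. h \<in> hom C V W \<and> (\<forall>j\<in>Obj J. h \<cdot>\<^bsub>C\<^esub> \<iota> j = \<zeta> j)))"

text \<open>Every subcategory with fewer than \<open>r\<close> arrows (the empty one included) has a cocone.\<close>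

definition filtered :: "'c rel \<Rightarrow> ('j, 'k) cat \<Rightarrow> bool" where
  "filtered r J \<longleftrightarrow> category J
     \<and> (\<forall>S. subcategory J S \<and> |S| <o r \<longrightarrow> (\<exists>V \<iota>. is_cocone (subcat J S) J id_fctr V \<iota>))"


section \<open>The category of sets\<close>

text \<open>
  The category of sets is rendered relative to a universe: the small sets are the subsets of \<open>'u\<close>
  of cardinality less than that of \<open>'u\<close>, where \<open>'u\<close> is an infinite regular strong limit. For an
  uncountable \<open>'u\<close> this means that \<open>'u\<close> has strongly inaccessible cardinality, and the small sets
  form a category equivalent to the sets of a Grothendieck universe. A countable \<open>'u\<close> gives
  the finite sets. Cardinals of the universe are represented by cardinal orders \<open>r :: 'u rel\<close>
  with \<open>r <o |UNIV|\<close>.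
\<close>

definition set_universe :: "'u itself \<Rightarrow> bool" where
  "set_universe _ \<longleftrightarrow> infinite (UNIV :: 'u set) \<and> regularCard |UNIV :: 'u set|
     \<and> (\<forall>A :: 'u set. |A| <o |UNIV :: 'u set| \<longrightarrow> |Pow A| <o |UNIV :: 'u set| )"

lemma set_universe_nat: "set_universe TYPE(nat)"
proof -
  have eq: "|UNIV :: nat set| =o natLeq"
    by (rule card_of_nat)
  have small: "|A| <o |UNIV :: nat set| \<longleftrightarrow> finite A" for A :: "'x set"
    unfolding finite_iff_ordLess_natLeq
    using ordLess_ordIso_trans[OF _ eq] ordLess_ordIso_trans[OF _ ordIso_symmetric[OF eq]] by blast
  have "regularCard |UNIV :: nat set|"
    by (rule regularCard_ordIso[OF ordIso_symmetric[OF eq] natLeq_Cinfinite regularCard_natLeq])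
  then show ?thesis
    by (simp add: set_universe_def small)
qed

definition small :: "'u set \<Rightarrow> bool" where
  "small A \<longleftrightarrow> |A| <o |UNIV :: 'u set|"

type_synonym 'u fn = "'u set \<times> ('u \<Rightarrow> 'u) \<times> 'u set"

abbreviation fsrc :: "'u fn \<Rightarrow> 'u set" where "fsrc \<equiv> fst"
abbreviation fapp :: "'u fn \<Rightarrow> 'u \<Rightarrow> 'u" where "fapp f \<equiv> fst (snd f)"
abbreviation ftgt :: "'u fn \<Rightarrow> 'u set" where "ftgt f \<equiv> snd (snd f)"

definition Sets :: "('u set, 'u fn) cat" where
  "Sets = \<lparr>Obj = {A. small A},
     Arr = {(A, f, B). small A \<and> small B \<and> f \<in> A \<rightarrow>\<^sub>E B},
     Dom = fsrc, Cod = ftgt,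
     Ide = (\<lambda>A. (A, \<lambda>x\<in>A. x, A)),
     Comp = (\<lambda>g f. (fsrc f, compose (fsrc f) (fapp g) (fapp f), ftgt g))\<rparr>"

lemma category_Sets: "category Sets"
proof
  fix f :: "'u fn" and X Y assume "f \<in> hom Sets X Y"
  then obtain f' where "f = (X, f', Y)" "f' \<in> X \<rightarrow>\<^sub>E Y"
    by (auto simp: Sets_def hom_def)
  moreover from this have "compose X f' (\<lambda>x\<in>X. x) = f'" "compose X (\<lambda>x\<in>Y. x) f' = f'"
    by (auto simp: compose_def PiE_def extensional_def fun_eq_iff)
  ultimately show "f \<cdot>\<^bsub>Sets\<^esub> \<one>\<^bsub>Sets\<^esub> X = f" "\<one>\<^bsub>Sets\<^esub> Y \<cdot>\<^bsub>Sets\<^esub> f = f"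
    by (simp_all add: Sets_def)
next
  fix f g :: "'u fn" and X Y Z assume "f \<in> hom Sets X Y" "g \<in> hom Sets Y Z"
  then show "g \<cdot>\<^bsub>Sets\<^esub> f \<in> hom Sets X Z"
    by (auto simp: Sets_def hom_def compose_def PiE_iff)
next
  fix f g h :: "'u fn" and W X Y Z
  assume "f \<in> hom Sets W X" "g \<in> hom Sets X Y" "h \<in> hom Sets Y Z"
  then show "(h \<cdot>\<^bsub>Sets\<^esub> g) \<cdot>\<^bsub>Sets\<^esub> f = h \<cdot>\<^bsub>Sets\<^esub> (g \<cdot>\<^bsub>Sets\<^esub> f)"
    by (auto simp: Sets_def hom_def compose_def fun_eq_iff)
qed (auto simp: Sets_def hom_def)

type_synonym 'u endo = "('u set, 'u fn, 'u set, 'u fn) fctr"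


section \<open>Coalgebras\<close>

type_synonym 'u coalg = "'u set \<times> 'u fn"
type_synonym 'u coalg_mor = "'u coalg \<times> 'u fn \<times> 'u coalg"

definition coalgebra :: "'u endo \<Rightarrow> 'u coalg \<Rightarrow> bool" where
  "coalgebra F = (\<lambda>(A, \<alpha>). A \<in> Obj Sets \<and> \<alpha> \<in> hom Sets A (omap F A))"

definition coalg_hom :: "'u endo \<Rightarrow> 'u coalg \<Rightarrow> 'u coalg \<Rightarrow> 'u fn \<Rightarrow> bool" where
  "coalg_hom F = (\<lambda>(A, \<alpha>) (B, \<beta>) \<phi>. \<phi> \<in> hom Sets A B
     \<and> \<beta> \<cdot>\<^bsub>Sets\<^esub> \<phi> = amap F \<phi> \<cdot>\<^bsub>Sets\<^esub> \<alpha>)"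

definition SetF :: "'u endo \<Rightarrow> ('u coalg, 'u coalg_mor) cat" where
  "SetF F = \<lparr>Obj = {X. coalgebra F X},
     Arr = {(X, \<phi>, Y). coalgebra F X \<and> coalgebra F Y \<and> coalg_hom F X Y \<phi>},
     Dom = fst, Cod = (\<lambda>(X, \<phi>, Y). Y),
     Ide = (\<lambda>X. (X, \<one>\<^bsub>Sets\<^esub> (fst X), X)),
     Comp = (\<lambda>(Y, \<psi>, Z) (X, \<phi>, Y'). (X, \<psi> \<cdot>\<^bsub>Sets\<^esub> \<phi>, Z))\<rparr>"

lemma category_SetF:
  assumes F: "is_functor Sets Sets F"
  shows "category (SetF F)"
proof -
  interpret S: category Sets by (rule category_Sets)
  have Fo: "amap F f \<in> hom Sets (omap F X) (omap F Y)" if "f \<in> hom Sets X Y" for f X Y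
    using F that by (auto simp: is_functor_def hom_def)
  have Fc: "amap F (g \<cdot>\<^bsub>Sets\<^esub> f) = amap F g \<cdot>\<^bsub>Sets\<^esub> amap F f"
    if "f \<in> hom Sets X Y" "g \<in> hom Sets Y Z" for f g X Y Z
    using F that by (auto simp: is_functor_def hom_def)
  have Fi: "amap F (\<one>\<^bsub>Sets\<^esub> A) = \<one>\<^bsub>Sets\<^esub> (omap F A)" if "A \<in> Obj Sets" for A
    using F that by (auto simp: is_functor_def)
  have comp: "coalg_hom F X Z (\<psi> \<cdot>\<^bsub>Sets\<^esub> \<phi>)"
    if "coalgebra F X" "coalgebra F Y" "coalgebra F Z" "coalg_hom F X Y \<phi>" "coalg_hom F Y Z \<psi>"
    for X Y Z \<phi> \<psi>
  proof -
    obtain A \<alpha> B \<beta> C \<gamma> where [simp]: "X = (A, \<alpha>)" "Y = (B, \<beta>)" "Z = (C, \<gamma>)"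
      by (cases X, cases Y, cases Z)
    have \<alpha>: "\<alpha> \<in> hom Sets A (omap F A)" and \<beta>: "\<beta> \<in> hom Sets B (omap F B)"
      and \<gamma>: "\<gamma> \<in> hom Sets C (omap F C)"
      and \<phi>: "\<phi> \<in> hom Sets A B" "\<beta> \<cdot>\<^bsub>Sets\<^esub> \<phi> = amap F \<phi> \<cdot>\<^bsub>Sets\<^esub> \<alpha>"
      and \<psi>: "\<psi> \<in> hom Sets B C" "\<gamma> \<cdot>\<^bsub>Sets\<^esub> \<psi> = amap F \<psi> \<cdot>\<^bsub>Sets\<^esub> \<beta>"
      using that by (auto simp: coalgebra_def coalg_hom_def)
    have "\<gamma> \<cdot>\<^bsub>Sets\<^esub> (\<psi> \<cdot>\<^bsub>Sets\<^esub> \<phi>) = (\<gamma> \<cdot>\<^bsub>Sets\<^esub> \<psi>) \<cdot>\<^bsub>Sets\<^esub> \<phi>"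
      using S.Comp_assoc[OF \<phi>(1) \<psi>(1) \<gamma>] by simp
    also have "\<dots> = amap F \<psi> \<cdot>\<^bsub>Sets\<^esub> (amap F \<phi> \<cdot>\<^bsub>Sets\<^esub> \<alpha>)"
      using S.Comp_assoc[OF \<phi>(1) \<beta> Fo[OF \<psi>(1)]] \<phi>(2) \<psi>(2) by simp
    also have "\<dots> = amap F (\<psi> \<cdot>\<^bsub>Sets\<^esub> \<phi>) \<cdot>\<^bsub>Sets\<^esub> \<alpha>"
      using S.Comp_assoc[OF \<alpha> Fo[OF \<phi>(1)] Fo[OF \<psi>(1)]] Fc[OF \<phi>(1) \<psi>(1)] by simp
    finally show ?thesis
      using S.Comp_hom[OF \<phi>(1) \<psi>(1)] by (simp add: coalg_hom_def)
  qed
  have ide: "coalg_hom F X X (\<one>\<^bsub>Sets\<^esub> (fst X))" if "coalgebra F X" for X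
    using that S.Ide_hom[of "fst X"] Fi[of "fst X"]
      S.Comp_Ide[of "snd X" "fst X" "omap F (fst X)"] S.Ide_Comp[of "snd X" "fst X" "omap F (fst X)"]
    by (cases X) (simp add: coalgebra_def coalg_hom_def)
  have hom: "f \<in> hom (SetF F) X Y \<longleftrightarrow>
      (\<exists>\<phi>. f = (X, \<phi>, Y) \<and> coalgebra F X \<and> coalgebra F Y \<and> coalg_hom F X Y \<phi>)" for f X Y
    by (auto simp: SetF_def hom_def)
  have hom': "\<phi> \<in> hom Sets (fst X) (fst Y)" if "coalg_hom F X Y \<phi>" for X Y \<phi>
    using that by (auto simp: coalg_hom_def split: prod.splits)
  show ?thesis
  proof
    fix f X Y assume "f \<in> hom (SetF F) X Y"
    then obtain \<phi> where "f = (X, \<phi>, Y)" "coalg_hom F X Y \<phi>"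
      by (auto simp: hom)
    with S.Comp_Ide[OF hom', of X Y \<phi>] S.Ide_Comp[OF hom', of X Y \<phi>] show "f \<cdot>\<^bsub>SetF F\<^esub> \<one>\<^bsub>SetF F\<^esub> X = f" "\<one>\<^bsub>SetF F\<^esub> Y \<cdot>\<^bsub>SetF F\<^esub> f = f"
      by (simp_all add: SetF_def)
  next
    fix f g X Y Z assume "f \<in> hom (SetF F) X Y" "g \<in> hom (SetF F) Y Z"
    then obtain \<phi> \<psi> where *: "f = (X, \<phi>, Y)" "g = (Y, \<psi>, Z)" "coalgebra F X" "coalgebra F Y"
      "coalgebra F Z" "coalg_hom F X Y \<phi>" "coalg_hom F Y Z \<psi>"
      unfolding hom by blast
    have "g \<cdot>\<^bsub>SetF F\<^esub> f = (X, \<psi> \<cdot>\<^bsub>Sets\<^esub> \<phi>, Z)"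
      using * by (simp add: SetF_def)
    then show "g \<cdot>\<^bsub>SetF F\<^esub> f \<in> hom (SetF F) X Z"
      using * comp[OF *(3-7)] unfolding hom by blast
  next
    fix f g h W X Y Z
    assume "f \<in> hom (SetF F) W X" "g \<in> hom (SetF F) X Y" "h \<in> hom (SetF F) Y Z"
    then obtain \<phi> \<psi> \<chi> where *: "f = (W, \<phi>, X)" "g = (X, \<psi>, Y)" "h = (Y, \<chi>, Z)"
      "coalg_hom F W X \<phi>" "coalg_hom F X Y \<psi>" "coalg_hom F Y Z \<chi>"
      unfolding hom by blast
    show "(h \<cdot>\<^bsub>SetF F\<^esub> g) \<cdot>\<^bsub>SetF F\<^esub> f = h \<cdot>\<^bsub>SetF F\<^esub> (g \<cdot>\<^bsub>SetF F\<^esub> f)"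
      using * S.Comp_assoc[OF hom'[OF *(4)] hom'[OF *(5)] hom'[OF *(6)]] by (simp add: SetF_def)
  next
    fix X assume "X \<in> Obj (SetF F)"
    then show "\<one>\<^bsub>SetF F\<^esub> X \<in> hom (SetF F) X X"
      using ide by (auto simp: SetF_def hom_def)
  qed (auto simp: SetF_def)
qed

definition subcoalgebra :: "'u endo \<Rightarrow> 'u coalg \<Rightarrow> 'u set \<Rightarrow> bool" where
  "subcoalgebra F = (\<lambda>(A, \<alpha>) S. S \<subseteq> A
     \<and> (\<exists>\<sigma>. coalgebra F (S, \<sigma>) \<and> coalg_hom F (S, \<sigma>) (A, \<alpha>) (S, \<lambda>x\<in>S. x, A)))"

definition nontrivial :: "'u endo \<Rightarrow> bool" where
  "nontrivial F \<longleftrightarrow> (\<forall>X\<in>Obj Sets. omap F X = {} \<longrightarrow> X = {})"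

definition weakly_preserves_pullbacks :: "'u endo \<Rightarrow> bool" where
  "weakly_preserves_pullbacks F \<longleftrightarrow> (\<forall>f g p q. is_pullback Sets f g p q \<longrightarrow>
     is_weak_pullback Sets (amap F f) (amap F g) (amap F p) (amap F q))"

definition bounded :: "'u endo \<Rightarrow> bool" where
  "bounded F \<longleftrightarrow> (\<exists>r :: 'u rel. Card_order r \<and> r <o |UNIV :: 'u set|
     \<and> (\<forall>A \<alpha>. coalgebra F (A, \<alpha>) \<longrightarrow>
          (\<forall>a\<in>A. \<exists>S. subcoalgebra F (A, \<alpha>) S \<and> a \<in> S \<and> |S| \<le>o r)))"

text \<open>Up to isomorphism, every small category has its objects and its arrows in \<open>'u\<close>.\<close>

definition preserves_filtered_colimits :: "'u rel \<Rightarrow> 'u endo \<Rightarrow> bool" where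
  "preserves_filtered_colimits r F \<longleftrightarrow>
     (\<forall>(J :: ('u, 'u) cat) D V \<iota>.
        small (Obj J) \<and> small (Arr J) \<and> filtered r J \<and> is_functor J Sets D
          \<and> is_colimit J Sets D V \<iota>
        \<longrightarrow> is_colimit J Sets (comp_fctr F D) (omap F V) (\<lambda>j. amap F (\<iota> j)))"

definition accessible :: "'u endo \<Rightarrow> bool" where
  "accessible F \<longleftrightarrow> (\<exists>r :: 'u rel. Cinfinite r \<and> regularCard r \<and> r <o |UNIV :: 'u set|
     \<and> preserves_filtered_colimits r F)"


section \<open>Partial morphisms\<close>

text \<open>
  \<open>pclass C m \<phi>\<close> is the equivalence class \<open>{m, \<phi>}\<close>. An arrow of \<open>Pfn C\<close> carries its class together
  with its domain and codomain. Composition and the near product are lifted to classes as usual,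
  by taking the union of the classes obtained from all representatives (and, for composition, from
  all pullbacks).
\<close>

definition pspan :: "('o, 'a) cat \<Rightarrow> 'a \<Rightarrow> 'a \<Rightarrow> bool" where
  "pspan C m \<phi> \<longleftrightarrow> is_mono C m \<and> \<phi> \<in> Arr C \<and> Dom C m = Dom C \<phi>"

definition pclass :: "('o, 'a) cat \<Rightarrow> 'a \<Rightarrow> 'a \<Rightarrow> ('a \<times> 'a) set" where
  "pclass C m \<phi> = {(m', \<phi>'). pspan C m' \<phi>' \<and>
     (\<exists>\<theta>. is_iso C \<theta> \<and> \<theta> \<in> hom C (Dom C m) (Dom C m') \<and> m = m' \<cdot>\<^bsub>C\<^esub> \<theta> \<and> \<phi> = \<phi>' \<cdot>\<^bsub>C\<^esub> \<theta>)}"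

type_synonym ('o, 'a) pmor = "'o \<times> ('a \<times> 'a) set \<times> 'o"

definition pmor :: "('o, 'a) cat \<Rightarrow> 'a \<Rightarrow> 'a \<Rightarrow> ('o, 'a) pmor" where
  "pmor C m \<phi> = (Cod C m, pclass C m \<phi>, Cod C \<phi>)"

definition Pfn :: "('o, 'a) cat \<Rightarrow> ('o, ('o, 'a) pmor) cat" where
  "Pfn C = \<lparr>Obj = Obj C,
     Arr = {pmor C m \<phi> | m \<phi>. pspan C m \<phi>},
     Dom = (\<lambda>(X, c, Y). X), Cod = (\<lambda>(X, c, Y). Y),
     Ide = (\<lambda>X. pmor C (\<one>\<^bsub>C\<^esub> X) (\<one>\<^bsub>C\<^esub> X)),
     Comp = (\<lambda>(Y', c', Z) (X, c, Y).
       (X, \<Union>(m, \<phi>)\<in>c. \<Union>(m', \<phi>')\<in>c'. \<Union>(q, r)\<in>{(q, r). is_pullback C \<phi> m' q r}.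
             pclass C (m \<cdot>\<^bsub>C\<^esub> q) (\<phi>' \<cdot>\<^bsub>C\<^esub> r), Z))\<rparr>"

definition total :: "('o, 'a) cat \<Rightarrow> 'a \<Rightarrow> ('o, 'a) pmor" where
  "total C \<phi> = pmor C (\<one>\<^bsub>C\<^esub> (Dom C \<phi>)) \<phi>"

definition pfn_box ::
  "('o, 'a) cat \<Rightarrow> ('o \<times> 'o, ('o, 'a) pmor \<times> ('o, 'a) pmor, 'o, ('o, 'a) pmor) fctr" where
  "pfn_box C = \<lparr>omap = (\<lambda>(X, Y). prod_ob C X Y),
     amap = (\<lambda>((X, c, Y), (X', c', Y')).
       (prod_ob C X X',
        \<Union>(m, \<phi>)\<in>c. \<Union>(m', \<phi>')\<in>c'. pclass C (prod_ar C m m') (prod_ar C \<phi> \<phi>'),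
        prod_ob C Y Y'))\<rparr>"

definition pfn_diag :: "('o, 'a) cat \<Rightarrow> 'o \<Rightarrow> ('o, 'a) pmor" where
  "pfn_diag C X = total C (diagonal C X)"

definition pfn_proj0 :: "('o, 'a) cat \<Rightarrow> 'o \<times> 'o \<Rightarrow> ('o, 'a) pmor" where
  "pfn_proj0 C = (\<lambda>(X, Y). total C (proj0 C X Y))"

definition pfn_proj1 :: "('o, 'a) cat \<Rightarrow> 'o \<times> 'o \<Rightarrow> ('o, 'a) pmor" where
  "pfn_proj1 C = (\<lambda>(X, Y). total C (proj1 C X Y))"


section \<open>P-categories\<close>

locale P_category_data =
  fixes C :: "('o, 'a) cat" (structure)
    and box :: "('o \<times> 'o, 'a \<times> 'a, 'o, 'a) fctr"
    and \<Delta> :: "'o \<Rightarrow> 'a"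
    and p0 p1 :: "'o \<times> 'o \<Rightarrow> 'a"
begin

definition bob :: "'o \<Rightarrow> 'o \<Rightarrow> 'o" (infixr "\<boxtimes>" 75) where
  "X \<boxtimes> Y = omap box (X, Y)"

definition bar :: "'a \<Rightarrow> 'a \<Rightarrow> 'a" (infixr "\<boxtimes>\<^sub>a" 75) where
  "f \<boxtimes>\<^sub>a g = amap box (f, g)"

definition bpair :: "'a \<Rightarrow> 'a \<Rightarrow> 'a" where
  "bpair f g = (f \<boxtimes>\<^sub>a g) \<cdot> \<Delta> (Dom C f)"

definition P_arrows :: "'a set" where
  "P_arrows = \<Inter>{S. subcategory C S \<and> (\<forall>f\<in>S. \<forall>g\<in>S. f \<boxtimes>\<^sub>a g \<in> S)
     \<and> (\<forall>X\<in>Obj C. \<forall>Y\<in>Obj C. p0 (X, Y) \<in> S \<and> p1 (X, Y) \<in> S)}"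

definition assoc :: "'o \<Rightarrow> 'o \<Rightarrow> 'o \<Rightarrow> 'a" where
  "assoc X Y Z = bpair (p0 (X, Y) \<cdot> p0 (X \<boxtimes> Y, Z))
                       (bpair (p1 (X, Y) \<cdot> p0 (X \<boxtimes> Y, Z)) (p1 (X \<boxtimes> Y, Z)))"

definition transp :: "'o \<Rightarrow> 'o \<Rightarrow> 'a" where
  "transp X Y = bpair (p1 (X, Y)) (p0 (X, Y))"

text \<open>\<open>((X, Y), Z) \<mapsto> (X \<boxtimes> Y) \<boxtimes> Z\<close> and \<open>((X, Y), Z) \<mapsto> X \<boxtimes> (Y \<boxtimes> Z)\<close>\<close>

definition box_left :: "(('o \<times> 'o) \<times> 'o, ('a \<times> 'a) \<times> 'a, 'o, 'a) fctr" where
  "box_left = comp_fctr box (pair_fctr (comp_fctr box fst_fctr) snd_fctr)"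

definition box_right :: "(('o \<times> 'o) \<times> 'o, ('a \<times> 'a) \<times> 'a, 'o, 'a) fctr" where
  "box_right = comp_fctr box
     (pair_fctr (comp_fctr fst_fctr fst_fctr)
                (comp_fctr box (pair_fctr (comp_fctr snd_fctr fst_fctr) snd_fctr)))"

end

locale P_category = P_category_data C box \<Delta> p0 p1 + category C
  for C :: "('o, 'a) cat" (structure) and box \<Delta> p0 p1 +
  assumes box_functor: "is_functor (prod_cat C C) C box"
    and \<Delta>_natural: "natural C C id_fctr (comp_fctr box (pair_fctr id_fctr id_fctr)) \<Delta>"
    and p0_infranatural: "infranatural (prod_cat C C) C box fst_fctr p0"
    and p1_infranatural: "infranatural (prod_cat C C) C box snd_fctr p1"
    and p0_\<Delta>: "X \<in> Obj C \<Longrightarrow> p0 (X, X) \<cdot> \<Delta> X = \<one> X"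
    and p1_\<Delta>: "X \<in> Obj C \<Longrightarrow> p1 (X, X) \<cdot> \<Delta> X = \<one> X"
    and p0_p1_\<Delta>: "X \<in> Obj C \<Longrightarrow> (p0 (X, X) \<boxtimes>\<^sub>a p1 (X, X)) \<cdot> \<Delta> (X \<boxtimes> X) = \<one> (X \<boxtimes> X)"
    and p0_naturalizer: "Arr C \<times> P_arrows \<subseteq> naturalizer (prod_cat C C) C box fst_fctr p0"
    and p1_naturalizer: "P_arrows \<times> Arr C \<subseteq> naturalizer (prod_cat C C) C box snd_fctr p1"
    and assoc_natural_iso: "natural_iso (prod_cat (prod_cat C C) C) C box_left box_right
                              (\<lambda>((X, Y), Z). assoc X Y Z)"
    and transp_natural_iso: "natural_iso (prod_cat C C) C box
                               (comp_fctr box (pair_fctr snd_fctr fst_fctr))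
                               (\<lambda>(X, Y). transp X Y)"
    and pentagon: "W \<in> Obj C \<Longrightarrow> X \<in> Obj C \<Longrightarrow> Y \<in> Obj C \<Longrightarrow> Z \<in> Obj C \<Longrightarrow>
           (\<one> W \<boxtimes>\<^sub>a assoc X Y Z) \<cdot> assoc W (X \<boxtimes> Y) Z \<cdot> (assoc W X Y \<boxtimes>\<^sub>a \<one> Z)
             = assoc W X (Y \<boxtimes> Z) \<cdot> assoc (W \<boxtimes> X) Y Z"
    and hexagon: "X \<in> Obj C \<Longrightarrow> Y \<in> Obj C \<Longrightarrow> Z \<in> Obj C \<Longrightarrow>
           assoc Y Z X \<cdot> transp X (Y \<boxtimes> Z) \<cdot> assoc X Y Z
             = (\<one> Y \<boxtimes>\<^sub>a transp X Z) \<cdot> assoc Y X Z \<cdot> (transp X Y \<boxtimes>\<^sub>a \<one> Z)"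
    and transp_transp: "X \<in> Obj C \<Longrightarrow> Y \<in> Obj C \<Longrightarrow> transp Y X \<cdot> transp X Y = \<one> (X \<boxtimes> Y)"

end

theory Submission
  imports Defs
begin

text \<open>
  The statement separates into a part about an arbitrary category \<open>C\<close> and a part about coalgebras.

  Suppose that \<open>C\<close> has binary products and pullbacks of monomorphisms along arbitrary arrows. Then
  partial maps compose, and \<open>X \<boxtimes> Y = X \<times> Y\<close> is functorial on them because products commute with
  pullbacks. The arrows of \<open>C\<close> sit inside \<open>Pfn C\<close> as the total maps, and the embedding respects
  composition and \<open>\<boxtimes>\<close>. Every axiom that equates composites of structure maps (the pentagon, the
  hexagon, the equations for \<open>\<Delta>\<close>) therefore is the image of an identity between tuples of projections
  in \<open>C\<close>. What remains are naturality statements against partial maps. To compose a partial map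
  \<open>{m, \<phi>}\<close> with a total map \<open>g\<close> in front of it, one pulls \<open>m\<close> back along \<open>g\<close>; hence a family of total
  maps that is natural in \<open>C\<close> is natural at \<open>{m, \<phi>}\<close> as soon as its naturality square at \<open>m\<close> is a
  pullback. This is so for an invertible family, and for the diagonal because \<open>m\<close> is mono. For the
  projection \<open>p\<^sub>0\<close> the square at \<open>(m, n)\<close> is a pullback when \<open>n\<close> is an identity, but not in general:
  a partial second argument restricts the domain of one composite only. So \<open>p\<^sub>0\<close> is natural
  against total maps in its second argument, and these suffice: total maps form a subcategory that
  is closed under \<open>\<boxtimes>\<close> and contains the projections, so every arrow of \<open>P\<close> is total. These facts make up the
  result \<open>P_category_Pfn\<close>.

  For coalgebras, weak preservation of pullbacks puts a coalgebra structure on a pullback of sets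
  such that both projections are morphisms (\<open>pullback_structure\<close>). Applied to kernel pairs, it shows
  that monomorphisms are injective (\<open>mono_inj\<close>); applied to a monomorphism and a morphism with the
  same codomain, it shows that the preimage is a subcoalgebra, which is the pullback
  (\<open>mono_pullback\<close>); applied to two inclusions, it shows that subcoalgebras are closed under binary
  intersection.

  A product of \<open>A\<close> and \<open>B\<close> is a terminal span from coalgebras to \<open>A\<close> and \<open>B\<close>. If \<open>F\<close> is bounded, the spans
  whose carrier is a subset of one fixed small set represent, up to isomorphism, all spans that are
  as small as the bound. Let \<open>K\<close> be their coproduct, and let \<open>T\<close> be its quotient by the equivalence
  generated by all pairs that some morphism of spans out of \<open>K\<close> identifies. No two distinct
  morphisms of spans end in \<open>T\<close> with the same source: their coequalizer would be a further quotient of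
  \<open>K\<close>. An arbitrary span is a union of subcoalgebras below the bound; each of them has a morphism to
  \<open>T\<close>, and any two of these agree on the intersection by uniqueness, so they glue
  (\<open>terminal_span\<close>). Finally an accessible functor is bounded (\<open>accessible_bounded\<close>): each element of
  \<open>F A\<close> has a support of bounded size, and closing a point under supports takes \<open>\<omega>\<close> steps.
\<close>

section \<open>Arrow calculus\<close>

context category begin

lemma comp_arr [simp]:
  assumes "f \<in> Arr C" "g \<in> Arr C" "Dom C g = Cod C f"
  shows "g \<cdot> f \<in> Arr C" "Dom C (g \<cdot> f) = Dom C f" "Cod C (g \<cdot> f) = Cod C g"
  using Comp_hom[of f "Dom C f" "Cod C f" g "Cod C g"] assms by (auto simp: hom_def)

lemma ide_arr [simp]:
  assumes "X \<in> Obj C"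
  shows "\<one> X \<in> Arr C" "Dom C (\<one> X) = X" "Cod C (\<one> X) = X"
  using Ide_hom[OF assms] by (auto simp: hom_def)

lemma comp_ide [simp]:
  assumes "f \<in> Arr C"
  shows "X = Dom C f \<Longrightarrow> f \<cdot> \<one> X = f" "X = Cod C f \<Longrightarrow> \<one> X \<cdot> f = f"
  using Comp_Ide[of f "Dom C f" "Cod C f"] Ide_Comp[of f "Dom C f" "Cod C f"] assms
  by (auto simp: hom_def)

lemma comp_assoc [simp]:
  assumes "f \<in> Arr C" "g \<in> Arr C" "h \<in> Arr C" "Dom C g = Cod C f" "Dom C h = Cod C g"
  shows "(h \<cdot> g) \<cdot> f = h \<cdot> (g \<cdot> f)"
  using Comp_assoc[of f "Dom C f" "Cod C f" g "Cod C g" h "Cod C h"] assms by (auto simp: hom_def)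

declare Dom_Obj [simp] Cod_Obj [simp]

lemma is_isoE:
  assumes "is_iso C f"
  obtains g where "f \<in> Arr C" "g \<in> Arr C" "Dom C g = Cod C f" "Cod C g = Dom C f"
    "g \<cdot> f = \<one> (Dom C f)" "f \<cdot> g = \<one> (Cod C f)"
  using assms by (auto simp: is_iso_def hom_def)

lemma is_isoI:
  assumes "f \<in> Arr C" "g \<in> Arr C" "Dom C g = Cod C f" "Cod C g = Dom C f"
    "g \<cdot> f = \<one> (Dom C f)" "f \<cdot> g = \<one> (Cod C f)"
  shows "is_iso C f"
  using assms by (auto simp: is_iso_def hom_def)

lemma is_iso_ide: "X \<in> Obj C \<Longrightarrow> is_iso C (\<one> X)"
  by (rule is_isoI[where g = "\<one> X"]) auto

lemma cancel_left:
  assumes "g \<cdot> f = \<one> (Dom C f)" "f \<in> Arr C" "g \<in> Arr C" "Dom C g = Cod C f" "h \<in> Arr C" "Cod C h = Dom C f"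
  shows "g \<cdot> (f \<cdot> h) = h"
  using assms comp_assoc[of h f g] by simp

lemma is_iso_comp:
  assumes "is_iso C f" "is_iso C g" "Dom C g = Cod C f"
  shows "is_iso C (g \<cdot> f)"
proof -
  obtain f' where f: "f \<in> Arr C" "f' \<in> Arr C" "Dom C f' = Cod C f" "Cod C f' = Dom C f"
    "f' \<cdot> f = \<one> (Dom C f)" "f \<cdot> f' = \<one> (Cod C f)" using assms(1) by (rule is_isoE)
  obtain g' where g: "g \<in> Arr C" "g' \<in> Arr C" "Dom C g' = Cod C g" "Cod C g' = Dom C g"
    "g' \<cdot> g = \<one> (Dom C g)" "g \<cdot> g' = \<one> (Cod C g)" using assms(2) by (rule is_isoE)
  have "g' \<cdot> (g \<cdot> f) = f" "f \<cdot> (f' \<cdot> g') = g'"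
    using f g assms(3) by (simp_all add: cancel_left)
  then show ?thesis
    by (intro is_isoI[where g = "f' \<cdot> g'"]) (use f g assms(3) in simp_all)
qed

lemma is_mono_arr: "is_mono C m \<Longrightarrow> m \<in> Arr C"
  by (simp add: is_mono_def)

lemma is_monoD:
  assumes "is_mono C m" "m \<cdot> f = m \<cdot> g" "f \<in> Arr C" "g \<in> Arr C"
    "Cod C f = Dom C m" "Cod C g = Dom C m" "Dom C f = Dom C g"
  shows "f = g"
  using assms unfolding is_mono_def by blast

lemma is_mono_ide: "X \<in> Obj C \<Longrightarrow> is_mono C (\<one> X)"
  unfolding is_mono_def by (metis comp_ide(2) ide_arr(1,2))

lemma is_mono_comp:
  assumes "is_mono C f" "is_mono C g" "Dom C g = Cod C f"
  shows "is_mono C (g \<cdot> f)"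
  unfolding is_mono_def
proof (intro conjI ballI impI)
  note a = is_mono_arr[OF assms(1)] is_mono_arr[OF assms(2)]
  show "g \<cdot> f \<in> Arr C" using a assms(3) by simp
  fix h k assume "h \<in> Arr C" "k \<in> Arr C" "Cod C h = Dom C (g \<cdot> f) \<and> Cod C k = Dom C (g \<cdot> f)
     \<and> Dom C h = Dom C k \<and> (g \<cdot> f) \<cdot> h = (g \<cdot> f) \<cdot> k"
  then have hk: "h \<in> Arr C" "k \<in> Arr C" "Cod C h = Dom C f" "Cod C k = Dom C f"
    "Dom C h = Dom C k" and e: "(g \<cdot> f) \<cdot> h = (g \<cdot> f) \<cdot> k"
    using a assms(3) by simp_all
  have "f \<cdot> h = f \<cdot> k"
    by (rule is_monoD[OF assms(2)]) (use e hk a assms(3) in simp_all)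
  then show "h = k"
    by (rule is_monoD[OF assms(1)]) (use hk a assms(3) in simp_all)
qed

lemma is_iso_mono:
  assumes "is_iso C f" shows "is_mono C f"
proof -
  obtain f' where f: "f \<in> Arr C" "f' \<in> Arr C" "Dom C f' = Cod C f" "Cod C f' = Dom C f"
    "f' \<cdot> f = \<one> (Dom C f)" using assms by (rule is_isoE)
  show ?thesis unfolding is_mono_def
    using f cancel_left[of f' f] by metis
qed

section \<open>Pullbacks\<close>

lemma is_pullbackD:
  assumes "is_pullback C f g p q"
  shows "f \<in> Arr C" "g \<in> Arr C" "p \<in> Arr C" "q \<in> Arr C" "Cod C f = Cod C g" "Dom C p = Dom C q"
    "Cod C p = Dom C f" "Cod C q = Dom C g" "f \<cdot> p = g \<cdot> q"
  using assms by (auto simp: is_pullback_def commuting_square_def)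

lemma is_pullback_mediator:
  assumes "is_pullback C f g p q" "p' \<in> Arr C" "q' \<in> Arr C" "Dom C p' = Dom C q'"
    "Cod C p' = Dom C f" "Cod C q' = Dom C g" "f \<cdot> p' = g \<cdot> q'"
  obtains h where "h \<in> Arr C" "Dom C h = Dom C p'" "Cod C h = Dom C p" "p \<cdot> h = p'" "q \<cdot> h = q'"
proof -
  have "commuting_square C f g p' q'"
    using assms by (auto simp: is_pullback_def commuting_square_def)
  then show ?thesis using assms(1) that unfolding is_pullback_def hom_def by blast
qed

lemma is_pullback_unique:
  assumes "is_pullback C f g p q" "h \<in> Arr C" "k \<in> Arr C" "Dom C h = Dom C k"
    "Cod C h = Dom C p" "Cod C k = Dom C p" "p \<cdot> h = p \<cdot> k" "q \<cdot> h = q \<cdot> k"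
  shows "h = k"
proof -
  note p = is_pullbackD[OF assms(1)]
  have "f \<cdot> (p \<cdot> h) = g \<cdot> (q \<cdot> h)"
    using p assms by (metis comp_assoc)
  then have "commuting_square C f g (p \<cdot> h) (q \<cdot> h)"
    using p assms by (auto simp: commuting_square_def)
  then have "\<exists>!h'. h' \<in> hom C (Dom C (p \<cdot> h)) (Dom C p) \<and> p \<cdot> h' = p \<cdot> h \<and> q \<cdot> h' = q \<cdot> h"
    using assms(1) unfolding is_pullback_def by blast
  then show ?thesis using p assms by (auto simp: hom_def)
qed

lemma is_pullbackI:
  assumes "f \<in> Arr C" "g \<in> Arr C" "p \<in> Arr C" "q \<in> Arr C" "Cod C f = Cod C g" "Dom C p = Dom C q"
    "Cod C p = Dom C f" "Cod C q = Dom C g" "f \<cdot> p = g \<cdot> q"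
    and ex: "\<And>p' q'. \<lbrakk>p' \<in> Arr C; q' \<in> Arr C; Dom C p' = Dom C q'; Cod C p' = Dom C f;
       Cod C q' = Dom C g; f \<cdot> p' = g \<cdot> q'\<rbrakk> \<Longrightarrow>
       \<exists>h. h \<in> Arr C \<and> Dom C h = Dom C p' \<and> Cod C h = Dom C p \<and> p \<cdot> h = p' \<and> q \<cdot> h = q'"
    and un: "\<And>h k. \<lbrakk>h \<in> Arr C; k \<in> Arr C; Dom C h = Dom C k; Cod C h = Dom C p; Cod C k = Dom C p;
       p \<cdot> h = p \<cdot> k; q \<cdot> h = q \<cdot> k\<rbrakk> \<Longrightarrow> h = k"
  shows "is_pullback C f g p q"
  unfolding is_pullback_def
proof (intro conjI allI impI)
  show "commuting_square C f g p q" using assms(1-9) by (simp add: commuting_square_def)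
  fix p' q' assume "commuting_square C f g p' q'"
  then obtain h where h: "h \<in> Arr C \<and> Dom C h = Dom C p' \<and> Cod C h = Dom C p \<and> p \<cdot> h = p' \<and> q \<cdot> h = q'"
    using ex[of p' q'] by (auto simp: commuting_square_def)
  show "\<exists>!h. h \<in> hom C (Dom C p') (Dom C p) \<and> p \<cdot> h = p' \<and> q \<cdot> h = q'"
    by (rule ex1I[of _ h]) (use h un in \<open>auto simp: hom_def\<close>)
qed

lemma is_pullback_sym:
  assumes "is_pullback C f g p q" shows "is_pullback C g f q p"
proof (rule is_pullbackI)
  fix p' q' assume "p' \<in> Arr C" "q' \<in> Arr C" "Dom C p' = Dom C q'" "Cod C p' = Dom C g"
       "Cod C q' = Dom C f" "g \<cdot> p' = f \<cdot> q'"
  then show "\<exists>h. h \<in> Arr C \<and> Dom C h = Dom C p' \<and> Cod C h = Dom C q \<and> q \<cdot> h = p' \<and> p \<cdot> h = q'"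
    using is_pullbackD[OF assms] by (metis is_pullback_mediator[OF assms, of q' p'])
next
  fix h k assume "h \<in> Arr C" "k \<in> Arr C" "Dom C h = Dom C k" "Cod C h = Dom C q" "Cod C k = Dom C q"
       "q \<cdot> h = q \<cdot> k" "p \<cdot> h = p \<cdot> k"
  then show "h = k" using is_pullbackD[OF assms] by (metis is_pullback_unique[OF assms, of h k])
qed (use is_pullbackD[OF assms] in auto)

text \<open>
  Pasting is what makes composition of partial maps associative: both bracketings of a triple
  composite are read off from one diagram of three pullbacks, pasted along one edge or the other.
\<close>

lemma is_pullback_paste:
  assumes 1: "is_pullback C f g p q" and 2: "is_pullback C q h s t"
  shows "is_pullback C f (g \<cdot> h) (p \<cdot> s) t"
proof -
  note a = is_pullbackD[OF 1] and b = is_pullbackD[OF 2]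
  show ?thesis
  proof (rule is_pullbackI)
    have "f \<cdot> p \<cdot> s = (f \<cdot> p) \<cdot> s" using a(1-8) b(1-8) by simp
    also have "\<dots> = g \<cdot> q \<cdot> s" using a b by simp
    also have "\<dots> = (g \<cdot> h) \<cdot> t" using a b by simp
    finally show "f \<cdot> p \<cdot> s = (g \<cdot> h) \<cdot> t" .
  next
    fix p' q' assume c: "p' \<in> Arr C" "q' \<in> Arr C" "Dom C p' = Dom C q'" "Cod C p' = Dom C f"
       "Cod C q' = Dom C (g \<cdot> h)" and e: "f \<cdot> p' = (g \<cdot> h) \<cdot> q'"
    have c': "Cod C q' = Dom C h" using c a b by simp
    have e': "f \<cdot> p' = g \<cdot> (h \<cdot> q')" using e a b c c' by simp
    obtain k where k: "k \<in> Arr C" "Dom C k = Dom C p'" "Cod C k = Dom C p" "p \<cdot> k = p'" "q \<cdot> k = h \<cdot> q'"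
      by (rule is_pullback_mediator[OF 1 _ _ _ _ _ e']) (use a b c c' in simp_all)
    obtain l where l: "l \<in> Arr C" "Dom C l = Dom C k" "Cod C l = Dom C s" "s \<cdot> l = k" "t \<cdot> l = q'"
      by (rule is_pullback_mediator[OF 2 _ _ _ _ _ k(5)]) (use a b c c' k(1-3) in simp_all)
    have "(p \<cdot> s) \<cdot> l = p'" using a b k(4) l by simp
    then show "\<exists>h. h \<in> Arr C \<and> Dom C h = Dom C p' \<and> Cod C h = Dom C (p \<cdot> s) \<and> (p \<cdot> s) \<cdot> h = p' \<and> t \<cdot> h = q'"
      using l k(2) a b by (intro exI[of _ l]) simp
  next
    fix k l assume c: "k \<in> Arr C" "l \<in> Arr C" "Dom C k = Dom C l" "Cod C k = Dom C (p \<cdot> s)"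
      "Cod C l = Dom C (p \<cdot> s)" and e: "(p \<cdot> s) \<cdot> k = (p \<cdot> s) \<cdot> l" and e': "t \<cdot> k = t \<cdot> l"
    have c': "Cod C k = Dom C s" "Cod C l = Dom C s" using c a b by simp_all
    have "q \<cdot> (s \<cdot> k) = (h \<cdot> t) \<cdot> k" using a b c c' by (metis comp_assoc)
    also have "\<dots> = (h \<cdot> t) \<cdot> l" using a b c c' e' by simp
    also have "\<dots> = q \<cdot> (s \<cdot> l)" using a b c c' by (metis comp_assoc)
    finally have qe: "q \<cdot> (s \<cdot> k) = q \<cdot> (s \<cdot> l)" .
    have se: "s \<cdot> k = s \<cdot> l"
      by (rule is_pullback_unique[OF 1]) (use a b c c' e qe in simp_all)
    show "k = l"
      by (rule is_pullback_unique[OF 2]) (use c c' se e' in simp_all)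
  qed (use a b in simp_all)
qed

lemma is_pullback_paste':
  assumes "is_pullback C f g p q" and "is_pullback C h p t s"
  shows "is_pullback C (f \<cdot> h) g t (q \<cdot> s)"
  using is_pullback_sym is_pullback_paste assms by blast

text \<open>
  This makes the composite of two partial maps a partial map again: its domain of definition is a
  pullback of a domain of definition, included by a monomorphism.
\<close>

lemma is_pullback_mono:
  assumes "is_pullback C f m q r" "is_mono C m"
  shows "is_mono C q"
  unfolding is_mono_def
proof (intro conjI ballI impI)
  note a = is_pullbackD[OF assms(1)]
  show "q \<in> Arr C" by (fact a)
  fix h k assume "h \<in> Arr C" "k \<in> Arr C" "Cod C h = Dom C q \<and> Cod C k = Dom C q
     \<and> Dom C h = Dom C k \<and> q \<cdot> h = q \<cdot> k"
  then have hk: "h \<in> Arr C" "k \<in> Arr C" "Cod C h = Dom C q" "Cod C k = Dom C q"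
    "Dom C h = Dom C k" and e: "q \<cdot> h = q \<cdot> k"
    by simp_all
  have "m \<cdot> r \<cdot> h = (f \<cdot> q) \<cdot> h" using hk a by simp
  also have "\<dots> = (f \<cdot> q) \<cdot> k" using hk a(1-8) e by simp
  also have "\<dots> = m \<cdot> r \<cdot> k" using hk a by simp
  finally have "r \<cdot> h = r \<cdot> k"
    by (rule is_monoD[OF assms(2)]) (use hk a in simp_all)
  then show "h = k"
    using is_pullback_unique[OF assms(1) hk(1,2,5,3,4) e] by blast
qed

text \<open>
  A cone \<open>(u, v)\<close> can only factor through \<open>q\<inverse> v\<close>, and it does because \<open>f\<close> can be cancelled. In
  particular the naturality squares of a natural isomorphism are pullbacks.
\<close>

lemma is_pullback_iso:
  assumes "g \<in> Arr C" "p \<in> Arr C" "is_iso C f" "is_iso C q" "Cod C f = Cod C g" "Dom C p = Dom C q"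
    "Cod C p = Dom C f" "Cod C q = Dom C g" "f \<cdot> p = g \<cdot> q"
  shows "is_pullback C f g p q"
proof -
  obtain q' where q: "q \<in> Arr C" "q' \<in> Arr C" "Dom C q' = Cod C q" "Cod C q' = Dom C q"
    "q' \<cdot> q = \<one> (Dom C q)" "q \<cdot> q' = \<one> (Cod C q)" using assms(4) by (rule is_isoE)
  have f: "f \<in> Arr C" using assms(3) by (simp add: is_iso_def)
  show ?thesis
  proof (rule is_pullbackI)
    fix u v assume u: "u \<in> Arr C" "v \<in> Arr C" "Dom C u = Dom C v" "Cod C u = Dom C f"
       "Cod C v = Dom C g" and e: "f \<cdot> u = g \<cdot> v"
    have qv: "q \<cdot> q' \<cdot> v = v" using cancel_left[of q q' v] q u assms by simp
    have "f \<cdot> (p \<cdot> q' \<cdot> v) = (f \<cdot> p) \<cdot> q' \<cdot> v" using assms(1,2,5-8) f q u by simp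
    also have "\<dots> = g \<cdot> q \<cdot> q' \<cdot> v" using assms f q u by simp
    also have "\<dots> = f \<cdot> u" using qv e by simp
    finally have "p \<cdot> q' \<cdot> v = u"
      by (rule is_monoD[OF is_iso_mono[OF assms(3)]]) (use assms(1,2,5-8) f q u in simp_all)
    then show "\<exists>h. h \<in> Arr C \<and> Dom C h = Dom C u \<and> Cod C h = Dom C p \<and> p \<cdot> h = u \<and> q \<cdot> h = v"
      using qv q u assms by (intro exI[of _ "q' \<cdot> v"]) simp
  next
    fix h k assume "h \<in> Arr C" "k \<in> Arr C" "Dom C h = Dom C k" "Cod C h = Dom C p" "Cod C k = Dom C p"
      "q \<cdot> h = q \<cdot> k"
    then show "h = k" using is_monoD[OF is_iso_mono[OF assms(4)]] assms(6) by metis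
  qed (use assms f q in simp_all)
qed

text \<open>
  Passing to another representative of a partial map changes an edge of the cospan by an
  isomorphism, which then reappears in the projection.
\<close>

lemma is_pullback_comp_iso:
  assumes 1: "is_pullback C (f \<cdot> \<theta>) g p q" and t: "is_iso C \<theta>" and f: "f \<in> Arr C" "Dom C f = Cod C \<theta>"
  shows "is_pullback C f g (\<theta> \<cdot> p) q"
proof -
  obtain \<theta>' where t: "\<theta> \<in> Arr C" "\<theta>' \<in> Arr C" "Dom C \<theta>' = Cod C \<theta>" "Cod C \<theta>' = Dom C \<theta>"
    "\<theta>' \<cdot> \<theta> = \<one> (Dom C \<theta>)" "\<theta> \<cdot> \<theta>' = \<one> (Cod C \<theta>)" using t by (rule is_isoE)
  note a = is_pullbackD[OF 1]
  have p: "p \<in> Arr C" "Cod C p = Dom C \<theta>" "q \<in> Arr C" "Dom C p = Dom C q" "Cod C q = Dom C g" "g \<in> Arr C"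
    "Cod C f = Cod C g" and e: "f \<cdot> \<theta> \<cdot> p = g \<cdot> q"
    using a t f by simp_all
  show ?thesis
  proof (rule is_pullbackI)
    fix u v assume u: "u \<in> Arr C" "v \<in> Arr C" "Dom C u = Dom C v" "Cod C u = Dom C f"
       "Cod C v = Dom C g" and e: "f \<cdot> u = g \<cdot> v"
    have tu: "\<theta> \<cdot> \<theta>' \<cdot> u = u" using cancel_left[of \<theta> \<theta>' u] t u f by simp
    have e': "(f \<cdot> \<theta>) \<cdot> (\<theta>' \<cdot> u) = g \<cdot> v" using tu e t(1-4) u f by simp
    obtain h where h: "h \<in> Arr C" "Dom C h = Dom C (\<theta>' \<cdot> u)" "Cod C h = Dom C p" "p \<cdot> h = \<theta>' \<cdot> u" "q \<cdot> h = v"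
      by (rule is_pullback_mediator[OF 1 _ _ _ _ _ e']) (use t u f in simp_all)
    have "(\<theta> \<cdot> p) \<cdot> h = u" using h p t(1-4) tu u f by simp
    then show "\<exists>h. h \<in> Arr C \<and> Dom C h = Dom C u \<and> Cod C h = Dom C (\<theta> \<cdot> p) \<and> (\<theta> \<cdot> p) \<cdot> h = u \<and> q \<cdot> h = v"
      using h p t(1-4) u f by (intro exI[of _ h]) simp
  next
    fix h k assume h: "h \<in> Arr C" "k \<in> Arr C" "Dom C h = Dom C k" "Cod C h = Dom C (\<theta> \<cdot> p)" "Cod C k = Dom C (\<theta> \<cdot> p)"
      "(\<theta> \<cdot> p) \<cdot> h = (\<theta> \<cdot> p) \<cdot> k" "q \<cdot> h = q \<cdot> k"
    have h': "Cod C h = Dom C p" "Cod C k = Dom C p" using h(4,5) p t by simp_all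
    have "\<theta>' \<cdot> \<theta> \<cdot> (p \<cdot> h) = p \<cdot> h" "\<theta>' \<cdot> \<theta> \<cdot> (p \<cdot> k) = p \<cdot> k"
      using cancel_left[of \<theta>' \<theta> "p \<cdot> h"] cancel_left[of \<theta>' \<theta> "p \<cdot> k"] t h(1-3) h' p by simp_all
    moreover have "\<theta> \<cdot> (p \<cdot> h) = \<theta> \<cdot> (p \<cdot> k)" using h(6) h(1-3) h' p t(1) by simp
    ultimately have "p \<cdot> h = p \<cdot> k" by metis
    then show "h = k" using is_pullback_unique[OF 1 h(1-3) h' _ h(7)] by blast
  qed (use e p t f in simp_all)
qed

lemma is_pullback_unique_iso:
  assumes 1: "is_pullback C f g p q" and 2: "is_pullback C f g p' q'"
  obtains k where "is_iso C k" "Dom C k = Dom C p'" "Cod C k = Dom C p" "p \<cdot> k = p'" "q \<cdot> k = q'"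
proof -
  note a = is_pullbackD[OF 1] and b = is_pullbackD[OF 2]
  obtain k where k: "k \<in> Arr C" "Dom C k = Dom C p'" "Cod C k = Dom C p" "p \<cdot> k = p'" "q \<cdot> k = q'"
    by (rule is_pullback_mediator[OF 1 b(3,4,6,7,8,9)])
  obtain l where l: "l \<in> Arr C" "Dom C l = Dom C p" "Cod C l = Dom C p'" "p' \<cdot> l = p" "q' \<cdot> l = q"
    by (rule is_pullback_mediator[OF 2 a(3,4,6,7,8,9)])
  have "p \<cdot> (k \<cdot> l) = p" "q \<cdot> (k \<cdot> l) = q"
    using k l a b comp_assoc[of l k p] comp_assoc[of l k q] by simp_all
  then have kl: "k \<cdot> l = \<one> (Dom C p)"
    using is_pullback_unique[OF 1, of "k \<cdot> l" "\<one> (Dom C p)"] a(1-8) k(1-3) l(1-3) by auto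
  have "p' \<cdot> (l \<cdot> k) = p'" "q' \<cdot> (l \<cdot> k) = q'"
    using k l a b comp_assoc[of k l p'] comp_assoc[of k l q'] by simp_all
  then have lk: "l \<cdot> k = \<one> (Dom C p')"
    using is_pullback_unique[OF 2, of "l \<cdot> k" "\<one> (Dom C p')"] b(1-8) k(1-3) l(1-3) by auto
  have "is_iso C k"
    by (rule is_isoI[where g = l]) (use k(1-3) l(1-3) kl lk in simp_all)
  then show ?thesis using k that by blast
qed

section \<open>Classes of spans\<close>

lemma pspan_arr:
  assumes "pspan C m \<phi>"
  shows "is_mono C m" "m \<in> Arr C" "\<phi> \<in> Arr C" "Dom C m = Dom C \<phi>"
  using assms by (auto simp: pspan_def is_mono_def)

lemma pspanI: "is_mono C m \<Longrightarrow> \<phi> \<in> Arr C \<Longrightarrow> Dom C m = Dom C \<phi> \<Longrightarrow> pspan C m \<phi>"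
  by (simp add: pspan_def)

lemma pclassE:
  assumes "(m', \<phi>') \<in> pclass C m \<phi>"
  obtains \<theta> where "pspan C m' \<phi>'" "is_iso C \<theta>" "\<theta> \<in> Arr C" "Dom C \<theta> = Dom C m" "Cod C \<theta> = Dom C m'"
    "m = m' \<cdot> \<theta>" "\<phi> = \<phi>' \<cdot> \<theta>"
  using assms by (auto simp: pclass_def hom_def)

lemma pclassI:
  assumes "pspan C m' \<phi>'" "is_iso C \<theta>" "Dom C \<theta> = Dom C m" "Cod C \<theta> = Dom C m'"
    "m = m' \<cdot> \<theta>" "\<phi> = \<phi>' \<cdot> \<theta>"
  shows "(m', \<phi>') \<in> pclass C m \<phi>"
  using assms unfolding pclass_def hom_def is_iso_def by blast

lemma pclass_refl: "pspan C m \<phi> \<Longrightarrow> (m, \<phi>) \<in> pclass C m \<phi>"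
  using pspan_arr[of m \<phi>] by (intro pclassI[where \<theta> = "\<one> (Dom C m)"] is_iso_ide) auto

lemma pclass_trans:
  assumes "(m', \<phi>') \<in> pclass C m \<phi>" "(m'', \<phi>'') \<in> pclass C m' \<phi>'"
  shows "(m'', \<phi>'') \<in> pclass C m \<phi>"
proof -
  obtain \<theta> where t: "pspan C m' \<phi>'" "is_iso C \<theta>" "\<theta> \<in> Arr C" "Dom C \<theta> = Dom C m" "Cod C \<theta> = Dom C m'"
    "m = m' \<cdot> \<theta>" "\<phi> = \<phi>' \<cdot> \<theta>" using assms(1) by (rule pclassE)
  obtain \<eta> where e: "pspan C m'' \<phi>''" "is_iso C \<eta>" "\<eta> \<in> Arr C" "Dom C \<eta> = Dom C m'" "Cod C \<eta> = Dom C m''"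
    "m' = m'' \<cdot> \<eta>" "\<phi>' = \<phi>'' \<cdot> \<eta>" using assms(2) by (rule pclassE)
  note p = pspan_arr[OF e(1)]
  show ?thesis
    by (rule pclassI[where \<theta> = "\<eta> \<cdot> \<theta>"])
      (use t(2-5) e(1-5) p is_iso_comp[of \<theta> \<eta>] t(6,7)[unfolded e(6,7)] in simp_all)
qed

lemma pclass_sym:
  assumes "(m', \<phi>') \<in> pclass C m \<phi>" "pspan C m \<phi>"
  shows "(m, \<phi>) \<in> pclass C m' \<phi>'"
proof -
  obtain \<theta> where t: "pspan C m' \<phi>'" "is_iso C \<theta>" "\<theta> \<in> Arr C" "Dom C \<theta> = Dom C m" "Cod C \<theta> = Dom C m'"
    "m = m' \<cdot> \<theta>" "\<phi> = \<phi>' \<cdot> \<theta>" using assms(1) by (rule pclassE)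
  obtain \<eta> where e: "\<eta> \<in> Arr C" "Dom C \<eta> = Cod C \<theta>" "Cod C \<eta> = Dom C \<theta>" "\<eta> \<cdot> \<theta> = \<one> (Dom C \<theta>)"
    "\<theta> \<cdot> \<eta> = \<one> (Cod C \<theta>)" using t(2) by (rule is_isoE)
  note p = pspan_arr[OF t(1)] and p' = pspan_arr[OF assms(2)]
  have i: "is_iso C \<eta>" by (rule is_isoI[where g = \<theta>]) (use t e in simp_all)
  have "m \<cdot> \<eta> = m'" "\<phi> \<cdot> \<eta> = \<phi>'" using t(3-7) e p by simp_all
  then show ?thesis
    by (intro pclassI[OF assms(2) i]) (use t(4,5) e(2,3) in simp_all)
qed

lemma pclass_eqI:
  assumes "(m', \<phi>') \<in> pclass C m \<phi>" "pspan C m \<phi>"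
  shows "pclass C m' \<phi>' = pclass C m \<phi>"
  using pclass_trans[OF assms(1)] pclass_trans[OF pclass_sym[OF assms]] by auto

lemma pspan_comp:
  assumes "pspan C m \<phi>" "pspan C m' \<phi>'" "is_pullback C \<phi> m' q r"
  shows "pspan C (m \<cdot> q) (\<phi>' \<cdot> r)"
proof -
  note a = is_pullbackD[OF assms(3)] and p = pspan_arr[OF assms(1)] and p' = pspan_arr[OF assms(2)]
  have "is_mono C q" using is_pullback_mono[OF assms(3) p'(1)] .
  then show ?thesis using a p p' by (intro pspanI is_mono_comp) simp_all
qed

text \<open>
  The composite does not depend on the representatives or on the choice of the pullback, since the
  isomorphisms between representatives turn one of the two pullbacks into a pullback of the other
  cospan. Hence the union that defines composition in \<open>Pfn C\<close> consists of a single class.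
\<close>

lemma pclass_comp_well_defined:
  assumes 1: "(m1, \<phi>1) \<in> pclass C m \<phi>" and 2: "(m1', \<phi>1') \<in> pclass C m' \<phi>'"
    and s: "pspan C m \<phi>" "pspan C m' \<phi>'"
    and 3: "is_pullback C \<phi> m' q r" and 4: "is_pullback C \<phi>1 m1' q1 r1"
  shows "pclass C (m1 \<cdot> q1) (\<phi>1' \<cdot> r1) = pclass C (m \<cdot> q) (\<phi>' \<cdot> r)"
proof (rule pclass_eqI)
  obtain \<theta> where t: "pspan C m1 \<phi>1" "is_iso C \<theta>" "\<theta> \<in> Arr C" "Dom C \<theta> = Dom C m" "Cod C \<theta> = Dom C m1"
    "m = m1 \<cdot> \<theta>" "\<phi> = \<phi>1 \<cdot> \<theta>" using 1 by (rule pclassE)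
  obtain \<eta> where e: "pspan C m1' \<phi>1'" "is_iso C \<eta>" "\<eta> \<in> Arr C" "Dom C \<eta> = Dom C m'" "Cod C \<eta> = Dom C m1'"
    "m' = m1' \<cdot> \<eta>" "\<phi>' = \<phi>1' \<cdot> \<eta>" using 2 by (rule pclassE)
  note p1 = pspan_arr[OF t(1)] and p1' = pspan_arr[OF e(1)] and p = pspan_arr[OF s(1)] and p' = pspan_arr[OF s(2)]
  note a = is_pullbackD[OF 3] and b = is_pullbackD[OF 4]
  have "is_pullback C \<phi>1 m' (\<theta> \<cdot> q) r"
    by (rule is_pullback_comp_iso[OF 3[unfolded t(7)] t(2)]) (use p1 t in simp_all)
  then have pb: "is_pullback C \<phi>1 m1' (\<theta> \<cdot> q) (\<eta> \<cdot> r)"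
    using is_pullback_sym[THEN is_pullback_comp_iso[of m1' \<eta>, THEN is_pullback_sym]] e p1' by metis
  obtain k where k: "is_iso C k" "Dom C k = Dom C (\<theta> \<cdot> q)" "Cod C k = Dom C q1"
    "q1 \<cdot> k = \<theta> \<cdot> q" "r1 \<cdot> k = \<eta> \<cdot> r"
    using is_pullback_unique_iso[OF 4 pb] by metis
  have ka: "k \<in> Arr C" using k(1) by (simp add: is_iso_def)
  show "(m1 \<cdot> q1, \<phi>1' \<cdot> r1) \<in> pclass C (m \<cdot> q) (\<phi>' \<cdot> r)"
  proof (rule pclassI[OF _ k(1)])
    show "pspan C (m1 \<cdot> q1) (\<phi>1' \<cdot> r1)" by (rule pspan_comp[OF t(1) e(1) 4])
    show "m \<cdot> q = (m1 \<cdot> q1) \<cdot> k" "\<phi>' \<cdot> r = (\<phi>1' \<cdot> r1) \<cdot> k"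
      unfolding t(6) e(7)
      using k ka a(2-8) b(1-8) t(2-5) e(2-5) p1 p1' p p' by simp_all
  qed (use k ka a b t(1-5) e(1-5) p1 p1' p p' in simp_all)
  show "pspan C (m \<cdot> q) (\<phi>' \<cdot> r)" by (rule pspan_comp[OF s 3])
qed

end

section \<open>Functors on product categories\<close>

lemma category_prod_cat:
  assumes "category C" "category D" shows "category (prod_cat C D)"
proof -
  interpret C: category C by fact
  interpret D: category D by fact
  have hom: "h \<in> hom (prod_cat C D) X Y \<longleftrightarrow>
      fst h \<in> hom C (fst X) (fst Y) \<and> snd h \<in> hom D (snd X) (snd Y)" for h X Y
    by (auto simp: hom_def prod_cat_def split: prod.splits)
  have sel: "Comp (prod_cat C D) g f = (fst g \<cdot>\<^bsub>C\<^esub> fst f, snd g \<cdot>\<^bsub>D\<^esub> snd f)" 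
    "Ide (prod_cat C D) X = (\<one>\<^bsub>C\<^esub> (fst X), \<one>\<^bsub>D\<^esub> (snd X))"
    "X \<in> Obj (prod_cat C D) \<longleftrightarrow> fst X \<in> Obj C \<and> snd X \<in> Obj D" for f g X
    by (cases X; auto simp: prod_cat_def split: prod.splits)+
  show ?thesis
  proof
    fix f g X Y Z assume "f \<in> hom (prod_cat C D) X Y" "g \<in> hom (prod_cat C D) Y Z"
    then show "g \<cdot>\<^bsub>prod_cat C D\<^esub> f \<in> hom (prod_cat C D) X Z"
      using C.Comp_hom D.Comp_hom by (simp add: hom sel) blast
  next
    fix f g h W X Y Z assume "f \<in> hom (prod_cat C D) W X" "g \<in> hom (prod_cat C D) X Y" "h \<in> hom (prod_cat C D) Y Z"
    then show "(h \<cdot>\<^bsub>prod_cat C D\<^esub> g) \<cdot>\<^bsub>prod_cat C D\<^esub> f = h \<cdot>\<^bsub>prod_cat C D\<^esub> (g \<cdot>\<^bsub>prod_cat C D\<^esub> f)"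
      using C.Comp_assoc D.Comp_assoc by (simp add: hom sel) blast
  qed (auto simp: hom sel C.Ide_hom D.Ide_hom C.Comp_Ide D.Comp_Ide C.Ide_Comp D.Ide_Comp,
       auto simp: prod_cat_def C.Dom_Obj C.Cod_Obj D.Dom_Obj D.Cod_Obj)
qed

lemma is_functorD:
  assumes "is_functor C D G"
  shows "category C" "category D" "X \<in> Obj C \<Longrightarrow> omap G X \<in> Obj D"
    "f \<in> Arr C \<Longrightarrow> amap G f \<in> hom D (omap G (Dom C f)) (omap G (Cod C f))"
    "X \<in> Obj C \<Longrightarrow> amap G (\<one>\<^bsub>C\<^esub> X) = \<one>\<^bsub>D\<^esub> (omap G X)"
    "f \<in> Arr C \<Longrightarrow> g \<in> Arr C \<Longrightarrow> Dom C g = Cod C f \<Longrightarrow> amap G (g \<cdot>\<^bsub>C\<^esub> f) = amap G g \<cdot>\<^bsub>D\<^esub> amap G f"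
  using assms by (auto simp: is_functor_def)

lemma is_functor_id: "category C \<Longrightarrow> is_functor C C id_fctr"
  by (auto simp: is_functor_def id_fctr_def hom_def)

lemma is_functor_fst: "category C \<Longrightarrow> category D \<Longrightarrow> is_functor (prod_cat C D) C fst_fctr"
  unfolding is_functor_def by (auto simp: category_prod_cat) (auto simp: prod_cat_def fst_fctr_def hom_def)

lemma is_functor_snd: "category C \<Longrightarrow> category D \<Longrightarrow> is_functor (prod_cat C D) D snd_fctr"
  unfolding is_functor_def by (auto simp: category_prod_cat) (auto simp: prod_cat_def snd_fctr_def hom_def)

lemma is_functor_comp:
  assumes G: "is_functor C D G" and H: "is_functor D E H"
  shows "is_functor C E (comp_fctr H G)"
proof -
  have "amap G f \<in> Arr D" "Dom D (amap G f) = omap G (Dom C f)" "Cod D (amap G f) = omap G (Cod C f)" if "f \<in> Arr C" for f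
    using is_functorD(4)[OF G that] by (auto simp: hom_def)
  then show ?thesis
    unfolding is_functor_def
    using is_functorD[OF G] is_functorD[OF H] by (auto simp: comp_fctr_def hom_def)
qed

lemma is_functor_pair:
  assumes "is_functor C D G" "is_functor C E H"
  shows "is_functor C (prod_cat D E) (pair_fctr G H)"
  unfolding is_functor_def
  using is_functorD[OF assms(1)] is_functorD[OF assms(2)]
  by (auto simp: category_prod_cat) (auto simp: prod_cat_def pair_fctr_def hom_def)

lemma prod_cat_simps [simp]:
  "Obj (prod_cat A B) = Obj A \<times> Obj B" "Arr (prod_cat A B) = Arr A \<times> Arr B"
  "Dom (prod_cat A B) (f, g) = (Dom A f, Dom B g)" "Cod (prod_cat A B) (f, g) = (Cod A f, Cod B g)"
  "Ide (prod_cat A B) (X, Y) = (\<one>\<^bsub>A\<^esub> X, \<one>\<^bsub>B\<^esub> Y)"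
  "(f', g') \<cdot>\<^bsub>prod_cat A B\<^esub> (f, g) = (f' \<cdot>\<^bsub>A\<^esub> f, g' \<cdot>\<^bsub>B\<^esub> g)"
  by (simp_all add: prod_cat_def)

section \<open>Binary products\<close>

locale product_category = category C for C :: "('o, 'a) cat" (structure) +
  assumes has_products: "X \<in> Obj C \<Longrightarrow> Y \<in> Obj C \<Longrightarrow> \<exists>P p q. is_product C X Y P p q"
begin

lemma is_product_product:
  assumes "X \<in> Obj C" "Y \<in> Obj C"
  shows "is_product C X Y (prod_ob C X Y) (proj0 C X Y) (proj1 C X Y)"
proof -
  have "\<exists>t. case t of (P, p, q) \<Rightarrow> is_product C X Y P p q" using has_products[OF assms] by auto
  then have "case product C X Y of (P, p, q) \<Rightarrow> is_product C X Y P p q"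
    unfolding product_def by (rule someI_ex)
  then show ?thesis by (simp add: prod_ob_def proj0_def proj1_def split: prod.splits)
qed

lemma proj_arr [simp]:
  assumes "X \<in> Obj C" "Y \<in> Obj C"
  shows "prod_ob C X Y \<in> Obj C"
    "proj0 C X Y \<in> Arr C" "Dom C (proj0 C X Y) = prod_ob C X Y" "Cod C (proj0 C X Y) = X"
    "proj1 C X Y \<in> Arr C" "Dom C (proj1 C X Y) = prod_ob C X Y" "Cod C (proj1 C X Y) = Y"
  using is_product_product[OF assms] by (auto simp: is_product_def hom_def)

lemma tuple_ex1:
  assumes "f \<in> Arr C" "g \<in> Arr C" "Dom C f = Dom C g"
  shows "\<exists>!h. h \<in> hom C (Dom C f) (prod_ob C (Cod C f) (Cod C g))
     \<and> proj0 C (Cod C f) (Cod C g) \<cdot> h = f \<and> proj1 C (Cod C f) (Cod C g) \<cdot> h = g"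
proof -
  have "f \<in> hom C (Dom C f) (Cod C f) \<and> g \<in> hom C (Dom C f) (Cod C g)"
    using assms by (simp add: hom_def)
  then show ?thesis
    using is_product_product[of "Cod C f" "Cod C g"] assms unfolding is_product_def by auto
qed

lemma tuple_arr [simp]:
  assumes "f \<in> Arr C" "g \<in> Arr C" "Dom C f = Dom C g"
  shows "tuple C f g \<in> Arr C" "Dom C (tuple C f g) = Dom C g"
    "Cod C (tuple C f g) = prod_ob C (Cod C f) (Cod C g)"
  using theI'[OF tuple_ex1[OF assms]] assms unfolding tuple_def[symmetric] by (auto simp: hom_def)

lemma proj_tuple [simp]:
  assumes "f \<in> Arr C" "g \<in> Arr C" "Dom C f = Dom C g" "Cod C f = X" "Cod C g = Y"
  shows "proj0 C X Y \<cdot> tuple C f g = f" "proj1 C X Y \<cdot> tuple C f g = g"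
  using theI'[OF tuple_ex1[OF assms(1-3)]] assms unfolding tuple_def[symmetric] by (auto simp: hom_def)

lemma proj_jointly_mono:
  assumes "proj0 C X Y \<cdot> h = proj0 C X Y \<cdot> k" "proj1 C X Y \<cdot> h = proj1 C X Y \<cdot> k" 
    "X \<in> Obj C" "Y \<in> Obj C" "h \<in> Arr C" "k \<in> Arr C" "Dom C h = Dom C k"
    "Cod C h = prod_ob C X Y" "Cod C k = prod_ob C X Y"
  shows "h = k"
  using tuple_ex1[of "proj0 C X Y \<cdot> h" "proj1 C X Y \<cdot> h"] assms by (auto simp: hom_def)

lemma tuple_comp [simp]:
  assumes "f \<in> Arr C" "g \<in> Arr C" "h \<in> Arr C" "Dom C f = Dom C g" "Dom C g = Cod C h"
  shows "tuple C f g \<cdot> h = tuple C (f \<cdot> h) (g \<cdot> h)"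
proof (rule proj_jointly_mono[where X = "Cod C f" and Y = "Cod C g"])
  have e: "proj0 C (Cod C f) (Cod C g) \<cdot> tuple C f g \<cdot> h = (proj0 C (Cod C f) (Cod C g) \<cdot> tuple C f g) \<cdot> h"
    "proj1 C (Cod C f) (Cod C g) \<cdot> tuple C f g \<cdot> h = (proj1 C (Cod C f) (Cod C g) \<cdot> tuple C f g) \<cdot> h"
    by (subst comp_assoc; use assms in simp)+
  show "proj0 C (Cod C f) (Cod C g) \<cdot> tuple C f g \<cdot> h = proj0 C (Cod C f) (Cod C g) \<cdot> tuple C (f \<cdot> h) (g \<cdot> h)"
    "proj1 C (Cod C f) (Cod C g) \<cdot> tuple C f g \<cdot> h = proj1 C (Cod C f) (Cod C g) \<cdot> tuple C (f \<cdot> h) (g \<cdot> h)"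
    unfolding e using assms by simp_all
qed (use assms in simp_all)

lemma tuple_proj [simp]:
  "X \<in> Obj C \<Longrightarrow> Y \<in> Obj C \<Longrightarrow> tuple C (proj0 C X Y) (proj1 C X Y) = \<one> (prod_ob C X Y)"
  by (rule proj_jointly_mono[where X = X and Y = Y]) simp_all

lemma tuple_proj_comp [simp]:
  "X \<in> Obj C \<Longrightarrow> Y \<in> Obj C \<Longrightarrow> h \<in> Arr C \<Longrightarrow> Cod C h = prod_ob C X Y \<Longrightarrow>
   tuple C (proj0 C X Y \<cdot> h) (proj1 C X Y \<cdot> h) = h"
  by (rule proj_jointly_mono[where X = X and Y = Y]) simp_all

lemma tuple_eq_iff:
  assumes "f \<in> Arr C" "g \<in> Arr C" "Dom C f = Dom C g"
   "f' \<in> Arr C" "g' \<in> Arr C" "Dom C f' = Dom C g'" "Cod C f = Cod C f'" "Cod C g = Cod C g'"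
  shows "tuple C f g = tuple C f' g' \<longleftrightarrow> f = f' \<and> g = g'"
  using proj_tuple[OF assms(1-3) refl refl] proj_tuple[OF assms(4-6) refl refl] assms(7,8) by metis

lemma prod_ar_arr [simp]:
  assumes "f \<in> Arr C" "g \<in> Arr C"
  shows "prod_ar C f g \<in> Arr C" "Dom C (prod_ar C f g) = prod_ob C (Dom C f) (Dom C g)"
    "Cod C (prod_ar C f g) = prod_ob C (Cod C f) (Cod C g)"
  using assms by (simp_all add: prod_ar_def)

lemma proj_prod_ar:
  assumes "f \<in> Arr C" "g \<in> Arr C"
  shows "proj0 C (Cod C f) (Cod C g) \<cdot> prod_ar C f g = f \<cdot> proj0 C (Dom C f) (Dom C g)"
    "proj1 C (Cod C f) (Cod C g) \<cdot> prod_ar C f g = g \<cdot> proj1 C (Dom C f) (Dom C g)"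
  using assms by (simp_all add: prod_ar_def)

lemma prod_ar_tuple:
  assumes "f \<in> Arr C" "g \<in> Arr C" "h \<in> Arr C" "k \<in> Arr C" "Dom C h = Dom C k" "Dom C f = Cod C h" "Dom C g = Cod C k"
  shows "prod_ar C f g \<cdot> tuple C h k = tuple C (f \<cdot> h) (g \<cdot> k)"
  using assms by (simp add: prod_ar_def)

lemma prod_ar_comp:
  assumes "f \<in> Arr C" "g \<in> Arr C" "h \<in> Arr C" "k \<in> Arr C" "Dom C f = Cod C h" "Dom C g = Cod C k"
  shows "prod_ar C f g \<cdot> prod_ar C h k = prod_ar C (f \<cdot> h) (g \<cdot> k)"
  using assms by (simp add: prod_ar_def)

lemma prod_ar_ide: "X \<in> Obj C \<Longrightarrow> Y \<in> Obj C \<Longrightarrow> prod_ar C (\<one> X) (\<one> Y) = \<one> (prod_ob C X Y)"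
  by (simp add: prod_ar_def)

lemma is_iso_prod_ar:
  assumes "is_iso C f" "is_iso C g" shows "is_iso C (prod_ar C f g)"
proof -
  obtain f' where f: "f \<in> Arr C" "f' \<in> Arr C" "Dom C f' = Cod C f" "Cod C f' = Dom C f"
    "f' \<cdot> f = \<one> (Dom C f)" "f \<cdot> f' = \<one> (Cod C f)" using assms(1) by (rule is_isoE)
  obtain g' where g: "g \<in> Arr C" "g' \<in> Arr C" "Dom C g' = Cod C g" "Cod C g' = Dom C g"
    "g' \<cdot> g = \<one> (Dom C g)" "g \<cdot> g' = \<one> (Cod C g)" using assms(2) by (rule is_isoE)
  show ?thesis
    by (rule is_isoI[where g = "prod_ar C f' g'"]) (use f g in \<open>simp_all add: prod_ar_comp prod_ar_ide\<close>)
qed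

lemma prod_ar_cancel:
  assumes "prod_ar C f g \<cdot> h = prod_ar C f g \<cdot> k" "f \<in> Arr C" "g \<in> Arr C" "h \<in> Arr C" "k \<in> Arr C"
    "Cod C h = prod_ob C (Dom C f) (Dom C g)" "Cod C k = prod_ob C (Dom C f) (Dom C g)"  "Dom C h = Dom C k"
  shows "f \<cdot> (proj0 C (Dom C f) (Dom C g) \<cdot> h) = f \<cdot> (proj0 C (Dom C f) (Dom C g) \<cdot> k)"
    "g \<cdot> (proj1 C (Dom C f) (Dom C g) \<cdot> h) = g \<cdot> (proj1 C (Dom C f) (Dom C g) \<cdot> k)"
  using assms(1) assms(2-) unfolding prod_ar_def by (simp_all add: tuple_eq_iff)

lemma is_mono_prod_ar:
  assumes "is_mono C f" "is_mono C g" shows "is_mono C (prod_ar C f g)"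
  unfolding is_mono_def
proof (intro conjI ballI impI)
  note a = is_mono_arr[OF assms(1)] is_mono_arr[OF assms(2)]
  show "prod_ar C f g \<in> Arr C" using a by simp
  fix h k assume "h \<in> Arr C" "k \<in> Arr C" "Cod C h = Dom C (prod_ar C f g) \<and> Cod C k = Dom C (prod_ar C f g)
     \<and> Dom C h = Dom C k \<and> prod_ar C f g \<cdot> h = prod_ar C f g \<cdot> k"
  then have hk: "h \<in> Arr C" "k \<in> Arr C" "Cod C h = prod_ob C (Dom C f) (Dom C g)"
    "Cod C k = prod_ob C (Dom C f) (Dom C g)" "Dom C h = Dom C k"
    and e: "prod_ar C f g \<cdot> h = prod_ar C f g \<cdot> k"
    using a by simp_all
  note c = prod_ar_cancel[OF e a hk]
  show "h = k"
    by (rule proj_jointly_mono[OF is_monoD[OF assms(1) c(1)] is_monoD[OF assms(2) c(2)]])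
      (use a hk in simp_all)
qed

lemma is_pullback_prod_ar:
  assumes 1: "is_pullback C f m q r" and 2: "is_pullback C f' m' q' r'"
  shows "is_pullback C (prod_ar C f f') (prod_ar C m m') (prod_ar C q q') (prod_ar C r r')"
proof -
  note a = is_pullbackD[OF 1] and b = is_pullbackD[OF 2]
  show ?thesis
  proof (rule is_pullbackI)
    show "prod_ar C f f' \<cdot> prod_ar C q q' = prod_ar C m m' \<cdot> prod_ar C r r'"
      using a b by (simp add: prod_ar_comp)
  next
    fix u v assume u: "u \<in> Arr C" "v \<in> Arr C" "Dom C u = Dom C v" "Cod C u = Dom C (prod_ar C f f')"
       "Cod C v = Dom C (prod_ar C m m')" and e: "prod_ar C f f' \<cdot> u = prod_ar C m m' \<cdot> v"
    have u': "Cod C u = prod_ob C (Dom C f) (Dom C f')" "Cod C v = prod_ob C (Dom C m) (Dom C m')"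
      using u a b by simp_all
    have "tuple C (f \<cdot> proj0 C (Dom C f) (Dom C f') \<cdot> u) (f' \<cdot> proj1 C (Dom C f) (Dom C f') \<cdot> u)
      = tuple C (m \<cdot> proj0 C (Dom C m) (Dom C m') \<cdot> v) (m' \<cdot> proj1 C (Dom C m) (Dom C m') \<cdot> v)"
      using e a(1-8) b(1-8) u(1-3) u' unfolding prod_ar_def by simp
    then have e1: "f \<cdot> proj0 C (Dom C f) (Dom C f') \<cdot> u = m \<cdot> proj0 C (Dom C m) (Dom C m') \<cdot> v"
      and e2: "f' \<cdot> proj1 C (Dom C f) (Dom C f') \<cdot> u = m' \<cdot> proj1 C (Dom C m) (Dom C m') \<cdot> v"
      using a(1-8) b(1-8) u(1-3) u' by (simp_all add: tuple_eq_iff)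
    obtain h where h: "h \<in> Arr C" "Dom C h = Dom C u" "Cod C h = Dom C q"
      "q \<cdot> h = proj0 C (Dom C f) (Dom C f') \<cdot> u" "r \<cdot> h = proj0 C (Dom C m) (Dom C m') \<cdot> v"
      by (rule is_pullback_mediator[OF 1 _ _ _ _ _ e1]) (use a(1-8) b(1-8) u(1-3) u' in simp_all)
    obtain k where k: "k \<in> Arr C" "Dom C k = Dom C u" "Cod C k = Dom C q'"
      "q' \<cdot> k = proj1 C (Dom C f) (Dom C f') \<cdot> u" "r' \<cdot> k = proj1 C (Dom C m) (Dom C m') \<cdot> v"
      by (rule is_pullback_mediator[OF 2 _ _ _ _ _ e2]) (use a(1-8) b(1-8) u(1-3) u' in simp_all)
    have "prod_ar C q q' \<cdot> tuple C h k = u" "prod_ar C r r' \<cdot> tuple C h k = v"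
      using h k a(1-8) b(1-8) u(1-3) u' by (simp_all add: prod_ar_tuple)
    then show "\<exists>h. h \<in> Arr C \<and> Dom C h = Dom C u \<and> Cod C h = Dom C (prod_ar C q q') \<and>
        prod_ar C q q' \<cdot> h = u \<and> prod_ar C r r' \<cdot> h = v"
      using h(1-3) k(1-3) a(1-8) b(1-8) by (intro exI[of _ "tuple C h k"]) simp
  next
    fix h k assume h: "h \<in> Arr C" "k \<in> Arr C" "Dom C h = Dom C k" "Cod C h = Dom C (prod_ar C q q')"
      "Cod C k = Dom C (prod_ar C q q')" and e: "prod_ar C q q' \<cdot> h = prod_ar C q q' \<cdot> k"
      "prod_ar C r r' \<cdot> h = prod_ar C r r' \<cdot> k"
    have h': "Cod C h = prod_ob C (Dom C q) (Dom C q')" "Cod C k = prod_ob C (Dom C q) (Dom C q')"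
      "Cod C h = prod_ob C (Dom C r) (Dom C r')" "Cod C k = prod_ob C (Dom C r) (Dom C r')"
      using h a b by simp_all
    note c = prod_ar_cancel[OF e(1) a(3) b(3) h(1,2) h'(1,2) h(3)]
    note d = prod_ar_cancel[OF e(2) a(4) b(4) h(1,2) h'(3,4) h(3), folded a(6) b(6)]
    have "proj0 C (Dom C q) (Dom C q') \<cdot> h = proj0 C (Dom C q) (Dom C q') \<cdot> k"
      by (rule is_pullback_unique[OF 1 _ _ _ _ _ c(1) d(1)]) (use a(1-8) b(1-8) h(1-3) h' in simp_all)
    moreover have "proj1 C (Dom C q) (Dom C q') \<cdot> h = proj1 C (Dom C q) (Dom C q') \<cdot> k"
      by (rule is_pullback_unique[OF 2 _ _ _ _ _ c(2) d(2)]) (use a(1-8) b(1-8) h(1-3) h' in simp_all)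
    ultimately show "h = k"
      by (rule proj_jointly_mono) (use a b h(1-3) h' in simp_all)
  qed (use a b in simp_all)
qed

text \<open>
  If \<open>m\<close> is mono and the two components of \<open>v\<close> have the same image under \<open>m\<close>, they are equal, so \<open>v\<close>
  is diagonal. This is the naturality of \<open>\<Delta>\<close> against partial maps.
\<close>

lemma is_pullback_diagonal:
  assumes "is_mono C m"
  shows "is_pullback C (diagonal C (Cod C m)) (prod_ar C m m) m (diagonal C (Dom C m))"
proof -
  note m = is_mono_arr[OF assms]
  show ?thesis
  proof (rule is_pullbackI)
    fix u v assume u: "u \<in> Arr C" "v \<in> Arr C" "Dom C u = Dom C v" "Cod C u = Dom C (diagonal C (Cod C m))"
       "Cod C v = Dom C (prod_ar C m m)" and e: "diagonal C (Cod C m) \<cdot> u = prod_ar C m m \<cdot> v"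
    have u': "Cod C u = Cod C m" "Cod C v = prod_ob C (Dom C m) (Dom C m)"
      using u m by (simp_all add: diagonal_def)
    let ?p = "proj0 C (Dom C m) (Dom C m) \<cdot> v" and ?q = "proj1 C (Dom C m) (Dom C m) \<cdot> v"
    have "tuple C u u = tuple C (m \<cdot> ?p) (m \<cdot> ?q)"
      using e m u(1-3) u' by (simp add: diagonal_def prod_ar_def)
    moreover have "tuple C u u = tuple C (m \<cdot> ?p) (m \<cdot> ?q) \<longleftrightarrow> u = m \<cdot> ?p \<and> u = m \<cdot> ?q"
      by (rule tuple_eq_iff) (use m u(1-3) u' in simp_all)
    ultimately have e1: "u = m \<cdot> ?p" and e2: "u = m \<cdot> ?q" by blast+
    have "?p = ?q"
      by (rule is_monoD[OF assms trans[OF e1[symmetric] e2]]) (use m u(1-3) u' in simp_all)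
    then have "tuple C ?p ?p = v" using m u(1-3) u' tuple_proj_comp[of "Dom C m" "Dom C m" v] by simp
    then show "\<exists>h. h \<in> Arr C \<and> Dom C h = Dom C u \<and> Cod C h = Dom C m \<and> m \<cdot> h = u \<and> diagonal C (Dom C m) \<cdot> h = v"
      using e1 m u(1-3) u' by (intro exI[of _ ?p]) (simp add: diagonal_def)
  next
    fix h k assume "h \<in> Arr C" "k \<in> Arr C" "Dom C h = Dom C k" "Cod C h = Dom C m" "Cod C k = Dom C m" "m \<cdot> h = m \<cdot> k"
    then show "h = k" using is_monoD[OF assms] by blast
  qed (use m in \<open>simp_all add: diagonal_def prod_ar_def\<close>)
qed

text \<open>
  The factor \<open>Y\<close> is carried along unchanged. With a second monomorphism in place of the identity of
  \<open>Y\<close> the square is not a pullback in general, and this is the reason why the projections are only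
  infranatural on partial maps.
\<close>

lemma is_pullback_proj0:
  assumes "m \<in> Arr C" "Y \<in> Obj C"
  shows "is_pullback C (proj0 C (Cod C m) Y) m (prod_ar C m (\<one> Y)) (proj0 C (Dom C m) Y)"
proof (rule is_pullbackI)
  fix u v assume u: "u \<in> Arr C" "v \<in> Arr C" "Dom C u = Dom C v" "Cod C u = Dom C (proj0 C (Cod C m) Y)"
       "Cod C v = Dom C m" and e: "proj0 C (Cod C m) Y \<cdot> u = m \<cdot> v"
  let ?h = "tuple C v (proj1 C (Cod C m) Y \<cdot> u)"
  have "prod_ar C m (\<one> Y) \<cdot> ?h = tuple C (proj0 C (Cod C m) Y \<cdot> u) (proj1 C (Cod C m) Y \<cdot> u)"
    using u assms e by (simp add: prod_ar_tuple)
  then have "prod_ar C m (\<one> Y) \<cdot> ?h = u" using u assms by simp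
  then show "\<exists>h. h \<in> Arr C \<and> Dom C h = Dom C u \<and> Cod C h = Dom C (prod_ar C m (\<one> Y)) \<and>
      prod_ar C m (\<one> Y) \<cdot> h = u \<and> proj0 C (Dom C m) Y \<cdot> h = v"
    using u assms by (intro exI[of _ ?h]) simp
next
  fix h k assume h: "h \<in> Arr C" "k \<in> Arr C" "Dom C h = Dom C k" "Cod C h = Dom C (prod_ar C m (\<one> Y))"
    "Cod C k = Dom C (prod_ar C m (\<one> Y))" and e: "prod_ar C m (\<one> Y) \<cdot> h = prod_ar C m (\<one> Y) \<cdot> k"
    "proj0 C (Dom C m) Y \<cdot> h = proj0 C (Dom C m) Y \<cdot> k"
  have h': "Cod C h = prod_ob C (Dom C m) Y" "Cod C k = prod_ob C (Dom C m) Y" using h assms by simp_all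
  have "proj1 C (Dom C m) Y \<cdot> h = proj1 C (Dom C m) Y \<cdot> k"
    using prod_ar_cancel(2)[OF e(1)] h(1-3) h' assms by simp
  with e(2) show "h = k" by (rule proj_jointly_mono) (use h(1-3) h' assms in simp_all)
qed (use assms in \<open>simp_all add: prod_ar_def\<close>)

lemma is_pullback_proj1:
  assumes "m \<in> Arr C" "X \<in> Obj C"
  shows "is_pullback C (proj1 C X (Cod C m)) m (prod_ar C (\<one> X) m) (proj1 C X (Dom C m))"
proof (rule is_pullbackI)
  fix u v assume u: "u \<in> Arr C" "v \<in> Arr C" "Dom C u = Dom C v" "Cod C u = Dom C (proj1 C X (Cod C m))"
       "Cod C v = Dom C m" and e: "proj1 C X (Cod C m) \<cdot> u = m \<cdot> v"
  let ?h = "tuple C (proj0 C X (Cod C m) \<cdot> u) v"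
  have "prod_ar C (\<one> X) m \<cdot> ?h = tuple C (proj0 C X (Cod C m) \<cdot> u) (proj1 C X (Cod C m) \<cdot> u)"
    using u assms e by (simp add: prod_ar_tuple)
  then have "prod_ar C (\<one> X) m \<cdot> ?h = u" using u assms by simp
  then show "\<exists>h. h \<in> Arr C \<and> Dom C h = Dom C u \<and> Cod C h = Dom C (prod_ar C (\<one> X) m) \<and>
      prod_ar C (\<one> X) m \<cdot> h = u \<and> proj1 C X (Dom C m) \<cdot> h = v"
    using u assms by (intro exI[of _ ?h]) simp
next
  fix h k assume h: "h \<in> Arr C" "k \<in> Arr C" "Dom C h = Dom C k" "Cod C h = Dom C (prod_ar C (\<one> X) m)"
    "Cod C k = Dom C (prod_ar C (\<one> X) m)" and e: "prod_ar C (\<one> X) m \<cdot> h = prod_ar C (\<one> X) m \<cdot> k"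
    "proj1 C X (Dom C m) \<cdot> h = proj1 C X (Dom C m) \<cdot> k"
  have h': "Cod C h = prod_ob C X (Dom C m)" "Cod C k = prod_ob C X (Dom C m)" using h assms by simp_all
  have "proj0 C X (Dom C m) \<cdot> h = proj0 C X (Dom C m) \<cdot> k"
    using prod_ar_cancel(1)[OF e(1)] h(1-3) h' assms by simp
  then show "h = k" using e(2) by (rule proj_jointly_mono) (use h(1-3) h' assms in simp_all)
qed (use assms in \<open>simp_all add: prod_ar_def\<close>)

definition prod_assoc where
  "prod_assoc X Y Z = tuple C (proj0 C X Y \<cdot> proj0 C (prod_ob C X Y) Z)
     (tuple C (proj1 C X Y \<cdot> proj0 C (prod_ob C X Y) Z) (proj1 C (prod_ob C X Y) Z))"

definition prod_swap where
  "prod_swap X Y = tuple C (proj1 C X Y) (proj0 C X Y)"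

lemma prod_assoc_arr [simp]:
  assumes "X \<in> Obj C" "Y \<in> Obj C" "Z \<in> Obj C"
  shows "prod_assoc X Y Z \<in> Arr C" "Dom C (prod_assoc X Y Z) = prod_ob C (prod_ob C X Y) Z"
    "Cod C (prod_assoc X Y Z) = prod_ob C X (prod_ob C Y Z)"
  using assms by (simp_all add: prod_assoc_def)

lemma prod_swap_arr [simp]:
  assumes "X \<in> Obj C" "Y \<in> Obj C"
  shows "prod_swap X Y \<in> Arr C" "Dom C (prod_swap X Y) = prod_ob C X Y"
    "Cod C (prod_swap X Y) = prod_ob C Y X"
  using assms by (simp_all add: prod_swap_def)

lemma prod_swap_swap: "X \<in> Obj C \<Longrightarrow> Y \<in> Obj C \<Longrightarrow> prod_swap Y X \<cdot> prod_swap X Y = \<one> (prod_ob C X Y)"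
  by (simp add: prod_swap_def)

lemma is_iso_prod_swap: "X \<in> Obj C \<Longrightarrow> Y \<in> Obj C \<Longrightarrow> is_iso C (prod_swap X Y)"
  by (rule is_isoI[where g = "prod_swap Y X"]) (simp_all add: prod_swap_swap)

lemma is_iso_prod_assoc: 
  assumes "X \<in> Obj C" "Y \<in> Obj C" "Z \<in> Obj C"
  shows "is_iso C (prod_assoc X Y Z)"
proof (rule is_isoI[where g = "tuple C (tuple C (proj0 C X (prod_ob C Y Z)) (proj0 C Y Z \<cdot> proj1 C X (prod_ob C Y Z)))
     (proj1 C Y Z \<cdot> proj1 C X (prod_ob C Y Z))"])
qed (use assms in \<open>simp_all add: prod_assoc_def\<close>)

lemma prod_assoc_natural:
  assumes "f \<in> Arr C" "g \<in> Arr C" "h \<in> Arr C"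
  shows "prod_assoc (Cod C f) (Cod C g) (Cod C h) \<cdot> prod_ar C (prod_ar C f g) h
     = prod_ar C f (prod_ar C g h) \<cdot> prod_assoc (Dom C f) (Dom C g) (Dom C h)"
  using assms by (simp add: prod_assoc_def prod_ar_def)

lemma prod_swap_natural:
  assumes "f \<in> Arr C" "g \<in> Arr C"
  shows "prod_swap (Cod C f) (Cod C g) \<cdot> prod_ar C f g = prod_ar C g f \<cdot> prod_swap (Dom C f) (Dom C g)"
  using assms by (simp add: prod_swap_def prod_ar_def)

text \<open>
  Both sides rewrite to the same nested tuple of composites of projections; so does the hexagon.
\<close>

lemma prod_pentagon:
  assumes "W \<in> Obj C" "X \<in> Obj C" "Y \<in> Obj C" "Z \<in> Obj C"
  shows "prod_ar C (\<one> W) (prod_assoc X Y Z) \<cdot> prod_assoc W (prod_ob C X Y) Z \<cdot> prod_ar C (prod_assoc W X Y) (\<one> Z)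
     = prod_assoc W X (prod_ob C Y Z) \<cdot> prod_assoc (prod_ob C W X) Y Z"
  using assms by (simp add: prod_assoc_def prod_ar_def)

lemma prod_hexagon:
  assumes "X \<in> Obj C" "Y \<in> Obj C" "Z \<in> Obj C"
  shows "prod_assoc Y Z X \<cdot> prod_swap X (prod_ob C Y Z) \<cdot> prod_assoc X Y Z
     = prod_ar C (\<one> Y) (prod_swap X Z) \<cdot> prod_assoc Y X Z \<cdot> prod_ar C (prod_swap X Y) (\<one> Z)"
  using assms by (simp add: prod_assoc_def prod_swap_def prod_ar_def)

end

section \<open>The category of partial maps\<close>

lemma Pfn_simps [simp]:
  "Obj (Pfn C) = Obj C" "Dom (Pfn C) (pmor C m \<phi>) = Cod C m" "Cod (Pfn C) (pmor C m \<phi>) = Cod C \<phi>"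
  "Ide (Pfn C) X = pmor C (\<one>\<^bsub>C\<^esub> X) (\<one>\<^bsub>C\<^esub> X)"
  by (simp_all add: Pfn_def pmor_def)

lemma Pfn_arrE:
  assumes "F \<in> Arr (Pfn C)"
  obtains m \<phi> where "F = pmor C m \<phi>" "pspan C m \<phi>"
  using assms by (auto simp: Pfn_def)

lemma pmor_arr: "pspan C m \<phi> \<Longrightarrow> pmor C m \<phi> \<in> Arr (Pfn C)"
  by (auto simp: Pfn_def)

text \<open>
  The pullbacks along which partial maps compose.
\<close>

locale partial_map_category = category C for C :: "('o, 'a) cat" (structure) +
  assumes mono_pullbacks: "is_mono C m \<Longrightarrow> f \<in> Arr C \<Longrightarrow> Cod C f = Cod C m \<Longrightarrow> \<exists>q r. is_pullback C f m q r"
begin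

lemma pmor_comp:
  assumes s: "pspan C m \<phi>" "pspan C m' \<phi>'" and pb: "is_pullback C \<phi> m' q r"
  shows "pmor C m' \<phi>' \<cdot>\<^bsub>Pfn C\<^esub> pmor C m \<phi> = pmor C (m \<cdot> q) (\<phi>' \<cdot> r)"
proof -
  note p = pspan_arr[OF s(1)] and p' = pspan_arr[OF s(2)] and a = is_pullbackD[OF pb]
  have "(\<Union>(m1, \<phi>1)\<in>pclass C m \<phi>. \<Union>(m1', \<phi>1')\<in>pclass C m' \<phi>'.
      \<Union>(q, r)\<in>{(q, r). is_pullback C \<phi>1 m1' q r}. pclass C (m1 \<cdot> q) (\<phi>1' \<cdot> r)) = pclass C (m \<cdot> q) (\<phi>' \<cdot> r)"
    (is "?U = ?c")
  proof (rule equalityI)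
    show "?U \<subseteq> ?c"
      using pclass_comp_well_defined[OF _ _ s pb] by fastforce
    show "?c \<subseteq> ?U"
      using pclass_refl[OF s(1)] pclass_refl[OF s(2)] pb by fastforce
  qed
  then show ?thesis
    using p p' a by (simp add: Pfn_def pmor_def)
qed

lemma category_Pfn: "category (Pfn C)"
proof
  fix F assume "F \<in> Arr (Pfn C)"
  then obtain m \<phi> where F: "F = pmor C m \<phi>" "pspan C m \<phi>" by (rule Pfn_arrE)
  with pspan_arr[of m \<phi>] show "Dom (Pfn C) F \<in> Obj (Pfn C)" "Cod (Pfn C) F \<in> Obj (Pfn C)"
    by simp_all
next
  fix X assume "X \<in> Obj (Pfn C)"
  then show "\<one>\<^bsub>Pfn C\<^esub> X \<in> hom (Pfn C) X X"
    by (auto simp: hom_def intro!: pmor_arr pspanI is_mono_ide)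
next
  fix F G X Y Z assume "F \<in> hom (Pfn C) X Y" "G \<in> hom (Pfn C) Y Z"
  then have FA: "F \<in> Arr (Pfn C)" "Dom (Pfn C) F = X" "Cod (Pfn C) F = Y" and GA: "G \<in> Arr (Pfn C)"
    "Dom (Pfn C) G = Y" "Cod (Pfn C) G = Z" by (auto simp: hom_def)
  obtain m \<phi> where F: "F = pmor C m \<phi>" "pspan C m \<phi>" using FA(1) by (rule Pfn_arrE)
  obtain m' \<phi>' where G: "G = pmor C m' \<phi>'" "pspan C m' \<phi>'" using GA(1) by (rule Pfn_arrE)
  note p = pspan_arr[OF F(2)] and p' = pspan_arr[OF G(2)]
  obtain q r where pb: "is_pullback C \<phi> m' q r"
    using mono_pullbacks[OF p'(1) p(3)] FA GA F G by auto
  show "G \<cdot>\<^bsub>Pfn C\<^esub> F \<in> hom (Pfn C) X Z"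
    unfolding F(1) G(1) pmor_comp[OF F(2) G(2) pb]
    using pmor_arr[OF pspan_comp[OF F(2) G(2) pb]] is_pullbackD[OF pb] FA GA F G p p' by (simp add: hom_def)
next
  fix F X Y assume "F \<in> hom (Pfn C) X Y"
  then have FA: "F \<in> Arr (Pfn C)" "Dom (Pfn C) F = X" "Cod (Pfn C) F = Y" by (auto simp: hom_def)
  obtain m \<phi> where F: "F = pmor C m \<phi>" "pspan C m \<phi>" using FA(1) by (rule Pfn_arrE)
  note p = pspan_arr[OF F(2)]
  have 1: "is_pullback C (\<one> X) m m (\<one> (Dom C m))"
    by (rule is_pullback_iso) (use FA F p in \<open>auto simp: is_iso_ide\<close>)
  have 2: "is_pullback C \<phi> (\<one> Y) (\<one> (Dom C m)) \<phi>"
    by (rule is_pullback_sym, rule is_pullback_iso) (use FA F p in \<open>auto simp: is_iso_ide\<close>)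
  have i: "pspan C (\<one> X) (\<one> X)" "pspan C (\<one> Y) (\<one> Y)" using FA F p by (auto intro!: pspanI is_mono_ide)
  show "F \<cdot>\<^bsub>Pfn C\<^esub> \<one>\<^bsub>Pfn C\<^esub> X = F" "\<one>\<^bsub>Pfn C\<^esub> Y \<cdot>\<^bsub>Pfn C\<^esub> F = F"
    using pmor_comp[OF i(1) F(2) 1] pmor_comp[OF F(2) i(2) 2] FA F p by simp_all
next
  fix F G H W X Y Z assume "F \<in> hom (Pfn C) W X" "G \<in> hom (Pfn C) X Y" "H \<in> hom (Pfn C) Y Z"
  then have FA: "F \<in> Arr (Pfn C)" "Dom (Pfn C) F = W" "Cod (Pfn C) F = X" and GA: "G \<in> Arr (Pfn C)"
    "Dom (Pfn C) G = X" "Cod (Pfn C) G = Y" and HA: "H \<in> Arr (Pfn C)" "Dom (Pfn C) H = Y" "Cod (Pfn C) H = Z"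
    by (auto simp: hom_def)
  obtain m \<phi> where F: "F = pmor C m \<phi>" "pspan C m \<phi>" using FA(1) by (rule Pfn_arrE)
  obtain m' \<phi>' where G: "G = pmor C m' \<phi>'" "pspan C m' \<phi>'" using GA(1) by (rule Pfn_arrE)
  obtain m'' \<phi>'' where H: "H = pmor C m'' \<phi>''" "pspan C m'' \<phi>''" using HA(1) by (rule Pfn_arrE)
  note p = pspan_arr[OF F(2)] and p' = pspan_arr[OF G(2)] and p'' = pspan_arr[OF H(2)]
  obtain q r where pb: "is_pullback C \<phi> m' q r"
    using mono_pullbacks[OF p'(1) p(3)] FA GA F G by auto
  obtain q' r' where pb': "is_pullback C \<phi>' m'' q' r'"
    using mono_pullbacks[OF p''(1) p'(3)] HA GA H G by auto
  note a = is_pullbackD[OF pb] and a' = is_pullbackD[OF pb']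
  \<comment> \<open>The third pullback joins the two given ones; its pastings serve for the two bracketings.\<close>
  obtain q3 r3 where pb3: "is_pullback C r q' q3 r3"
    using mono_pullbacks[OF is_pullback_mono[OF pb' p''(1)] a(4)] a(8) a'(7) p' by auto
  note b = is_pullbackD[OF pb3]
  have 1: "is_pullback C \<phi> (m' \<cdot> q') (q \<cdot> q3) r3" by (rule is_pullback_paste[OF pb pb3])
  have 2: "is_pullback C (\<phi>' \<cdot> r) m'' q3 (r' \<cdot> r3)" by (rule is_pullback_paste'[OF pb' pb3])
  have "(H \<cdot>\<^bsub>Pfn C\<^esub> G) \<cdot>\<^bsub>Pfn C\<^esub> F = pmor C (m \<cdot> q \<cdot> q3) ((\<phi>'' \<cdot> r') \<cdot> r3)"
    using pmor_comp[OF G(2) H(2) pb'] pmor_comp[OF F(2) pspan_comp[OF G(2) H(2) pb'] 1] F(1) G(1) H(1) by simp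
  moreover have "H \<cdot>\<^bsub>Pfn C\<^esub> (G \<cdot>\<^bsub>Pfn C\<^esub> F) = pmor C ((m \<cdot> q) \<cdot> q3) (\<phi>'' \<cdot> (r' \<cdot> r3))"
    using pmor_comp[OF F(2) G(2) pb] pmor_comp[OF pspan_comp[OF F(2) G(2) pb] H(2) 2] F(1) G(1) H(1) by simp
  ultimately show "(H \<cdot>\<^bsub>Pfn C\<^esub> G) \<cdot>\<^bsub>Pfn C\<^esub> F = H \<cdot>\<^bsub>Pfn C\<^esub> (G \<cdot>\<^bsub>Pfn C\<^esub> F)"
    using a(1-8) a'(1-8) b(1-8) p p' p'' by simp
qed

lemma pspan_total: "f \<in> Arr C \<Longrightarrow> pspan C (\<one> (Dom C f)) f"
  by (auto intro!: pspanI is_mono_ide)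

lemma total_arr [simp]:
  assumes "f \<in> Arr C"
  shows "total C f \<in> Arr (Pfn C)" "Dom (Pfn C) (total C f) = Dom C f" "Cod (Pfn C) (total C f) = Cod C f"
  using assms pmor_arr[OF pspan_total] by (simp_all add: total_def)

text \<open>
  The pullback of an identity is an identity, so a total map acts on the second leg only.
\<close>

lemma total_comp_pmor:
  assumes "pspan C m \<phi>" "g \<in> Arr C" "Dom C g = Cod C \<phi>"
  shows "total C g \<cdot>\<^bsub>Pfn C\<^esub> pmor C m \<phi> = pmor C m (g \<cdot> \<phi>)"
proof -
  note p = pspan_arr[OF assms(1)]
  have "is_pullback C \<phi> (\<one> (Dom C g)) (\<one> (Dom C m)) \<phi>"
    by (rule is_pullback_sym, rule is_pullback_iso) (use p assms in \<open>auto simp: is_iso_ide\<close>)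
  from pmor_comp[OF assms(1) pspan_total[OF assms(2)] this] show ?thesis
    using p by (simp add: total_def)
qed

text \<open>
  A total map in front is where a pullback is really needed. Naturality against partial maps thus
  becomes the question which naturality squares are pullbacks.
\<close>

lemma pmor_comp_total:
  assumes "pspan C m \<phi>" "is_pullback C f m q r"
  shows "pmor C m \<phi> \<cdot>\<^bsub>Pfn C\<^esub> total C f = pmor C q (\<phi> \<cdot> r)"
  using pmor_comp[OF pspan_total assms(1,2)] is_pullbackD[OF assms(2)] by (simp add: total_def)

lemma total_comp:
  assumes "f \<in> Arr C" "g \<in> Arr C" "Dom C g = Cod C f"
  shows "total C g \<cdot>\<^bsub>Pfn C\<^esub> total C f = total C (g \<cdot> f)"
  using total_comp_pmor[OF pspan_total assms(2)] assms by (simp add: total_def)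

lemma total_ide: "X \<in> Obj C \<Longrightarrow> total C (\<one> X) = \<one>\<^bsub>Pfn C\<^esub> X"
  by (simp add: total_def)

lemma is_iso_total:
  assumes "is_iso C f" shows "is_iso (Pfn C) (total C f)"
proof -
  obtain g where "f \<in> Arr C" "g \<in> Arr C" "Dom C g = Cod C f" "Cod C g = Dom C f"
    "g \<cdot> f = \<one> (Dom C f)" "f \<cdot> g = \<one> (Cod C f)" using assms by (rule is_isoE)
  then have "total C g \<in> hom (Pfn C) (Cod (Pfn C) (total C f)) (Dom (Pfn C) (total C f)) \<and>
      total C g \<cdot>\<^bsub>Pfn C\<^esub> total C f = \<one>\<^bsub>Pfn C\<^esub> (Dom (Pfn C) (total C f)) \<and>
      total C f \<cdot>\<^bsub>Pfn C\<^esub> total C g = \<one>\<^bsub>Pfn C\<^esub> (Cod (Pfn C) (total C f))"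
    by (simp add: hom_def total_comp total_ide del: Pfn_simps(4))
  moreover have "total C f \<in> Arr (Pfn C)" using assms by (simp add: is_iso_def)
  ultimately show ?thesis unfolding is_iso_def by blast
qed

end

section \<open>The near product of partial maps\<close>

locale partial_product_category = partial_map_category C + product_category C
  for C :: "('o, 'a) cat" (structure)
begin

lemma pspan_prod_ar:
  assumes "pspan C m \<phi>" "pspan C m' \<phi>'"
  shows "pspan C (prod_ar C m m') (prod_ar C \<phi> \<phi>')"
  using pspan_arr[OF assms(1)] pspan_arr[OF assms(2)] by (intro pspanI is_mono_prod_ar) simp_all

lemma pclass_prod_ar:
  assumes "(m1, \<phi>1) \<in> pclass C m \<phi>" "(m1', \<phi>1') \<in> pclass C m' \<phi>'" "pspan C m \<phi>" "pspan C m' \<phi>'"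
  shows "pclass C (prod_ar C m1 m1') (prod_ar C \<phi>1 \<phi>1') = pclass C (prod_ar C m m') (prod_ar C \<phi> \<phi>')"
proof (rule pclass_eqI)
  obtain \<theta> where t: "pspan C m1 \<phi>1" "is_iso C \<theta>" "\<theta> \<in> Arr C" "Dom C \<theta> = Dom C m" "Cod C \<theta> = Dom C m1"
    "m = m1 \<cdot> \<theta>" "\<phi> = \<phi>1 \<cdot> \<theta>" using assms(1) by (rule pclassE)
  obtain \<eta> where e: "pspan C m1' \<phi>1'" "is_iso C \<eta>" "\<eta> \<in> Arr C" "Dom C \<eta> = Dom C m'" "Cod C \<eta> = Dom C m1'"
    "m' = m1' \<cdot> \<eta>" "\<phi>' = \<phi>1' \<cdot> \<eta>" using assms(2) by (rule pclassE)
  note p1 = pspan_arr[OF t(1)] and p1' = pspan_arr[OF e(1)]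
    and p = pspan_arr[OF assms(3)] and p' = pspan_arr[OF assms(4)]
  show "(prod_ar C m1 m1', prod_ar C \<phi>1 \<phi>1') \<in> pclass C (prod_ar C m m') (prod_ar C \<phi> \<phi>')"
  proof (rule pclassI[where \<theta> = "prod_ar C \<theta> \<eta>"])
    show "prod_ar C m m' = prod_ar C m1 m1' \<cdot> prod_ar C \<theta> \<eta>"
      "prod_ar C \<phi> \<phi>' = prod_ar C \<phi>1 \<phi>1' \<cdot> prod_ar C \<theta> \<eta>"
      unfolding t(6,7) e(6,7) using t(3-5) e(3-5) p1 p1' by (simp_all add: prod_ar_comp)
  qed (use t(3-5) e(3-5) p1 p1' p p' in \<open>simp_all add: is_iso_prod_ar[OF t(2) e(2)] pspan_prod_ar[OF t(1) e(1)]\<close>)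
  show "pspan C (prod_ar C m m') (prod_ar C \<phi> \<phi>')" by (rule pspan_prod_ar[OF assms(3,4)])
qed

lemma pfn_box_pmor:
  assumes s: "pspan C m \<phi>" "pspan C m' \<phi>'"
  shows "amap (pfn_box C) (pmor C m \<phi>, pmor C m' \<phi>') = pmor C (prod_ar C m m') (prod_ar C \<phi> \<phi>')"
proof -
  have "(\<Union>(m1, \<phi>1)\<in>pclass C m \<phi>. \<Union>(m1', \<phi>1')\<in>pclass C m' \<phi>'.
     pclass C (prod_ar C m1 m1') (prod_ar C \<phi>1 \<phi>1')) = pclass C (prod_ar C m m') (prod_ar C \<phi> \<phi>')"
    (is "?U = ?c")
  proof (rule equalityI)
    show "?U \<subseteq> ?c" using pclass_prod_ar[OF _ _ s] by fastforce
    show "?c \<subseteq> ?U" using pclass_refl[OF s(1)] pclass_refl[OF s(2)] by fastforce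
  qed
  then show ?thesis
    using pspan_arr[OF s(1)] pspan_arr[OF s(2)] by (simp add: pfn_box_def pmor_def)
qed

lemma pfn_box_total:
  assumes "f \<in> Arr C" "g \<in> Arr C"
  shows "amap (pfn_box C) (total C f, total C g) = total C (prod_ar C f g)"
  using pfn_box_pmor[OF pspan_total pspan_total] assms by (simp add: total_def prod_ar_ide)

lemma omap_pfn_box [simp]: "omap (pfn_box C) (X, Y) = prod_ob C X Y"
  by (simp add: pfn_box_def)

lemma is_functor_pfn_box: "is_functor (prod_cat (Pfn C) (Pfn C)) (Pfn C) (pfn_box C)"
  unfolding is_functor_def
proof (intro conjI ballI impI)
  show "category (prod_cat (Pfn C) (Pfn C))" "category (Pfn C)"
    by (simp_all add: category_prod_cat category_Pfn)
  fix X assume X: "X \<in> Obj (prod_cat (Pfn C) (Pfn C))"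
  then show "omap (pfn_box C) X \<in> Obj (Pfn C)"
    by auto
  obtain Y Z where "X = (Y, Z)" by (cases X)
  with X show "amap (pfn_box C) (\<one>\<^bsub>prod_cat (Pfn C) (Pfn C)\<^esub> X) = \<one>\<^bsub>Pfn C\<^esub> (omap (pfn_box C) X)"
    by (simp add: total_ide[symmetric] pfn_box_total prod_ar_ide del: Pfn_simps(4))
next
  fix H assume "H \<in> Arr (prod_cat (Pfn C) (Pfn C))"
  then obtain F F' where H: "H = (F, F')" "F \<in> Arr (Pfn C)" "F' \<in> Arr (Pfn C)" by auto
  obtain m \<phi> where F: "F = pmor C m \<phi>" "pspan C m \<phi>" using H(2) by (rule Pfn_arrE)
  obtain m' \<phi>' where F': "F' = pmor C m' \<phi>'" "pspan C m' \<phi>'" using H(3) by (rule Pfn_arrE)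
  note p = pspan_arr[OF F(2)] and p' = pspan_arr[OF F'(2)]
  show "amap (pfn_box C) H \<in> hom (Pfn C) (omap (pfn_box C) (Dom (prod_cat (Pfn C) (Pfn C)) H))
              (omap (pfn_box C) (Cod (prod_cat (Pfn C) (Pfn C)) H))"
    using p p' pmor_arr[OF pspan_prod_ar[OF F(2) F'(2)]]
    by (simp add: hom_def H(1) F(1) F'(1) pfn_box_pmor[OF F(2) F'(2)])
  fix K assume "K \<in> Arr (prod_cat (Pfn C) (Pfn C))"
    and e: "Dom (prod_cat (Pfn C) (Pfn C)) K = Cod (prod_cat (Pfn C) (Pfn C)) H"
  then obtain G G' where K: "K = (G, G')" "G \<in> Arr (Pfn C)" "G' \<in> Arr (Pfn C)" by auto
  obtain n \<psi> where G: "G = pmor C n \<psi>" "pspan C n \<psi>" using K(2) by (rule Pfn_arrE)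
  obtain n' \<psi>' where G': "G' = pmor C n' \<psi>'" "pspan C n' \<psi>'" using K(3) by (rule Pfn_arrE)
  note s = pspan_arr[OF G(2)] and s' = pspan_arr[OF G'(2)]
  have e: "Cod C n = Cod C \<phi>" "Cod C n' = Cod C \<phi>'"
    using e by (simp_all add: H(1) K(1) F(1) F'(1) G(1) G'(1))
  obtain q r where pb: "is_pullback C \<phi> n q r"
    using mono_pullbacks[OF s(1) p(3)] e by auto
  obtain q' r' where pb': "is_pullback C \<phi>' n' q' r'"
    using mono_pullbacks[OF s'(1) p'(3)] e by auto
  note a = is_pullbackD[OF pb] and a' = is_pullbackD[OF pb']
  show "amap (pfn_box C) (K \<cdot>\<^bsub>prod_cat (Pfn C) (Pfn C)\<^esub> H) = amap (pfn_box C) K \<cdot>\<^bsub>Pfn C\<^esub> amap (pfn_box C) H"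
    using a(1-8) a'(1-8) s s' p p'
    by (simp add: H(1) K(1) F(1) F'(1) G(1) G'(1) pmor_comp[OF F(2) G(2) pb] pmor_comp[OF F'(2) G'(2) pb']
      pfn_box_pmor pspan_comp[OF F(2) G(2) pb] pspan_comp[OF F'(2) G'(2) pb'] F(2) F'(2) G(2) G'(2)
      pmor_comp[OF pspan_prod_ar[OF F(2) F'(2)] pspan_prod_ar[OF G(2) G'(2)] is_pullback_prod_ar[OF pb pb']]
      prod_ar_comp)
qed

interpretation P: P_category_data "Pfn C" "pfn_box C" "pfn_diag C" "pfn_proj0 C" "pfn_proj1 C" .

lemma bpair_total:
  assumes "f \<in> Arr C" "g \<in> Arr C" "Dom C f = Dom C g"
  shows "P.bpair (total C f) (total C g) = total C (tuple C f g)"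
  using assms by (simp add: P.bpair_def P.bar_def pfn_box_total pfn_diag_def total_comp diagonal_def prod_ar_tuple)

lemma pfn_proj_eq: "pfn_proj0 C (X, Y) = total C (proj0 C X Y)" "pfn_proj1 C (X, Y) = total C (proj1 C X Y)"
  by (simp_all add: pfn_proj0_def pfn_proj1_def)

lemma bob_eq: "P.bob X Y = prod_ob C X Y"
  by (simp add: P.bob_def)

lemma P_assoc_eq:
  assumes "X \<in> Obj C" "Y \<in> Obj C" "Z \<in> Obj C"
  shows "P.assoc X Y Z = total C (prod_assoc X Y Z)"
  using assms by (simp add: P.assoc_def pfn_proj_eq bob_eq total_comp bpair_total prod_assoc_def)

lemma P_transp_eq:
  assumes "X \<in> Obj C" "Y \<in> Obj C"
  shows "P.transp X Y = total C (prod_swap X Y)"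
  using assms by (simp add: P.transp_def pfn_proj_eq bpair_total prod_swap_def)

text \<open>
  The total maps are one of the subcategories over which the intersection \<open>P\<close> is formed.
\<close>

lemma P_arrows_total: "P.P_arrows \<subseteq> total C ` Arr C"
proof -
  have "subcategory (Pfn C) (total C ` Arr C)"
    unfolding subcategory_def
    by (auto simp: total_comp total_ide[symmetric] simp del: Pfn_simps(4))
  moreover have "\<forall>f\<in>total C ` Arr C. \<forall>g\<in>total C ` Arr C. P.bar f g \<in> total C ` Arr C"
    by (auto simp: P.bar_def pfn_box_total)
  moreover have "\<forall>X\<in>Obj (Pfn C). \<forall>Y\<in>Obj (Pfn C). pfn_proj0 C (X, Y) \<in> total C ` Arr C \<and> pfn_proj1 C (X, Y) \<in> total C ` Arr C"
    by (auto simp: pfn_proj0_def pfn_proj1_def)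
  ultimately show ?thesis unfolding P.P_arrows_def by blast
qed

lemma infranatural_proj0: "infranatural (prod_cat (Pfn C) (Pfn C)) (Pfn C) (pfn_box C) fst_fctr (pfn_proj0 C)"
  unfolding infranatural_def
  by (auto simp: is_functor_pfn_box is_functor_fst category_Pfn fst_fctr_def pfn_proj0_def hom_def)
     (auto simp: is_functor_fst[unfolded fst_fctr_def] category_Pfn)

lemma infranatural_proj1: "infranatural (prod_cat (Pfn C) (Pfn C)) (Pfn C) (pfn_box C) snd_fctr (pfn_proj1 C)"
  unfolding infranatural_def
  by (auto simp: is_functor_pfn_box is_functor_snd category_Pfn snd_fctr_def pfn_proj1_def hom_def)
     (auto simp: is_functor_snd[unfolded snd_fctr_def] category_Pfn)

lemma proj0_natural_total:
  assumes s: "pspan C m \<phi>" and g: "g \<in> Arr C"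
  shows "pmor C m \<phi> \<cdot>\<^bsub>Pfn C\<^esub> pfn_proj0 C (Cod C m, Dom C g)
    = pfn_proj0 C (Cod C \<phi>, Cod C g) \<cdot>\<^bsub>Pfn C\<^esub> amap (pfn_box C) (pmor C m \<phi>, total C g)"
proof -
  note p = pspan_arr[OF s]
  have "pmor C m \<phi> \<cdot>\<^bsub>Pfn C\<^esub> pfn_proj0 C (Cod C m, Dom C g)
    = pmor C (prod_ar C m (\<one> (Dom C g))) (\<phi> \<cdot> proj0 C (Dom C m) (Dom C g))"
    unfolding pfn_proj0_def using p g by (simp add: pmor_comp_total[OF s is_pullback_proj0])
  moreover have "pfn_proj0 C (Cod C \<phi>, Cod C g) \<cdot>\<^bsub>Pfn C\<^esub> amap (pfn_box C) (pmor C m \<phi>, total C g)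
    = pmor C (prod_ar C m (\<one> (Dom C g))) (proj0 C (Cod C \<phi>) (Cod C g) \<cdot> prod_ar C \<phi> g)"
    unfolding pfn_proj0_def total_def[of _ g] using p g
    by (simp add: pfn_box_pmor[OF s pspan_total] total_comp_pmor[OF pspan_prod_ar[OF s pspan_total]])
  ultimately show ?thesis using p g by (simp add: proj_prod_ar)
qed

lemma proj1_natural_total:
  assumes s: "pspan C m \<phi>" and g: "g \<in> Arr C"
  shows "pmor C m \<phi> \<cdot>\<^bsub>Pfn C\<^esub> pfn_proj1 C (Dom C g, Cod C m)
    = pfn_proj1 C (Cod C g, Cod C \<phi>) \<cdot>\<^bsub>Pfn C\<^esub> amap (pfn_box C) (total C g, pmor C m \<phi>)"
proof -
  note p = pspan_arr[OF s]
  have "pmor C m \<phi> \<cdot>\<^bsub>Pfn C\<^esub> pfn_proj1 C (Dom C g, Cod C m)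
    = pmor C (prod_ar C (\<one> (Dom C g)) m) (\<phi> \<cdot> proj1 C (Dom C g) (Dom C m))"
    unfolding pfn_proj1_def using p g by (simp add: pmor_comp_total[OF s is_pullback_proj1])
  moreover have "pfn_proj1 C (Cod C g, Cod C \<phi>) \<cdot>\<^bsub>Pfn C\<^esub> amap (pfn_box C) (total C g, pmor C m \<phi>)
    = pmor C (prod_ar C (\<one> (Dom C g)) m) (proj1 C (Cod C g) (Cod C \<phi>) \<cdot> prod_ar C g \<phi>)"
    unfolding pfn_proj1_def total_def[of _ g] using p g
    by (simp add: pfn_box_pmor[OF pspan_total s] total_comp_pmor[OF pspan_prod_ar[OF pspan_total s]])
  ultimately show ?thesis using p g by (simp add: proj_prod_ar)
qed

lemma diag_natural:
  assumes s: "pspan C m \<phi>"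
  shows "amap (pfn_box C) (pmor C m \<phi>, pmor C m \<phi>) \<cdot>\<^bsub>Pfn C\<^esub> pfn_diag C (Cod C m)
    = pfn_diag C (Cod C \<phi>) \<cdot>\<^bsub>Pfn C\<^esub> pmor C m \<phi>"
proof -
  note p = pspan_arr[OF s]
  have "amap (pfn_box C) (pmor C m \<phi>, pmor C m \<phi>) \<cdot>\<^bsub>Pfn C\<^esub> pfn_diag C (Cod C m)
     = pmor C m (prod_ar C \<phi> \<phi> \<cdot> diagonal C (Dom C m))"
    unfolding pfn_diag_def
    by (simp add: pfn_box_pmor s pmor_comp_total[OF pspan_prod_ar[OF s s] is_pullback_diagonal[OF p(1)]])
  moreover have "pfn_diag C (Cod C \<phi>) \<cdot>\<^bsub>Pfn C\<^esub> pmor C m \<phi> = pmor C m (diagonal C (Cod C \<phi>) \<cdot> \<phi>)"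
    unfolding pfn_diag_def using p by (simp add: total_comp_pmor[OF s] diagonal_def)
  ultimately show ?thesis using p by (simp add: diagonal_def prod_ar_def)
qed

text \<open>
  Invertibility makes the square at \<open>m\<close> a pullback, so naturality at the two legs \<open>m\<close> and \<open>\<phi>\<close> gives
  naturality at the partial map. It applies to the associativity and to the transposition.
\<close>

lemma total_iso_natural:
  assumes s: "pspan C m \<phi>" "pspan C n \<psi>" and a: "is_iso C a" "is_iso C b" "c \<in> Arr C"
    and "Dom C a = Cod C m" "Cod C a = Cod C n" "Dom C b = Dom C m" "Cod C b = Dom C n"
      "Dom C c = Cod C \<phi>" "Cod C c = Cod C \<psi>"
    and "a \<cdot> m = n \<cdot> b" "c \<cdot> \<phi> = \<psi> \<cdot> b"
  shows "pmor C n \<psi> \<cdot>\<^bsub>Pfn C\<^esub> total C a = total C c \<cdot>\<^bsub>Pfn C\<^esub> pmor C m \<phi>"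
proof -
  have "is_pullback C a n m b"
    by (rule is_pullback_iso) (use assms pspan_arr[OF s(1)] pspan_arr[OF s(2)] in simp_all)
  from pmor_comp_total[OF s(2) this] show ?thesis
    using assms by (simp add: total_comp_pmor)
qed

theorem P_category_Pfn: "P_category (Pfn C) (pfn_box C) (pfn_diag C) (pfn_proj0 C) (pfn_proj1 C)"
proof -
  interpret Q: category "Pfn C" by (rule category_Pfn)
  note defs = bob_eq P_assoc_eq P_transp_eq P.bar_def pfn_box_total total_ide[symmetric] total_comp
  have fs: "is_functor (prod_cat (Pfn C) (Pfn C)) (Pfn C) (pfn_box C)"
    "is_functor (prod_cat (Pfn C) (Pfn C)) (Pfn C) fst_fctr"
    "is_functor (prod_cat (Pfn C) (Pfn C)) (Pfn C) snd_fctr"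
    "is_functor (prod_cat (prod_cat (Pfn C) (Pfn C)) (Pfn C)) (prod_cat (Pfn C) (Pfn C)) fst_fctr"
    "is_functor (prod_cat (prod_cat (Pfn C) (Pfn C)) (Pfn C)) (Pfn C) snd_fctr"
    "is_functor (Pfn C) (Pfn C) id_fctr"
    by (simp_all add: is_functor_pfn_box is_functor_fst is_functor_snd is_functor_id category_prod_cat category_Pfn)
  show ?thesis
  proof
    show "is_functor (prod_cat (Pfn C) (Pfn C)) (Pfn C) (pfn_box C)" by (rule fs)
    show "natural (Pfn C) (Pfn C) id_fctr (comp_fctr (pfn_box C) (pair_fctr id_fctr id_fctr)) (pfn_diag C)"
      unfolding natural_def infranatural_def
    proof (intro conjI ballI fs(6) is_functor_comp[OF is_functor_pair[OF fs(6,6)] fs(1)])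
      fix X assume "X \<in> Obj (Pfn C)"
      then show "pfn_diag C X \<in> hom (Pfn C) (omap id_fctr X) (omap (comp_fctr (pfn_box C) (pair_fctr id_fctr id_fctr)) X)"
        by (simp add: hom_def id_fctr_def comp_fctr_def pair_fctr_def pfn_diag_def diagonal_def)
    next
      show "natural_on (Pfn C) (Pfn C) id_fctr (comp_fctr (pfn_box C) (pair_fctr id_fctr id_fctr)) (pfn_diag C) (Arr (Pfn C))"
        unfolding natural_on_def
        by (auto elim!: Pfn_arrE simp: id_fctr_def comp_fctr_def pair_fctr_def diag_natural)
    qed
    show "infranatural (prod_cat (Pfn C) (Pfn C)) (Pfn C) (pfn_box C) fst_fctr (pfn_proj0 C)"
      "infranatural (prod_cat (Pfn C) (Pfn C)) (Pfn C) (pfn_box C) snd_fctr (pfn_proj1 C)"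
      by (fact infranatural_proj0 infranatural_proj1)+
    fix X assume "X \<in> Obj (Pfn C)"
    then have X: "X \<in> Obj C" by simp
    show "pfn_proj0 C (X, X) \<cdot>\<^bsub>Pfn C\<^esub> pfn_diag C X = \<one>\<^bsub>Pfn C\<^esub> X"
      "pfn_proj1 C (X, X) \<cdot>\<^bsub>Pfn C\<^esub> pfn_diag C X = \<one>\<^bsub>Pfn C\<^esub> X"
      "P.bar (pfn_proj0 C (X, X)) (pfn_proj1 C (X, X)) \<cdot>\<^bsub>Pfn C\<^esub> pfn_diag C (P.bob X X) = \<one>\<^bsub>Pfn C\<^esub> (P.bob X X)"
      using X by (simp_all add: pfn_proj0_def pfn_proj1_def pfn_diag_def defs diagonal_def prod_ar_tuple del: Pfn_simps(4))
  next
    show "Arr (Pfn C) \<times> P.P_arrows \<subseteq> naturalizer (prod_cat (Pfn C) (Pfn C)) (Pfn C) (pfn_box C) fst_fctr (pfn_proj0 C)"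
      unfolding naturalizer_eq(1)[OF infranatural_proj0]
    proof clarify
      fix F G assume F: "F \<in> Arr (Pfn C)" and "G \<in> P.P_arrows"
      then obtain g where G: "G = total C g" "g \<in> Arr C" using P_arrows_total by auto
      obtain m \<phi> where F': "F = pmor C m \<phi>" "pspan C m \<phi>" using F by (rule Pfn_arrE)
      show "(F, G) \<in> Arr (prod_cat (Pfn C) (Pfn C)) \<and>
        natural_on (prod_cat (Pfn C) (Pfn C)) (Pfn C) (pfn_box C) fst_fctr (pfn_proj0 C) {(F, G)}"
        using F F' G by (simp add: natural_on_def fst_fctr_def proj0_natural_total)
    qed
    show "P.P_arrows \<times> Arr (Pfn C) \<subseteq> naturalizer (prod_cat (Pfn C) (Pfn C)) (Pfn C) (pfn_box C) snd_fctr (pfn_proj1 C)"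
      unfolding naturalizer_eq(1)[OF infranatural_proj1]
    proof clarify
      fix F G assume F: "F \<in> Arr (Pfn C)" and "G \<in> P.P_arrows"
      then obtain g where G: "G = total C g" "g \<in> Arr C" using P_arrows_total by auto
      obtain m \<phi> where F': "F = pmor C m \<phi>" "pspan C m \<phi>" using F by (rule Pfn_arrE)
      show "(G, F) \<in> Arr (prod_cat (Pfn C) (Pfn C)) \<and>
        natural_on (prod_cat (Pfn C) (Pfn C)) (Pfn C) (pfn_box C) snd_fctr (pfn_proj1 C) {(G, F)}"
        using F F' G by (simp add: natural_on_def snd_fctr_def proj1_natural_total)
    qed
  next
    show "natural_iso (prod_cat (prod_cat (Pfn C) (Pfn C)) (Pfn C)) (Pfn C) P.box_left P.box_right
        (\<lambda>((X, Y), Z). P.assoc X Y Z)"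
      unfolding natural_iso_def natural_def infranatural_def
    proof (intro conjI ballI)
      show "is_functor (prod_cat (prod_cat (Pfn C) (Pfn C)) (Pfn C)) (Pfn C) P.box_left"
        unfolding P.box_left_def by (intro is_functor_comp[OF is_functor_pair] is_functor_comp fs) (rule fs)+
      show "is_functor (prod_cat (prod_cat (Pfn C) (Pfn C)) (Pfn C)) (Pfn C) P.box_right"
        unfolding P.box_right_def
        by (rule is_functor_comp[OF is_functor_pair[OF is_functor_comp[OF fs(4,2)]
              is_functor_comp[OF is_functor_pair[OF is_functor_comp[OF fs(4,3)] fs(5)] fs(1)]] fs(1)])
      fix XYZ assume "XYZ \<in> Obj (prod_cat (prod_cat (Pfn C) (Pfn C)) (Pfn C))"
      then obtain X Y Z where x: "XYZ = ((X, Y), Z)" "X \<in> Obj C" "Y \<in> Obj C" "Z \<in> Obj C" by auto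
      show "(case XYZ of (XY, Z) \<Rightarrow> (case XY of (X, Y) \<Rightarrow> \<lambda>Z. P.assoc X Y Z) Z) \<in> hom (Pfn C) (omap P.box_left XYZ) (omap P.box_right XYZ)"
        using x by (simp add: P_assoc_eq P.box_left_def P.box_right_def comp_fctr_def pair_fctr_def fst_fctr_def snd_fctr_def hom_def)
      show "is_iso (Pfn C) (case XYZ of (XY, Z) \<Rightarrow> (case XY of (X, Y) \<Rightarrow> \<lambda>Z. P.assoc X Y Z) Z)"
        using x by (simp add: P_assoc_eq is_iso_total is_iso_prod_assoc)
    next
      show "natural_on (prod_cat (prod_cat (Pfn C) (Pfn C)) (Pfn C)) (Pfn C) P.box_left P.box_right
         (\<lambda>((X, Y), Z). P.assoc X Y Z) (Arr (prod_cat (prod_cat (Pfn C) (Pfn C)) (Pfn C)))"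
        unfolding natural_on_def
      proof
        fix FGH assume "FGH \<in> Arr (prod_cat (prod_cat (Pfn C) (Pfn C)) (Pfn C))"
        then obtain F G H where x: "FGH = ((F, G), H)" and A: "F \<in> Arr (Pfn C)" "G \<in> Arr (Pfn C)" "H \<in> Arr (Pfn C)" by auto
        obtain m1 f1 where F: "F = pmor C m1 f1" "pspan C m1 f1" using A(1) by (rule Pfn_arrE)
        obtain m2 f2 where G: "G = pmor C m2 f2" "pspan C m2 f2" using A(2) by (rule Pfn_arrE)
        obtain m3 f3 where H: "H = pmor C m3 f3" "pspan C m3 f3" using A(3) by (rule Pfn_arrE)
        note p = pspan_arr[OF F(2)] pspan_arr[OF G(2)] pspan_arr[OF H(2)]
        have "pmor C (prod_ar C m1 (prod_ar C m2 m3)) (prod_ar C f1 (prod_ar C f2 f3)) \<cdot>\<^bsub>Pfn C\<^esub>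
            total C (prod_assoc (Cod C m1) (Cod C m2) (Cod C m3))
          = total C (prod_assoc (Cod C f1) (Cod C f2) (Cod C f3)) \<cdot>\<^bsub>Pfn C\<^esub>
            pmor C (prod_ar C (prod_ar C m1 m2) m3) (prod_ar C (prod_ar C f1 f2) f3)"
          by (rule total_iso_natural[where b = "prod_assoc (Dom C m1) (Dom C m2) (Dom C m3)"])
            (use p in \<open>simp_all add: pspan_prod_ar F(2) G(2) H(2) is_iso_prod_assoc prod_assoc_natural\<close>)
        then show "amap P.box_right FGH \<cdot>\<^bsub>Pfn C\<^esub> (\<lambda>((X, Y), Z). P.assoc X Y Z) (Dom (prod_cat (prod_cat (Pfn C) (Pfn C)) (Pfn C)) FGH)
          = (\<lambda>((X, Y), Z). P.assoc X Y Z) (Cod (prod_cat (prod_cat (Pfn C) (Pfn C)) (Pfn C)) FGH) \<cdot>\<^bsub>Pfn C\<^esub> amap P.box_left FGH"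
          using p by (simp add: x F(1) G(1) H(1) P_assoc_eq P.box_left_def P.box_right_def comp_fctr_def
              pair_fctr_def fst_fctr_def snd_fctr_def pfn_box_pmor pspan_prod_ar F(2) G(2) H(2))
      qed
    qed
  next
    show "natural_iso (prod_cat (Pfn C) (Pfn C)) (Pfn C) (pfn_box C)
        (comp_fctr (pfn_box C) (pair_fctr snd_fctr fst_fctr)) (\<lambda>(X, Y). P.transp X Y)"
      unfolding natural_iso_def natural_def infranatural_def
    proof (intro conjI ballI)
      show "is_functor (prod_cat (Pfn C) (Pfn C)) (Pfn C) (pfn_box C)" by (rule fs)
      show "is_functor (prod_cat (Pfn C) (Pfn C)) (Pfn C) (comp_fctr (pfn_box C) (pair_fctr snd_fctr fst_fctr))"
        by (rule is_functor_comp[OF is_functor_pair[OF fs(3,2)] fs(1)])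
      fix XY assume "XY \<in> Obj (prod_cat (Pfn C) (Pfn C))"
      then obtain X Y where x: "XY = (X, Y)" "X \<in> Obj C" "Y \<in> Obj C" by auto
      show "(case XY of (X, Y) \<Rightarrow> P.transp X Y) \<in> hom (Pfn C) (omap (pfn_box C) XY) (omap (comp_fctr (pfn_box C) (pair_fctr snd_fctr fst_fctr)) XY)"
        using x by (simp add: P_transp_eq comp_fctr_def pair_fctr_def fst_fctr_def snd_fctr_def hom_def)
      show "is_iso (Pfn C) (case XY of (X, Y) \<Rightarrow> P.transp X Y)"
        using x by (simp add: P_transp_eq is_iso_total is_iso_prod_swap)
    next
      show "natural_on (prod_cat (Pfn C) (Pfn C)) (Pfn C) (pfn_box C)
        (comp_fctr (pfn_box C) (pair_fctr snd_fctr fst_fctr)) (\<lambda>(X, Y). P.transp X Y) (Arr (prod_cat (Pfn C) (Pfn C)))"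
        unfolding natural_on_def
      proof
        fix FG assume "FG \<in> Arr (prod_cat (Pfn C) (Pfn C))"
        then obtain F G where x: "FG = (F, G)" and A: "F \<in> Arr (Pfn C)" "G \<in> Arr (Pfn C)" by auto
        obtain m1 f1 where F: "F = pmor C m1 f1" "pspan C m1 f1" using A(1) by (rule Pfn_arrE)
        obtain m2 f2 where G: "G = pmor C m2 f2" "pspan C m2 f2" using A(2) by (rule Pfn_arrE)
        note p = pspan_arr[OF F(2)] pspan_arr[OF G(2)]
        have "pmor C (prod_ar C m2 m1) (prod_ar C f2 f1) \<cdot>\<^bsub>Pfn C\<^esub> total C (prod_swap (Cod C m1) (Cod C m2))
          = total C (prod_swap (Cod C f1) (Cod C f2)) \<cdot>\<^bsub>Pfn C\<^esub> pmor C (prod_ar C m1 m2) (prod_ar C f1 f2)"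
          by (rule total_iso_natural[where b = "prod_swap (Dom C m1) (Dom C m2)"])
            (use p in \<open>simp_all add: pspan_prod_ar F(2) G(2) is_iso_prod_swap prod_swap_natural\<close>)
        then show "amap (comp_fctr (pfn_box C) (pair_fctr snd_fctr fst_fctr)) FG \<cdot>\<^bsub>Pfn C\<^esub>
            (\<lambda>(X, Y). P.transp X Y) (Dom (prod_cat (Pfn C) (Pfn C)) FG)
          = (\<lambda>(X, Y). P.transp X Y) (Cod (prod_cat (Pfn C) (Pfn C)) FG) \<cdot>\<^bsub>Pfn C\<^esub> amap (pfn_box C) FG"
          using p by (simp add: x F(1) G(1) P_transp_eq comp_fctr_def
              pair_fctr_def fst_fctr_def snd_fctr_def pfn_box_pmor F(2) G(2))
      qed
    qed
  next
    fix W X Y Z assume "W \<in> Obj (Pfn C)" "X \<in> Obj (Pfn C)" "Y \<in> Obj (Pfn C)" "Z \<in> Obj (Pfn C)"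
    then show "P.bar (\<one>\<^bsub>Pfn C\<^esub> W) (P.assoc X Y Z) \<cdot>\<^bsub>Pfn C\<^esub> P.assoc W (P.bob X Y) Z \<cdot>\<^bsub>Pfn C\<^esub> P.bar (P.assoc W X Y) (\<one>\<^bsub>Pfn C\<^esub> Z)
       = P.assoc W X (P.bob Y Z) \<cdot>\<^bsub>Pfn C\<^esub> P.assoc (P.bob W X) Y Z"
      by (simp add: defs prod_pentagon del: Pfn_simps(4))
  next
    fix X Y Z assume "X \<in> Obj (Pfn C)" "Y \<in> Obj (Pfn C)" "Z \<in> Obj (Pfn C)"
    then show "P.assoc Y Z X \<cdot>\<^bsub>Pfn C\<^esub> P.transp X (P.bob Y Z) \<cdot>\<^bsub>Pfn C\<^esub> P.assoc X Y Z
       = P.bar (\<one>\<^bsub>Pfn C\<^esub> Y) (P.transp X Z) \<cdot>\<^bsub>Pfn C\<^esub> P.assoc Y X Z \<cdot>\<^bsub>Pfn C\<^esub> P.bar (P.transp X Y) (\<one>\<^bsub>Pfn C\<^esub> Z)"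
      by (simp add: defs prod_hexagon del: Pfn_simps(4))
  next
    fix X Y assume "X \<in> Obj (Pfn C)" "Y \<in> Obj (Pfn C)"
    then show "P.transp Y X \<cdot>\<^bsub>Pfn C\<^esub> P.transp X Y = \<one>\<^bsub>Pfn C\<^esub> (P.bob X Y)"
      by (simp add: defs prod_swap_swap del: Pfn_simps(4))
  qed
qed

end

section \<open>Small sets\<close>

lemma finite_less_Cinfinite: "Cinfinite r \<Longrightarrow> finite A \<Longrightarrow> |A| <o r"
  by (rule finite_ordLess_infinite[OF card_of_Well_order])
    (auto simp: cinfinite_def Field_card_of dest: card_order_on_well_order_on)

text \<open>
  Smallness for sets of any type: the universe occurs only as a bound, so it has to be passed as an
  argument. On subsets of the universe it agrees with \<open>small\<close>.
\<close>

abbreviation lt_universe :: "'u itself \<Rightarrow> 'x set \<Rightarrow> bool" where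
  "lt_universe _ A \<equiv> |A| <o |UNIV :: 'u set|"

locale set_functor =
  fixes F :: "'u endo"
  assumes universe: "set_universe TYPE('u)"
    and F_functor: "is_functor Sets Sets F"
begin

lemma infinite_universe: "infinite (UNIV :: 'u set)"
  using universe by (simp add: set_universe_def)

lemma stable_universe: "stable |UNIV :: 'u set|"
  using universe unfolding set_universe_def
  by (intro regularCard_stable card_of_Card_order) (simp_all add: Field_card_of)

lemma lt_universe_subset: "lt_universe TYPE('u) B \<Longrightarrow> A \<subseteq> B \<Longrightarrow> lt_universe TYPE('u) A"
  using card_of_mono1 ordLeq_ordLess_trans by blast

lemma lt_universe_image: "lt_universe TYPE('u) A \<Longrightarrow> lt_universe TYPE('u) (f ` A)"
  using card_of_image ordLeq_ordLess_trans by blast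

lemma lt_universe_Sigma: "lt_universe TYPE('u) A \<Longrightarrow> (\<And>a. a \<in> A \<Longrightarrow> lt_universe TYPE('u) (B a)) \<Longrightarrow> lt_universe TYPE('u) (Sigma A B)"
  using stable_elim[OF stable_universe] by blast

lemma lt_universe_inj:
  assumes "lt_universe TYPE('u) (A :: 'x set)" obtains e :: "'x \<Rightarrow> 'u" where "inj_on e A"
  using assms card_of_ordLeq[of A "UNIV :: 'u set"] ordLess_imp_ordLeq by blast

lemma lt_universe_finite: "finite A \<Longrightarrow> lt_universe TYPE('u) A"
  using infinite_universe
  by (intro finite_less_Cinfinite) (simp_all add: cinfinite_def Field_card_of card_of_card_order_on)

lemma lt_universe_Pow:
  assumes "lt_universe TYPE('u) (A :: 'x set)" shows "lt_universe TYPE('u) (Pow A)"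
proof -
  obtain e :: "'x \<Rightarrow> 'u" where e: "inj_on e A" using lt_universe_inj[OF assms] .
  have "inj_on (image e) (Pow A)" using e by (rule inj_on_image_Pow)
  then have "|Pow A| \<le>o |Pow (e ` A)|" using card_of_ordLeq[of "Pow A" "Pow (e ` A)"] by blast
  moreover have "|Pow (e ` A)| <o |UNIV :: 'u set|"
    using universe lt_universe_image[OF assms, of e] unfolding set_universe_def by blast
  ultimately show ?thesis by (rule ordLeq_ordLess_trans)
qed

text \<open>
  An extensional function is determined by its graph, a subset of \<open>A \<times> B\<close>, so the strong limit
  property applies.
\<close>

lemma lt_universe_PiE:
  assumes "lt_universe TYPE('u) A" "lt_universe TYPE('u) B" shows "lt_universe TYPE('u) (A \<rightarrow>\<^sub>E B)"
proof -
  let ?g = "\<lambda>f. {(x, f x) |x. x \<in> A}"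
  have "inj_on ?g (A \<rightarrow>\<^sub>E B)"
  proof (rule inj_onI)
    fix f g assume f: "f \<in> A \<rightarrow>\<^sub>E B" "g \<in> A \<rightarrow>\<^sub>E B" and e: "?g f = ?g g"
    show "f = g"
    proof (rule PiE_ext[OF f])
      fix x assume "x \<in> A"
      then have "(x, f x) \<in> ?g g" unfolding e[symmetric] by blast
      then show "f x = g x" by blast
    qed
  qed
  moreover have "?g ` (A \<rightarrow>\<^sub>E B) \<subseteq> Pow (A \<times> B)" by auto
  ultimately have "|A \<rightarrow>\<^sub>E B| \<le>o |Pow (A \<times> B)|" using card_of_ordLeq by blast
  moreover have "lt_universe TYPE('u) (Pow (A \<times> B))"
    by (intro lt_universe_Pow lt_universe_Sigma assms)
  ultimately show ?thesis by (rule ordLeq_ordLess_trans)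
qed

definition pair_code :: "'u \<times> 'u \<Rightarrow> 'u" where
  "pair_code = (SOME e. inj e)"

text \<open>
  Small sets are subsets of \<open>'u\<close>, so relations on a coalgebra have to be coded by elements before they
  can carry a coalgebra structure.
\<close>

lemma inj_pair_code: "inj pair_code"
proof -
  have "|UNIV \<times> UNIV :: ('u \<times> 'u) set| \<le>o |UNIV :: 'u set|"
    using card_of_Times_same_infinite[OF infinite_universe] ordIso_imp_ordLeq by blast
  then have "\<exists>e :: 'u \<times> 'u \<Rightarrow> 'u. inj e"
    using card_of_ordLeq[of "UNIV \<times> UNIV :: ('u \<times> 'u) set" "UNIV :: 'u set"] by auto
  then show ?thesis unfolding pair_code_def by (rule someI_ex)
qed

section \<open>The functor on elements\<close>

abbreviation "FO \<equiv> omap F"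

text \<open>
  The action of \<open>F\<close> on elements. The argument need not be normalised outside \<open>A\<close>, so that composites
  can be written as plain \<open>\<lambda>\<close>-terms.
\<close>

definition fmap :: "'u set \<Rightarrow> 'u set \<Rightarrow> ('u \<Rightarrow> 'u) \<Rightarrow> 'u \<Rightarrow> 'u" where
  "fmap A B f = fapp (amap F (A, restrict f A, B))"

lemma small_F: "small A \<Longrightarrow> small (FO A)"
  using F_functor by (simp add: is_functor_def Sets_def)

lemma amap_eq:
  assumes "small A" "small B" "f \<in> A \<rightarrow> B"
  shows "amap F (A, restrict f A, B) = (FO A, fmap A B f, FO B)" "fmap A B f \<in> FO A \<rightarrow>\<^sub>E FO B"
proof -
  have "(A, restrict f A, B) \<in> Arr Sets" using assms by (simp add: Sets_def)
  then have "amap F (A, restrict f A, B) \<in> hom Sets (FO A) (FO B)"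
    using F_functor unfolding is_functor_def by (auto simp: Sets_def)
  then show "amap F (A, restrict f A, B) = (FO A, fmap A B f, FO B)" "fmap A B f \<in> FO A \<rightarrow>\<^sub>E FO B"
    by (auto simp: fmap_def hom_def Sets_def)
qed

lemma fmap_in: "small A \<Longrightarrow> small B \<Longrightarrow> f \<in> A \<rightarrow> B \<Longrightarrow> x \<in> FO A \<Longrightarrow> fmap A B f x \<in> FO B"
  using amap_eq(2) by blast

lemma fmap_cong: "(\<And>x. x \<in> A \<Longrightarrow> f x = g x) \<Longrightarrow> fmap A B f = fmap A B g"
  unfolding fmap_def by (simp add: restrict_def cong: if_cong)

lemma fmap_id:
  assumes "small A" "x \<in> FO A" shows "fmap A A (\<lambda>x. x) x = x"
proof -
  have "amap F (\<one>\<^bsub>Sets\<^esub> A) = \<one>\<^bsub>Sets\<^esub> (FO A)"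
    using F_functor assms(1) by (simp add: is_functor_def Sets_def)
  then show ?thesis using assms(2) by (simp add: fmap_def Sets_def)
qed

lemma fmap_comp:
  assumes "small A" "small B" "small D" "f \<in> A \<rightarrow> B" "g \<in> B \<rightarrow> D" "x \<in> FO A"
  shows "fmap B D g (fmap A B f x) = fmap A D (\<lambda>x. g (f x)) x"
proof -
  let ?f = "(A, restrict f A, B)" and ?g = "(B, restrict g B, D)"
  have a: "?f \<in> Arr Sets" "?g \<in> Arr Sets" using assms by (simp_all add: Sets_def)
  have "amap F (?g \<cdot>\<^bsub>Sets\<^esub> ?f) = amap F ?g \<cdot>\<^bsub>Sets\<^esub> amap F ?f"
    using F_functor a unfolding is_functor_def by (simp add: Sets_def)
  moreover have "?g \<cdot>\<^bsub>Sets\<^esub> ?f = (A, restrict (\<lambda>x. g (f x)) A, D)"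
    using assms(4) by (auto simp: Sets_def compose_def restrict_def fun_eq_iff)
  ultimately have "fmap A D (\<lambda>x. g (f x)) = fapp (amap F ?g \<cdot>\<^bsub>Sets\<^esub> amap F ?f)"
    by (simp add: fmap_def)
  then show ?thesis
    using amap_eq(1)[OF assms(1,2,4)] amap_eq(1)[OF assms(2,3,5)] assms(6)
    by (simp add: Sets_def compose_def)
qed

text \<open>
  An injection out of a nonempty set has a left inverse, which \<open>F\<close> preserves.
\<close>

lemma fmap_inj:
  assumes "small A" "small B" "f \<in> A \<rightarrow> B" "inj_on f A" "A \<noteq> {}"
  shows "inj_on (fmap A B f) (FO A)"
proof -
  obtain a where a: "a \<in> A" using assms(5) by blast
  let ?g = "\<lambda>y. if y \<in> f ` A then inv_into A f y else a"
  have "fmap B A ?g (fmap A B f x) = x" if x: "x \<in> FO A" for x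
  proof -
    have g: "?g \<in> B \<rightarrow> A" using a inv_into_into[of _ f A] by auto
    have "fmap B A ?g (fmap A B f x) = fmap A A (\<lambda>x. ?g (f x)) x"
      by (rule fmap_comp[OF assms(1,2,1,3) g x])
    also have "\<dots> = fmap A A (\<lambda>x. x) x"
      by (rule fun_cong[OF fmap_cong]) (use assms(4) in simp)
    also have "\<dots> = x" by (rule fmap_id[OF assms(1) x])
    finally show ?thesis .
  qed
  then show ?thesis by (rule inj_on_inverseI)
qed

section \<open>Coalgebras on elements\<close>

text \<open>
  As for \<open>fmap\<close>, structure maps and morphisms are plain functions whose values outside the carrier
  do not matter. The functions \<open>coalg_ob\<close> and \<open>coalg_ar\<close> below translate them into objects and arrows.
\<close>

definition coalg :: "'u set \<Rightarrow> ('u \<Rightarrow> 'u) \<Rightarrow> bool" where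
  "coalg A a \<longleftrightarrow> small A \<and> a \<in> A \<rightarrow> FO A"

definition cmor :: "'u set \<Rightarrow> ('u \<Rightarrow> 'u) \<Rightarrow> 'u set \<Rightarrow> ('u \<Rightarrow> 'u) \<Rightarrow> ('u \<Rightarrow> 'u) \<Rightarrow> bool" where
  "cmor A a B b f \<longleftrightarrow> f \<in> A \<rightarrow> B \<and> (\<forall>x\<in>A. b (f x) = fmap A B f (a x))"

lemma coalgD: "coalg A a \<Longrightarrow> small A" "coalg A a \<Longrightarrow> x \<in> A \<Longrightarrow> a x \<in> FO A"
  by (auto simp: coalg_def)

lemma cmorD: "cmor A a B b f \<Longrightarrow> f \<in> A \<rightarrow> B" "cmor A a B b f \<Longrightarrow> x \<in> A \<Longrightarrow> f x \<in> B"
  "cmor A a B b f \<Longrightarrow> x \<in> A \<Longrightarrow> b (f x) = fmap A B f (a x)"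
  by (auto simp: cmor_def)

lemma cmor_comp:
  assumes "cmor A a B b f" "cmor B b D d g" "coalg A a" "coalg B b" "coalg D d"
  shows "cmor A a D d (\<lambda>x. g (f x))"
  unfolding cmor_def
proof (intro conjI ballI)
  show "(\<lambda>x. g (f x)) \<in> A \<rightarrow> D" using cmorD(1)[OF assms(1)] cmorD(1)[OF assms(2)] by auto
  fix x assume x: "x \<in> A"
  have "d (g (f x)) = fmap B D g (fmap A B f (a x))"
    using cmorD(3)[OF assms(2) cmorD(2)[OF assms(1) x]] cmorD(3)[OF assms(1) x] by simp
  also have "\<dots> = fmap A D (\<lambda>x. g (f x)) (a x)"
    by (rule fmap_comp) (use assms x coalgD cmorD(1) in auto)
  finally show "d (g (f x)) = fmap A D (\<lambda>x. g (f x)) (a x)" .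
qed

lemma cmor_cong:
  assumes "cmor A a B b f" "\<And>x. x \<in> A \<Longrightarrow> f x = g x" "\<And>x. x \<in> A \<Longrightarrow> a x = a' x" "\<And>x. x \<in> B \<Longrightarrow> b x = b' x"
  shows "cmor A a' B b' g"
  using assms fmap_cong[of A f g B] unfolding cmor_def by (auto simp: Pi_iff)

lemma cmor_id: "coalg A a \<Longrightarrow> cmor A a A a (\<lambda>x. x)"
  by (auto simp: cmor_def coalg_def fmap_id Pi_iff)

text \<open>
  Injective morphisms detect morphisms: the two sides of the equation for \<open>h\<close> become equal under \<open>F i\<close>,
  which is injective as soon as there is an element to check the equation at.
\<close>

lemma cmor_cancel_inj:
  assumes i: "cmor P p X \<xi> i" "inj_on i P" and c: "coalg P p" "coalg X \<xi>" "coalg W \<omega>"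
    and h: "h \<in> W \<rightarrow> P" "cmor W \<omega> X \<xi> (\<lambda>w. i (h w))"
  shows "cmor W \<omega> P p h"
  unfolding cmor_def
proof (intro conjI ballI)
  show "h \<in> W \<rightarrow> P" by fact
  fix w assume w: "w \<in> W"
  then have hw: "h w \<in> P" using h by blast
  note s = coalgD(1)[OF c(1)] coalgD(1)[OF c(2)] coalgD(1)[OF c(3)]
  have "fmap P X i (p (h w)) = \<xi> (i (h w))" using cmorD(3)[OF i(1) hw] by simp
  also have "\<dots> = fmap W X (\<lambda>w. i (h w)) (\<omega> w)" using cmorD(3)[OF h(2) w] by simp
  also have "\<dots> = fmap P X i (fmap W P h (\<omega> w))"
    by (rule fmap_comp[symmetric]) (use s h(1) cmorD(1)[OF i(1)] coalgD(2)[OF c(3) w] in auto)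
  finally show "p (h w) = fmap W P h (\<omega> w)"
    using fmap_inj[OF s(1,2) cmorD(1)[OF i(1)] i(2)] hw coalgD(2)[OF c(1) hw]
      fmap_in[OF s(3,1) h(1) coalgD(2)[OF c(3) w]]
    by (auto dest: inj_onD)
qed

definition subco :: "'u set \<Rightarrow> ('u \<Rightarrow> 'u) \<Rightarrow> 'u set \<Rightarrow> ('u \<Rightarrow> 'u) \<Rightarrow> bool" where
  "subco A a S s \<longleftrightarrow> S \<subseteq> A \<and> coalg S s \<and> cmor S s A a (\<lambda>x. x)"

lemma subcoI:
  assumes "S \<subseteq> A" "small S" "\<And>x. x \<in> S \<Longrightarrow> s x \<in> FO S \<and> fmap S A (\<lambda>x. x) (s x) = a x"
  shows "subco A a S s"
  unfolding subco_def coalg_def cmor_def using assms(1,2)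
  by (intro conjI funcsetI ballI conjunct1[OF assms(3)] conjunct2[OF assms(3), symmetric]) auto

lemma small_subset: "small (A :: 'u set) \<Longrightarrow> S \<subseteq> A \<Longrightarrow> small S"
  unfolding small_def by (rule lt_universe_subset)

lemma coalgebra_iff:
  "coalgebra F X \<longleftrightarrow> (\<exists>A a. X = (A, (A, restrict a A, FO A)) \<and> coalg A a)"
proof
  assume "coalgebra F X"
  then obtain A a where X: "X = (A, (A, a, FO A))" "small A" "a \<in> A \<rightarrow>\<^sub>E FO A"
    by (cases X) (auto simp: coalgebra_def Sets_def hom_def)
  then have "restrict a A = a" "coalg A a" by (auto simp: coalg_def PiE_def extensional_restrict)
  then show "\<exists>A a. X = (A, (A, restrict a A, FO A)) \<and> coalg A a" using X(1) by (metis)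
next
  assume "\<exists>A a. X = (A, (A, restrict a A, FO A)) \<and> coalg A a"
  then show "coalgebra F X" by (auto simp: coalgebra_def coalg_def Sets_def hom_def small_F)
qed

lemma coalg_hom_iff:
  assumes "coalg A a" "coalg B b"
  shows "coalg_hom F (A, (A, restrict a A, FO A)) (B, (B, restrict b B, FO B)) \<phi> \<longleftrightarrow>
    (\<exists>f. \<phi> = (A, restrict f A, B) \<and> cmor A a B b f)" (is "?L \<longleftrightarrow> ?R")
proof -
  note s = coalgD(1)[OF assms(1)] coalgD(1)[OF assms(2)]
  have key: "coalg_hom F (A, (A, restrict a A, FO A)) (B, (B, restrict b B, FO B)) (A, restrict f A, B) \<longleftrightarrow> cmor A a B b f" for f
  proof (cases "f \<in> A \<rightarrow> B")
    case True
    have "coalg_hom F (A, (A, restrict a A, FO A)) (B, (B, restrict b B, FO B)) (A, restrict f A, B) \<longleftrightarrow>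
        compose A (restrict b B) (restrict f A) = compose A (fmap A B f) (restrict a A)"
      using True s by (simp add: coalg_hom_def Sets_def hom_def amap_eq(1)[OF s True])
    also have "\<dots> \<longleftrightarrow> (\<forall>x\<in>A. b (f x) = fmap A B f (a x))"
      using True by (auto simp: compose_def fun_eq_iff Pi_iff)
    finally show ?thesis using True by (simp add: cmor_def)
  next
    case False
    then show ?thesis by (auto simp: coalg_hom_def cmor_def Sets_def hom_def)
  qed
  show ?thesis
  proof
    assume L: ?L
    then obtain f where f: "\<phi> = (A, f, B)" "f \<in> A \<rightarrow>\<^sub>E B" by (auto simp: coalg_hom_def Sets_def hom_def)
    then have "restrict f A = f" by (auto simp: PiE_def extensional_restrict)
    then show ?R using key[of f] L f by metis
  qed (use key in blast)
qed

lemma subcoalgebra_iff: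
  assumes "coalg A a"
  shows "subcoalgebra F (A, (A, restrict a A, FO A)) S \<longleftrightarrow> (\<exists>s. subco A a S s)"
proof
  assume "subcoalgebra F (A, (A, restrict a A, FO A)) S"
  then obtain \<sigma> where SA: "S \<subseteq> A" and c: "coalgebra F (S, \<sigma>)"
    and h: "coalg_hom F (S, \<sigma>) (A, (A, restrict a A, FO A)) (S, \<lambda>x\<in>S. x, A)"
    by (auto simp: subcoalgebra_def)
  obtain s where s: "\<sigma> = (S, restrict s S, FO S)" "coalg S s" using c unfolding coalgebra_iff by auto
  obtain f where f: "(S, \<lambda>x\<in>S. x, A) = (S, restrict f S, A)" "cmor S s A a f"
    using h unfolding s(1) coalg_hom_iff[OF s(2) assms] by auto
  have "x = f x" if "x \<in> S" for x using f(1) that by (auto simp: restrict_def fun_eq_iff split: if_splits)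
  then have "cmor S s A a (\<lambda>x. x)" by (intro cmor_cong[OF f(2)]) auto
  then show "\<exists>s. subco A a S s" using SA s(2) by (auto simp: subco_def)
next
  assume "\<exists>s. subco A a S s"
  then obtain s where s: "S \<subseteq> A" "coalg S s" "cmor S s A a (\<lambda>x. x)" by (auto simp: subco_def)
  then show "subcoalgebra F (A, (A, restrict a A, FO A)) S"
    unfolding subcoalgebra_def prod.case using coalgebra_iff coalg_hom_iff[OF s(2) assms] by blast
qed

section \<open>Accessible functors are bounded\<close>

text \<open>
  The set \<open>A\<close> is the \<open>r\<close>-filtered colimit of its subsets with fewer than \<open>r\<close> elements, and \<open>F\<close>
  preserves this colimit. A colimit of sets is jointly surjective, so \<open>u\<close> comes from one of the
  subsets. The subsets and their inclusions are coded in \<open>'u\<close> to form a diagram of the required type.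
\<close>

lemma accessible_support:
  fixes r :: "'u rel"
  assumes r: "Cinfinite r" "regularCard r" "r <o |UNIV :: 'u set|" "preserves_filtered_colimits r F"
    and A: "small A" and u: "u \<in> FO A"
  obtains S where "S \<subseteq> A" "|S| <o r" "u \<in> fmap S A (\<lambda>x. x) ` FO S"
proof -
  let ?P = "{S. S \<subseteq> A \<and> |S| <o r}"
  have P: "lt_universe TYPE('u) ?P"
    by (rule lt_universe_subset[OF lt_universe_Pow[of A]]) (use A in \<open>auto simp: small_def\<close>)
  obtain e :: "'u set \<Rightarrow> 'u" where e: "inj_on e ?P" using lt_universe_inj[OF P] .
  define I where "I = e ` ?P"
  define d where "d = inv_into ?P e"
  have de: "d (e S) = S" if "S \<in> ?P" for S using e that by (simp add: d_def)
  have dP: "d i \<subseteq> A" "|d i| <o r" "e (d i) = i" if "i \<in> I" for i using that de by (auto simp: I_def)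
  have eI: "e S \<in> I" if "S \<in> ?P" for S using that by (simp add: I_def)
  have sd: "small (d i)" if "i \<in> I" for i using small_subset[OF A dP(1)[OF that]] .
  define p where "p a = fst (inv pair_code a)" for a
  define q where "q a = snd (inv pair_code a)" for a
  have pq [simp]: "p (pair_code (i, j)) = i" "q (pair_code (i, j)) = j"
    "pair_code (i, j) = pair_code (k, l) \<longleftrightarrow> i = k \<and> j = l" for i j k l
    by (simp_all add: p_def q_def inj_eq[OF inj_pair_code] inv_f_f[OF inj_pair_code])
  define J :: "('u, 'u) cat" where
    "J = \<lparr>Obj = I, Arr = {pair_code (i, j) |i j. i \<in> I \<and> j \<in> I \<and> d i \<subseteq> d j}, Dom = p, Cod = q,
       Ide = (\<lambda>i. pair_code (i, i)), Comp = (\<lambda>g f. pair_code (p f, q g))\<rparr>"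
  define D :: "('u, 'u, 'u set, 'u fn) fctr" where
    "D = \<lparr>omap = d, amap = (\<lambda>a. (d (p a), restrict (\<lambda>x. x) (d (p a)), d (q a)))\<rparr>"
  define \<iota> where "\<iota> i = (d i, restrict (\<lambda>x. x) (d i), A)" for i
  have J_cat: "category J"
    by standard (auto simp: J_def hom_def)+
  have sing: "{x} \<in> ?P" if "x \<in> A" for x
    using that by (auto intro: finite_less_Cinfinite[OF r(1)])
  have filt: "filtered r J"
    unfolding filtered_def
  proof (intro conjI allI impI J_cat)
    fix S :: "'u set" assume S: "subcategory J S \<and> |S| <o r"
    let ?O = "{i \<in> I. pair_code (i, i) \<in> S}"
    let ?V = "\<Union>i\<in>?O. d i"
    have "inj_on (\<lambda>i. pair_code (i, i)) ?O" by (rule inj_onI) simp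
    moreover have "(\<lambda>i. pair_code (i, i)) ` ?O \<subseteq> S" by auto
    ultimately have "|?O| \<le>o |S|" using card_of_ordLeq by blast
    then have "|?O| <o r" using S ordLeq_ordLess_trans by blast
    then have "|?V| <o r"
      using card_of_UNION_ordLess_infinite_Field_regularCard[OF r(2,1)] dP(2) by blast
    moreover have "?V \<subseteq> A" using dP(1) by blast
    ultimately have V: "?V \<in> ?P" by blast
    have "is_cocone (subcat J S) J id_fctr (e ?V) (\<lambda>i. pair_code (i, e ?V))"
      unfolding is_cocone_def
    proof (intro conjI ballI)
      show "e ?V \<in> Obj J" using eI[OF V] by (auto simp: J_def)
      fix i assume "i \<in> Obj (subcat J S)"
      then have i: "i \<in> ?O" by (simp add: subcat_def J_def)
      then have "d i \<subseteq> d (e ?V)" unfolding de[OF V] by blast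
      then show "pair_code (i, e ?V) \<in> hom J (omap id_fctr i) (e ?V)"
        using i eI[OF V] by (auto simp: J_def hom_def id_fctr_def)
    next
      fix a assume "a \<in> Arr (subcat J S)"
      then show "pair_code (Cod (subcat J S) a, e ?V) \<cdot>\<^bsub>J\<^esub> amap id_fctr a = pair_code (Dom (subcat J S) a, e ?V)"
        by (simp add: J_def id_fctr_def subcat_def)
    qed
    then show "\<exists>V \<iota>. is_cocone (subcat J S) J id_fctr V \<iota>" by blast
  qed
  have D_fun: "is_functor J Sets D"
    unfolding is_functor_def
    using J_cat category_Sets sd
    by (auto simp: J_def D_def Sets_def hom_def compose_def restrict_def fun_eq_iff)
  have colim: "is_colimit J Sets D A \<iota>"
    unfolding is_colimit_def
  proof (intro conjI allI impI)
    show "is_cocone J Sets D A \<iota>"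
      unfolding is_cocone_def using A sd dP(1)
      by (fastforce simp: J_def D_def Sets_def hom_def \<iota>_def compose_def restrict_def fun_eq_iff)
    fix W \<zeta> assume co: "is_cocone J Sets D W \<zeta>"
    have W: "small W" using co by (simp add: is_cocone_def Sets_def)
    have \<zeta>: "\<zeta> i = (d i, fapp (\<zeta> i), W)" "fapp (\<zeta> i) \<in> d i \<rightarrow>\<^sub>E W" if "i \<in> I" for i
    proof -
      have "\<zeta> i \<in> hom Sets (d i) W" using co that by (auto simp: is_cocone_def J_def D_def)
      then show "\<zeta> i = (d i, fapp (\<zeta> i), W)" "fapp (\<zeta> i) \<in> d i \<rightarrow>\<^sub>E W" by (auto simp: Sets_def hom_def)
    qed
    define h where "h = (\<lambda>x\<in>A. fapp (\<zeta> (e {x})) x)"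
    have hx: "h x = fapp (\<zeta> i) x" if i: "i \<in> I" "x \<in> d i" for i x
    proof -
      have x: "x \<in> A" using dP(1)[OF i(1)] i(2) by blast
      have ex: "e {x} \<in> I" "d (e {x}) = {x}" using eI[OF sing[OF x]] de[OF sing[OF x]] by auto
      let ?a = "pair_code (e {x}, i)"
      have "?a \<in> Arr J" using i ex by (auto simp: J_def)
      then have "\<zeta> (Cod J ?a) \<cdot>\<^bsub>Sets\<^esub> amap D ?a = \<zeta> (Dom J ?a)" using co unfolding is_cocone_def by blast
      then have "\<zeta> i \<cdot>\<^bsub>Sets\<^esub> ({x}, restrict (\<lambda>x. x) {x}, d i) = \<zeta> (e {x})"
        using ex by (simp add: J_def D_def)
      from arg_cong[OF this, of fapp]
      have "fapp (\<zeta> (e {x})) = compose {x} (fapp (\<zeta> i)) (restrict (\<lambda>x. x) {x})"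
        by (simp add: Sets_def)
      then show ?thesis using x by (simp add: h_def compose_def)
    qed
    have hW: "h \<in> A \<rightarrow>\<^sub>E W"
    proof (rule PiE_I)
      fix x assume x: "x \<in> A"
      have "e {x} \<in> I" "x \<in> d (e {x})" using eI[OF sing[OF x]] de[OF sing[OF x]] by auto
      then show "h x \<in> W" using \<zeta>(2) hx by fastforce
    qed (simp add: h_def)
    show "\<exists>!h. h \<in> hom Sets A W \<and> (\<forall>j\<in>Obj J. h \<cdot>\<^bsub>Sets\<^esub> \<iota> j = \<zeta> j)"
    proof (rule ex1I[of _ "(A, h, W)"])
      have "(A, h, W) \<cdot>\<^bsub>Sets\<^esub> \<iota> j = \<zeta> j" if j: "j \<in> I" for j
      proof -
        have "compose (d j) h (restrict (\<lambda>x. x) (d j)) = fapp (\<zeta> j)"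
          using hx[OF j] \<zeta>(2)[OF j] by (auto simp: compose_def fun_eq_iff PiE_def extensional_def)
        then show ?thesis using \<zeta>(1)[OF j] by (simp add: Sets_def \<iota>_def)
      qed
      then show "(A, h, W) \<in> hom Sets A W \<and> (\<forall>j\<in>Obj J. (A, h, W) \<cdot>\<^bsub>Sets\<^esub> \<iota> j = \<zeta> j)"
        using A W hW by (simp add: Sets_def hom_def J_def)
    next
      fix k assume k: "k \<in> hom Sets A W \<and> (\<forall>j\<in>Obj J. k \<cdot>\<^bsub>Sets\<^esub> \<iota> j = \<zeta> j)"
      then obtain k' where k': "k = (A, k', W)" "k' \<in> A \<rightarrow>\<^sub>E W" by (auto simp: Sets_def hom_def)
      have "k' = h"
      proof (rule PiE_ext[OF k'(2) hW])
        fix x assume x: "x \<in> A"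
        have ex: "e {x} \<in> I" "d (e {x}) = {x}" using eI[OF sing[OF x]] de[OF sing[OF x]] by auto
        have "k \<cdot>\<^bsub>Sets\<^esub> \<iota> (e {x}) = \<zeta> (e {x})" using k ex(1) by (simp add: J_def)
        from arg_cong[OF this, of fapp]
        have "fapp (\<zeta> (e {x})) = compose {x} k' (restrict (\<lambda>x. x) {x})"
          using ex(2) by (simp add: Sets_def k'(1) \<iota>_def)
        then show "k' x = h x" using x by (simp add: h_def compose_def)
      qed
      then show "k = (A, h, W)" using k'(1) by simp
    qed
  qed
  have smallJ: "small (Obj J)" "small (Arr J)"
  proof -
    have I: "lt_universe TYPE('u) I" unfolding I_def by (rule lt_universe_image[OF P])
    have "lt_universe TYPE('u) (pair_code ` (I \<times> I))" by (intro lt_universe_image lt_universe_Sigma I)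
    then have "lt_universe TYPE('u) (Arr J)" by (rule lt_universe_subset) (auto simp: J_def)
    then show "small (Obj J)" "small (Arr J)" using I by (auto simp: small_def J_def)
  qed
  have "is_colimit J Sets (comp_fctr F D) (FO A) (\<lambda>j. amap F (\<iota> j))"
    using r(4) smallJ filt D_fun colim unfolding preserves_filtered_colimits_def by blast
  then have F_co: "is_cocone J Sets (comp_fctr F D) (FO A) (\<lambda>j. amap F (\<iota> j))"
    and F_univ: "\<And>W \<zeta>. is_cocone J Sets (comp_fctr F D) W \<zeta> \<Longrightarrow>
       \<exists>!h. h \<in> hom Sets (FO A) W \<and> (\<forall>j\<in>Obj J. h \<cdot>\<^bsub>Sets\<^esub> amap F (\<iota> j) = \<zeta> j)"
    by (auto simp: is_colimit_def)
  have F\<iota>: "amap F (\<iota> j) = (FO (d j), fmap (d j) A (\<lambda>x. x), FO A)" "fmap (d j) A (\<lambda>x. x) \<in> FO (d j) \<rightarrow>\<^sub>E FO A" if "j \<in> I" for j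
    unfolding \<iota>_def using amap_eq[OF sd[OF that] A, of "\<lambda>x. x"] dP(1)[OF that] by auto
  \<comment> \<open>The joint image \<open>?U\<close> receives the cocone, so the identity of \<open>F A\<close> factors through it.\<close>
  let ?U = "\<Union>j\<in>I. fmap (d j) A (\<lambda>x. x) ` FO (d j)"
  have UF: "?U \<subseteq> FO A" using F\<iota>(2) by blast
  have sU: "small ?U" using small_subset[OF small_F[OF A] UF] .
  let ?\<zeta> = "\<lambda>j. (FO (d j), fmap (d j) A (\<lambda>x. x), ?U)"
  let ?incl = "(?U, restrict (\<lambda>x. x) ?U, FO A)"
  interpret S: category Sets by (rule category_Sets)
  have "is_cocone J Sets (comp_fctr F D) ?U ?\<zeta>"
    unfolding is_cocone_def
  proof (intro conjI ballI)
    show "?U \<in> Obj Sets" using sU by (simp add: Sets_def)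
    fix j assume "j \<in> Obj J"
    then have j: "j \<in> I" by (simp add: J_def)
    have "fmap (d j) A (\<lambda>x. x) \<in> FO (d j) \<rightarrow>\<^sub>E ?U"
      using F\<iota>(2)[OF j] j by (auto simp: PiE_def)
    then show "?\<zeta> j \<in> hom Sets (omap (comp_fctr F D) j) ?U"
      using sU small_F[OF sd[OF j]] by (simp add: Sets_def hom_def comp_fctr_def D_def)
  next
    fix a assume a: "a \<in> Arr J"
    then have i: "p a \<in> I" "q a \<in> I" "d (p a) \<subseteq> d (q a)" by (auto simp: J_def)
    have "amap F (\<iota> (Cod J a)) \<cdot>\<^bsub>Sets\<^esub> amap (comp_fctr F D) a = amap F (\<iota> (Dom J a))"
      using F_co a unfolding is_cocone_def by blast
    moreover have "fsrc (amap (comp_fctr F D) a) = FO (d (p a))"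
    proof -
      have id: "(\<lambda>x. x) \<in> d (p a) \<rightarrow> d (q a)" using i(3) by blast
      show ?thesis using amap_eq(1)[OF sd[OF i(1)] sd[OF i(2)] id] by (simp add: comp_fctr_def D_def)
    qed
    ultimately show "?\<zeta> (Cod J a) \<cdot>\<^bsub>Sets\<^esub> amap (comp_fctr F D) a = ?\<zeta> (Dom J a)"
      using F\<iota>(1)[OF i(1)] F\<iota>(1)[OF i(2)] by (simp add: J_def Sets_def)
  qed
  from F_univ[OF this] obtain h where h: "h \<in> hom Sets (FO A) ?U" "\<forall>j\<in>Obj J. h \<cdot>\<^bsub>Sets\<^esub> amap F (\<iota> j) = ?\<zeta> j"
    by blast
  have incl: "?incl \<in> hom Sets ?U (FO A)" using UF sU small_F[OF A] by (auto simp: Sets_def hom_def)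
  have "?incl \<cdot>\<^bsub>Sets\<^esub> h \<in> hom Sets (FO A) (FO A) \<and> (\<forall>j\<in>Obj J. (?incl \<cdot>\<^bsub>Sets\<^esub> h) \<cdot>\<^bsub>Sets\<^esub> amap F (\<iota> j) = amap F (\<iota> j))"
  proof (intro conjI ballI S.Comp_hom[OF h(1) incl])
    fix j assume jJ: "j \<in> Obj J"
    then have j: "j \<in> I" by (simp add: J_def)
    have m: "amap F (\<iota> j) \<in> hom Sets (FO (d j)) (FO A)"
      using F\<iota>[OF j] small_F[OF sd[OF j]] small_F[OF A] by (simp add: Sets_def hom_def)
    have "(?incl \<cdot>\<^bsub>Sets\<^esub> h) \<cdot>\<^bsub>Sets\<^esub> amap F (\<iota> j) = ?incl \<cdot>\<^bsub>Sets\<^esub> ?\<zeta> j"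
      using S.Comp_assoc[OF m h(1) incl] h(2) jJ by simp
    also have "\<dots> = amap F (\<iota> j)"
    proof -
      have "compose (FO (d j)) (restrict (\<lambda>x. x) ?U) (fmap (d j) A (\<lambda>x. x)) = fmap (d j) A (\<lambda>x. x)"
        using F\<iota>(2)[OF j] j by (auto simp: compose_def fun_eq_iff PiE_def extensional_def)
      then show ?thesis using F\<iota>(1)[OF j] by (simp add: Sets_def)
    qed
    finally show "(?incl \<cdot>\<^bsub>Sets\<^esub> h) \<cdot>\<^bsub>Sets\<^esub> amap F (\<iota> j) = amap F (\<iota> j)" .
  qed
  moreover have "\<one>\<^bsub>Sets\<^esub> (FO A) \<in> hom Sets (FO A) (FO A) \<and> (\<forall>j\<in>Obj J. \<one>\<^bsub>Sets\<^esub> (FO A) \<cdot>\<^bsub>Sets\<^esub> amap F (\<iota> j) = amap F (\<iota> j))"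
    using F_co S.Ide_hom[of "FO A"] S.Ide_Comp unfolding is_cocone_def by blast
  ultimately have idh: "?incl \<cdot>\<^bsub>Sets\<^esub> h = \<one>\<^bsub>Sets\<^esub> (FO A)" using F_univ[OF F_co] by blast
  obtain h' where h': "h = (FO A, h', ?U)" "h' \<in> FO A \<rightarrow>\<^sub>E ?U" using h(1) by (auto simp: Sets_def hom_def)
  have "compose (FO A) (restrict (\<lambda>x. x) ?U) h' = (\<lambda>x\<in>FO A. x)"
    using idh by (simp add: h'(1) Sets_def)
  then have "compose (FO A) (restrict (\<lambda>x. x) ?U) h' u = u" using u by simp
  moreover have "h' u \<in> ?U" using h'(2) u by blast
  ultimately have "u \<in> ?U" using u by (simp add: compose_def)
  then obtain j where "j \<in> I" "u \<in> fmap (d j) A (\<lambda>x. x) ` FO (d j)" by blast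
  then show ?thesis using that dP by blast
qed

text \<open>
  Close the point under chosen supports of the structure map. After \<open>\<omega>\<close> steps the set contains the
  supports of all its elements, hence is a subcoalgebra, and it is a countable union of sets of size
  at most \<open>r\<close>.
\<close>

lemma accessible_bounded:
  assumes "accessible F" shows "bounded F"
proof -
  obtain r :: "'u rel" where r: "Cinfinite r" "regularCard r" "r <o |UNIV :: 'u set|" "preserves_filtered_colimits r F"
    using assms by (auto simp: accessible_def)
  have inf: "infinite (Field r)" and cr: "Card_order r" using r(1) by (auto simp: cinfinite_def)
  show ?thesis
    unfolding bounded_def
  proof (intro exI[of _ r] conjI allI impI ballI cr r(3))
    fix A \<alpha> x0 assume "coalgebra F (A, \<alpha>)" and x0: "x0 \<in> A"
    then obtain a where \<alpha>: "\<alpha> = (A, restrict a A, FO A)" and c: "coalg A a" unfolding coalgebra_iff by blast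
    note A = coalgD(1)[OF c]
    have "\<exists>S. S \<subseteq> A \<and> |S| <o r \<and> a x \<in> fmap S A (\<lambda>x. x) ` FO S" if "x \<in> A" for x
      using accessible_support[OF r A coalgD(2)[OF c that]] by metis
    then obtain supp where supp: "\<And>x. x \<in> A \<Longrightarrow> supp x \<subseteq> A" "\<And>x. x \<in> A \<Longrightarrow> |supp x| <o r"
      "\<And>x. x \<in> A \<Longrightarrow> a x \<in> fmap (supp x) A (\<lambda>x. x) ` FO (supp x)" by metis
    define T where "T = rec_nat {x0} (\<lambda>_ S. S \<union> (\<Union>x\<in>S. supp x))"
    have T0: "T 0 = {x0}" and TS: "T (Suc n) = T n \<union> (\<Union>x\<in>T n. supp x)" for n by (simp_all add: T_def)
    have T: "T n \<subseteq> A \<and> |T n| \<le>o r" for n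
    proof (induction n)
      case 0
      have "|{x0}| <o r" by (rule finite_less_Cinfinite[OF r(1)]) simp
      then show ?case using x0 T0 ordLess_imp_ordLeq by auto
    next
      case (Suc n)
      have "|\<Union>x\<in>T n. supp x| \<le>o r"
        by (rule card_of_UNION_ordLeq_infinite_Field[OF inf cr]) (use Suc supp(2) ordLess_imp_ordLeq in blast)+
      then have "|T (Suc n)| \<le>o r" unfolding TS
        using Suc by (intro card_of_Un_ordLeq_infinite_Field[OF inf]) (auto simp: cr)
      then show ?case using Suc supp(1) TS by blast
    qed
    let ?S = "\<Union>n. T n"
    have SA: "?S \<subseteq> A" using T by blast
    have natr: "|UNIV :: nat set| \<le>o r"
      using inf cr infinite_iff_card_of_nat[of "Field r"] card_of_Field_ordIso ordLeq_ordIso_trans by blast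
    have Sr: "|?S| \<le>o r"
      by (rule card_of_UNION_ordLeq_infinite_Field[OF inf cr natr]) (use T in blast)
    have sS: "small ?S" using small_subset[OF A SA] .
    have ex: "\<exists>y. y \<in> FO ?S \<and> fmap ?S A (\<lambda>x. x) y = a x" if x: "x \<in> ?S" for x
    proof -
      obtain n where n: "x \<in> T n" using x by (rule UN_E)
      have "supp x \<subseteq> T (Suc n)" unfolding TS using n by (rule UN_upper[THEN le_supI2])
      then have sub: "supp x \<subseteq> ?S" by (rule order_trans) (rule UN_upper, simp)
      have xA: "x \<in> A" using SA x by (rule subsetD)
      obtain y where y: "y \<in> FO (supp x)" "a x = fmap (supp x) A (\<lambda>x. x) y"
        using supp(3)[OF xA] by (rule imageE) 
      have ss: "small (supp x)" using small_subset[OF A supp(1)[OF xA]] .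
      have i: "(\<lambda>x. x) \<in> supp x \<rightarrow> ?S" "(\<lambda>x. x) \<in> ?S \<rightarrow> A"
        by (rule funcsetI, erule subsetD[OF sub], rule funcsetI, erule subsetD[OF SA])
      have "fmap ?S A (\<lambda>x. x) (fmap (supp x) ?S (\<lambda>x. x) y) = a x"
        by (rule trans[OF fmap_comp[OF ss sS A i y(1)] y(2)[symmetric]])
      with fmap_in[OF ss sS i(1) y(1)] show ?thesis by (intro exI conjI)
    qed
    define s where "s x = (SOME y. y \<in> FO ?S \<and> fmap ?S A (\<lambda>x. x) y = a x)" for x
    have "subco A a ?S s"
      by (rule subcoI[OF SA sS], unfold s_def, rule someI_ex[OF ex])
    moreover have "x0 \<in> ?S" using T0 by blast
    ultimately show "\<exists>S. subcoalgebra F (A, \<alpha>) S \<and> x0 \<in> S \<and> |S| \<le>o r"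
      unfolding \<alpha> subcoalgebra_iff[OF c] using Sr by blast
  qed
qed

end

context set_functor begin

section \<open>Arrows of coalgebras\<close>

definition coalg_ob :: "'u set \<Rightarrow> ('u \<Rightarrow> 'u) \<Rightarrow> 'u coalg" where
  "coalg_ob A a = (A, (A, restrict a A, FO A))"

definition coalg_ar :: "'u set \<Rightarrow> ('u \<Rightarrow> 'u) \<Rightarrow> 'u set \<Rightarrow> ('u \<Rightarrow> 'u) \<Rightarrow> ('u \<Rightarrow> 'u) \<Rightarrow> 'u coalg_mor" where
  "coalg_ar A a B b f = (coalg_ob A a, (A, restrict f A, B), coalg_ob B b)"

lemma SetF_ObjE:
  assumes "X \<in> Obj (SetF F)" obtains A a where "X = coalg_ob A a" "coalg A a"
  using assms by (auto simp: SetF_def coalgebra_iff coalg_ob_def)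

lemma coalg_ob_Obj: "coalg A a \<Longrightarrow> coalg_ob A a \<in> Obj (SetF F)"
  by (auto simp: SetF_def coalgebra_iff coalg_ob_def)

lemma coalg_ar_Arr: "coalg A a \<Longrightarrow> coalg B b \<Longrightarrow> cmor A a B b f \<Longrightarrow> coalg_ar A a B b f \<in> Arr (SetF F)"
  using coalg_ob_Obj[of A a] coalg_ob_Obj[of B b] coalg_hom_iff[of A a B b] by (auto simp: SetF_def coalg_ar_def coalg_ob_def)

lemma coalg_ar_Dom [simp]: "Dom (SetF F) (coalg_ar A a B b f) = coalg_ob A a" "Cod (SetF F) (coalg_ar A a B b f) = coalg_ob B b"
  by (simp_all add: SetF_def coalg_ar_def)

lemma coalg_ar_comp: "f \<in> A \<rightarrow> B \<Longrightarrow> coalg_ar B b D d g \<cdot>\<^bsub>SetF F\<^esub> coalg_ar A a B b f = coalg_ar A a D d (\<lambda>x. g (f x))"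
  by (auto simp: SetF_def coalg_ar_def Sets_def compose_def restrict_def fun_eq_iff)

lemma coalg_ar_eq_iff: "coalg_ar A a B b f = coalg_ar A a B b f' \<longleftrightarrow> (\<forall>x\<in>A. f x = f' x)"
  by (auto simp: coalg_ar_def restrict_def fun_eq_iff)

lemma SetF_ArrE:
  assumes "\<phi> \<in> Arr (SetF F)" "Dom (SetF F) \<phi> = coalg_ob A a" "Cod (SetF F) \<phi> = coalg_ob B b" "coalg A a" "coalg B b"
  obtains f where "\<phi> = coalg_ar A a B b f" "cmor A a B b f"
proof -
  obtain \<psi> where p: "\<phi> = (coalg_ob A a, \<psi>, coalg_ob B b)" "coalg_hom F (coalg_ob A a) (coalg_ob B b) \<psi>"
    using assms(1-3) by (auto simp: SetF_def)
  then show ?thesis using coalg_hom_iff[OF assms(4,5)] that by (auto simp: coalg_ob_def coalg_ar_def)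
qed

lemma SetF_Dom_Obj: "\<phi> \<in> Arr (SetF F) \<Longrightarrow> Dom (SetF F) \<phi> \<in> Obj (SetF F)" "\<phi> \<in> Arr (SetF F) \<Longrightarrow> Cod (SetF F) \<phi> \<in> Obj (SetF F)"
  by (fact category.Dom_Obj[OF category_SetF[OF F_functor]] category.Cod_Obj[OF category_SetF[OF F_functor]])+

end

section \<open>Spans of coalgebras and their quotients\<close>

lemma trancl_equiv:
  assumes "\<theta> \<subseteq> K \<times> K" "sym \<theta>" "\<And>x. x \<in> K \<Longrightarrow> (x, x) \<in> \<theta>"
  shows "equiv K (\<theta>\<^sup>+)"
proof (rule equivI)
  show s: "\<theta>\<^sup>+ \<subseteq> K \<times> K" using assms(1) by (rule trancl_subset_Sigma)
  show "refl_on K (\<theta>\<^sup>+)" using assms(3) s by (auto simp: refl_on_def)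
  show "sym (\<theta>\<^sup>+)" using assms(2) by (rule sym_trancl)
qed (rule trans_trancl)

locale coalgebra_pair = set_functor F for F :: "'u endo" +
  fixes A B :: "'u set" and a b :: "'u \<Rightarrow> 'u"
  assumes A: "coalg A a" and B: "coalg B b"
begin

text \<open>
  The spans over the two given coalgebras; a product is a terminal object among them.
\<close>

definition span :: "'u set \<Rightarrow> ('u \<Rightarrow> 'u) \<Rightarrow> ('u \<Rightarrow> 'u) \<Rightarrow> ('u \<Rightarrow> 'u) \<Rightarrow> bool" where
  "span S s f g \<longleftrightarrow> coalg S s \<and> cmor S s A a f \<and> cmor S s B b g"

definition smor where
  "smor S s f g S' s' f' g' h \<longleftrightarrow> cmor S s S' s' h \<and> (\<forall>x\<in>S. f' (h x) = f x \<and> g' (h x) = g x)"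

lemma spanD: "span S s f g \<Longrightarrow> coalg S s" "span S s f g \<Longrightarrow> cmor S s A a f" "span S s f g \<Longrightarrow> cmor S s B b g"
  by (auto simp: span_def)

lemma smorD: "smor S s f g S' s' f' g' h \<Longrightarrow> cmor S s S' s' h"
  "smor S s f g S' s' f' g' h \<Longrightarrow> x \<in> S \<Longrightarrow> f' (h x) = f x"
  "smor S s f g S' s' f' g' h \<Longrightarrow> x \<in> S \<Longrightarrow> g' (h x) = g x"
  by (auto simp: smor_def)

lemma smor_comp:
  assumes "smor S s f g S' s' f' g' h" "smor S' s' f' g' S'' s'' f'' g'' h'"
    "coalg S s" "coalg S' s'" "coalg S'' s''"
  shows "smor S s f g S'' s'' f'' g'' (\<lambda>x. h' (h x))"
  using cmor_comp[OF smorD(1)[OF assms(1)] smorD(1)[OF assms(2)] assms(3-5)]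
    smorD(2,3)[OF assms(1)] smorD(2,3)[OF assms(2)] cmorD(2)[OF smorD(1)[OF assms(1)]]
  by (simp add: smor_def)

text \<open>
  The last clause says that \<open>k\<close> is compatible with \<open>\<theta>\<close> after every function that respects \<open>\<theta>\<close>. Applied
  to the quotient map it is the condition for the structure to descend to the quotient by the
  equivalence generated by \<open>\<theta>\<close>; the quantification over all \<open>c\<close> makes it independent of the
  representation of this quotient.
\<close>

definition span_congruence where
  "span_congruence K k f g \<theta> \<longleftrightarrow> \<theta> \<subseteq> K \<times> K \<and> sym \<theta> \<and> (\<forall>x\<in>K. (x, x) \<in> \<theta>)
     \<and> (\<forall>x y. (x, y) \<in> \<theta> \<longrightarrow> f x = f y \<and> g x = g y)
     \<and> (\<forall>Z c. small Z \<longrightarrow> c \<in> K \<rightarrow> Z \<longrightarrow> (\<forall>x y. (x, y) \<in> \<theta> \<longrightarrow> c x = c y) \<longrightarrow>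
           (\<forall>x y. (x, y) \<in> \<theta> \<longrightarrow> fmap K Z c (k x) = fmap K Z c (k y)))"

text \<open>
  The carrier of the quotient has to be a subset of \<open>'u\<close>; it consists of chosen representatives of the
  classes of \<open>\<theta>\<^sup>+\<close>.
\<close>

lemma span_quotient:
  assumes K: "span K k f g" and "span_congruence K k f g \<theta>"
  obtains T t f' g' w where "span T t f' g'" "smor K k f g T t f' g' w" "w ` K = T"
    "\<forall>x y. (x, y) \<in> \<theta> \<longrightarrow> w x = w y"
proof -
  have \<theta>: "\<theta> \<subseteq> K \<times> K" "sym \<theta>" "\<And>x. x \<in> K \<Longrightarrow> (x, x) \<in> \<theta>"
    and ker: "\<And>x y. (x, y) \<in> \<theta> \<Longrightarrow> f x = f y \<and> g x = g y"
    using assms(2) by (simp_all add: span_congruence_def)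
  have cong: "fmap K Z c (k x) = fmap K Z c (k y)"
    if "small Z" "c \<in> K \<rightarrow> Z" "\<And>x y. (x, y) \<in> \<theta> \<Longrightarrow> c x = c y" "(x, y) \<in> \<theta>" for Z c x y
    by (rule assms(2)[unfolded span_congruence_def, THEN conjunct2, THEN conjunct2, THEN conjunct2,
          THEN conjunct2, rule_format, OF that(1,2) _ that(4)]) (rule that(3))
  note sK = coalgD(1)[OF spanD(1)[OF K]] and kF = coalgD(2)[OF spanD(1)[OF K]]
    and sA = coalgD(1)[OF A] and sB = coalgD(1)[OF B]
  have eq: "equiv K (\<theta>\<^sup>+)" using \<theta> by (rule trancl_equiv)
  define w where "w x = (SOME y. (x, y) \<in> \<theta>\<^sup>+)" for x
  let ?T = "w ` K"
  have xw: "(x, w x) \<in> \<theta>\<^sup>+" if "x \<in> K" for x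
    unfolding w_def by (rule someI[of _ x]) (use \<theta>(3)[OF that] in blast)
  have w_eq: "w x = w y" if "(x, y) \<in> \<theta>\<^sup>+" for x y
  proof -
    have "{z. (x, z) \<in> \<theta>\<^sup>+} = {z. (y, z) \<in> \<theta>\<^sup>+}"
      using that eq unfolding equiv_def sym_def by (blast intro: trancl_trans)
    then have "(\<lambda>z. (x, z) \<in> \<theta>\<^sup>+) = (\<lambda>z. (y, z) \<in> \<theta>\<^sup>+)" by (simp add: set_eq_iff fun_eq_iff)
    then show ?thesis by (simp add: w_def)
  qed
  have TK: "?T \<subseteq> K" using xw trancl_subset_Sigma[OF \<theta>(1)] by blast
  have sT: "small ?T" using small_subset[OF sK TK] .
  have wT: "w \<in> K \<rightarrow> ?T" by blast
  define t where "t y = fmap K ?T w (k y)" for y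
  have t1: "t x = t y" if "(x, y) \<in> \<theta>" for x y
    unfolding t_def by (rule cong[OF sT wT _ that]) (rule w_eq, blast)
  have t2: "t x = t y" if "(x, y) \<in> \<theta>\<^sup>+" for x y
    using that by (induction rule: trancl_induct) (auto dest: t1)
  have ker2: "f x = f y \<and> g x = g y" if "(x, y) \<in> \<theta>\<^sup>+" for x y
    using that by (induction rule: trancl_induct) (auto dest: ker)
  have cT: "coalg ?T t"
    unfolding coalg_def t_def using sT TK by (auto intro!: fmap_in[OF sK sT wT] kF)
  have cw: "cmor K k ?T t w"
    unfolding cmor_def using wT t2[OF xw] by (auto simp: t_def)
  have quot: "cmor ?T t Z z h" if Z: "coalg Z z" "cmor K k Z z h" and h: "\<And>x. x \<in> K \<Longrightarrow> h (w x) = h x" for Z z h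
    unfolding cmor_def
  proof (intro conjI ballI)
    show hT: "h \<in> ?T \<rightarrow> Z" using cmorD(2)[OF Z(2)] TK by blast
    fix y assume "y \<in> ?T"
    then have y: "y \<in> K" using TK by blast
    have "z (h y) = fmap K Z h (k y)" using cmorD(3)[OF Z(2) y] .
    also have "\<dots> = fmap K Z (\<lambda>x. h (w x)) (k y)"
      by (rule fun_cong[OF fmap_cong]) (simp add: h)
    also have "\<dots> = fmap ?T Z h (t y)"
      unfolding t_def by (rule fmap_comp[symmetric, OF sK sT coalgD(1)[OF Z(1)] wT hT kF[OF y]])
    finally show "z (h y) = fmap ?T Z h (t y)" .
  qed
  have fw: "f (w x) = f x" "g (w x) = g x" if "x \<in> K" for x using ker2[OF xw[OF that]] by auto
  show ?thesis
  proof (rule that)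
    show "span ?T t f g"
      unfolding span_def using cT quot[OF A spanD(2)[OF K] fw(1)] quot[OF B spanD(3)[OF K] fw(2)] by blast
    show "smor K k f g ?T t f g w" unfolding smor_def using cw fw by blast
    show "\<forall>x y. (x, y) \<in> \<theta> \<longrightarrow> w x = w y" using w_eq by blast
  qed simp
qed

lemma span_coproduct:
  fixes \<Sigma> :: "('u set \<times> ('u \<Rightarrow> 'u) \<times> ('u \<Rightarrow> 'u) \<times> ('u \<Rightarrow> 'u)) set"
  assumes small: "lt_universe TYPE('u) \<Sigma>" and span: "\<And>S s f g. (S, s, f, g) \<in> \<Sigma> \<Longrightarrow> span S s f g"
  obtains K k f' g' where "span K k f' g'" "\<And>S s f g. (S, s, f, g) \<in> \<Sigma> \<Longrightarrow> \<exists>i. smor S s f g K k f' g' i"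
proof -
  have sp: "span (fst \<sigma>) (fst (snd \<sigma>)) (fst (snd (snd \<sigma>))) (snd (snd (snd \<sigma>)))" if "\<sigma> \<in> \<Sigma>" for \<sigma>
    using span that by (cases \<sigma>) auto
  let ?K = "SIGMA \<sigma>:\<Sigma>. fst \<sigma>"
  have K: "lt_universe TYPE('u) ?K"
    using small by (rule lt_universe_Sigma) (use coalgD(1)[OF spanD(1)[OF sp]] in \<open>simp add: small_def\<close>)
  obtain e :: "('u set \<times> ('u \<Rightarrow> 'u) \<times> ('u \<Rightarrow> 'u) \<times> ('u \<Rightarrow> 'u)) \<times> 'u \<Rightarrow> 'u" where e: "inj_on e ?K"
    using lt_universe_inj[OF K] .
  define K where "K = e ` ?K"
  define d where "d = inv_into ?K e"
  have de: "d (e (\<sigma>, x)) = (\<sigma>, x)" if "\<sigma> \<in> \<Sigma>" "x \<in> fst \<sigma>" for \<sigma> x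
    unfolding d_def by (rule inv_into_f_f[OF e]) (use that in auto)
  have sK: "small K" unfolding K_def small_def using K by (rule lt_universe_image)
  have eK: "e (\<sigma>, x) \<in> K" if "\<sigma> \<in> \<Sigma>" "x \<in> fst \<sigma>" for \<sigma> x using that by (auto simp: K_def)
  have KE: "\<exists>\<sigma> x. z = e (\<sigma>, x) \<and> \<sigma> \<in> \<Sigma> \<and> x \<in> fst \<sigma>" if "z \<in> K" for z using that unfolding K_def by blast
  define k where "k z = (case d z of (\<sigma>, x) \<Rightarrow> fmap (fst \<sigma>) K (\<lambda>x. e (\<sigma>, x)) (fst (snd \<sigma>) x))" for z
  define f' where "f' z = (case d z of (\<sigma>, x) \<Rightarrow> fst (snd (snd \<sigma>)) x)" for z
  define g' where "g' z = (case d z of (\<sigma>, x) \<Rightarrow> snd (snd (snd \<sigma>)) x)" for z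
  have kc: "coalg K k"
    unfolding coalg_def
  proof (intro conjI sK funcsetI)
    fix z assume "z \<in> K"
    then obtain \<sigma> x where z: "z = e (\<sigma>, x)" "\<sigma> \<in> \<Sigma>" "x \<in> fst \<sigma>" using KE by blast
    note c = spanD(1)[OF sp[OF z(2)]]
    show "k z \<in> FO K"
      unfolding z(1) k_def de[OF z(2,3)] prod.case
      by (rule fmap_in[OF coalgD(1)[OF c] sK _ coalgD(2)[OF c z(3)]]) (use eK z(2) in blast)
  qed
  have ci: "cmor (fst \<sigma>) (fst (snd \<sigma>)) K k (\<lambda>x. e (\<sigma>, x))" if "\<sigma> \<in> \<Sigma>" for \<sigma>
    unfolding cmor_def k_def using that eK de by auto
  have copair: "cmor K k Z z h"
    if Z: "coalg Z z" and h: "\<And>\<sigma>. \<sigma> \<in> \<Sigma> \<Longrightarrow> cmor (fst \<sigma>) (fst (snd \<sigma>)) Z z (\<lambda>x. h (e (\<sigma>, x)))" for Z z h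
    unfolding cmor_def
  proof (intro conjI ballI)
    show hK: "h \<in> K \<rightarrow> Z" using KE cmorD(2)[OF h] by blast
    fix y assume "y \<in> K"
    then obtain \<sigma> x where y: "y = e (\<sigma>, x)" "\<sigma> \<in> \<Sigma>" "x \<in> fst \<sigma>" using KE by blast
    note c = spanD(1)[OF sp[OF y(2)]]
    have "z (h y) = fmap (fst \<sigma>) Z (\<lambda>x. h (e (\<sigma>, x))) (fst (snd \<sigma>) x)"
      using cmorD(3)[OF h[OF y(2)] y(3)] y(1) by simp
    also have "\<dots> = fmap K Z h (fmap (fst \<sigma>) K (\<lambda>x. e (\<sigma>, x)) (fst (snd \<sigma>) x))"
      by (rule fmap_comp[symmetric, OF coalgD(1)[OF c] sK coalgD(1)[OF Z] cmorD(1)[OF ci[OF y(2)]] hK coalgD(2)[OF c y(3)]])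
    also have "\<dots> = fmap K Z h (k y)" using cmorD(3)[OF ci[OF y(2)] y(3)] y(1) by simp
    finally show "z (h y) = fmap K Z h (k y)" .
  qed
  have f'e: "f' (e (\<sigma>, x)) = fst (snd (snd \<sigma>)) x" "g' (e (\<sigma>, x)) = snd (snd (snd \<sigma>)) x"
    if "\<sigma> \<in> \<Sigma>" "x \<in> fst \<sigma>" for \<sigma> x using de[OF that] by (simp_all add: f'_def g'_def)
  show ?thesis
  proof (rule that)
    show "span K k f' g'"
      unfolding span_def
    proof (intro conjI kc)
      show "cmor K k A a f'"
        by (rule copair[OF A], rule cmor_cong[OF spanD(2)[OF sp]]) (simp_all add: f'e)
      show "cmor K k B b g'"
        by (rule copair[OF B], rule cmor_cong[OF spanD(3)[OF sp]]) (simp_all add: f'e)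
    qed
    fix S s f g assume "(S, s, f, g) \<in> \<Sigma>"
    then have "smor S s f g K k f' g' (\<lambda>x. e ((S, s, f, g), x))"
      using ci[of "(S, s, f, g)"] f'e[of "(S, s, f, g)"] by (simp add: smor_def)
    then show "\<exists>i. smor S s f g K k f' g' i" by blast
  qed
qed

definition subterminal where
  "subterminal T t f g \<longleftrightarrow> span T t f g \<and> (\<forall>S s f' g' u v. span S s f' g' \<longrightarrow>
     smor S s f' g' T t f g u \<longrightarrow> smor S s f' g' T t f g v \<longrightarrow> (\<forall>x\<in>S. u x = v x))"

lemma subterminalD:
  assumes "subterminal T t f g"
  shows "span T t f g" "span S s f' g' \<Longrightarrow> smor S s f' g' T t f g u \<Longrightarrow> smor S s f' g' T t f g v \<Longrightarrow>
     x \<in> S \<Longrightarrow> u x = v x"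
  using assms unfolding subterminal_def by blast+

text \<open>
  Divide \<open>K\<close> by the equivalence generated by all pairs that some morphism of spans out of \<open>K\<close>
  identifies. Two morphisms \<open>u\<close> and \<open>v\<close> to the quotient \<open>T\<close> have a coequalizer \<open>T'\<close>, and the composite
  \<open>K \<rightarrow> T \<rightarrow> T'\<close> witnesses that \<open>u x\<close> and \<open>v x\<close> were already identified in \<open>T\<close>.
\<close>

lemma subterminal_span:
  assumes K: "span K k f g"
  obtains T t f' g' w where "subterminal T t f' g'" "smor K k f g T t f' g' w"
proof -
  define \<theta> where "\<theta> = {(x, y). x \<in> K \<and> y \<in> K \<and> (\<exists>W \<omega> f' g' h. span W \<omega> f' g' \<and> smor K k f g W \<omega> f' g' h \<and> h x = h y)}"
  note sK = coalgD(1)[OF spanD(1)[OF K]] and kF = coalgD(2)[OF spanD(1)[OF K]]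
  have idK: "smor K k f g K k f g (\<lambda>x. x)" using cmor_id[OF spanD(1)[OF K]] by (simp add: smor_def)
  have 1: "\<theta> \<subseteq> K \<times> K" by (auto simp: \<theta>_def)
  have 2: "sym \<theta>" unfolding sym_def \<theta>_def by (auto; metis)
  have 3: "(x, x) \<in> \<theta>" if "x \<in> K" for x using that K idK unfolding \<theta>_def by blast
  have 4: "f x = f y \<and> g x = g y" if "(x, y) \<in> \<theta>" for x y
  proof -
    obtain W \<omega> f' g' h where h: "smor K k f g W \<omega> f' g' h" "h x = h y" "x \<in> K" "y \<in> K"
      using \<open>(x, y) \<in> \<theta>\<close> by (auto simp: \<theta>_def)
    show ?thesis using smorD(2,3)[OF h(1) h(3)] smorD(2,3)[OF h(1) h(4)] h(2) by simp
  qed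
  have 5: "fmap K Z c (k x) = fmap K Z c (k y)"
    if Z: "small Z" "c \<in> K \<rightarrow> Z" and c: "\<And>x y. (x, y) \<in> \<theta> \<Longrightarrow> c x = c y" and xy: "(x, y) \<in> \<theta>" for Z c x y
  proof -
    obtain W \<omega> f' g' h where W: "span W \<omega> f' g'" and h: "smor K k f g W \<omega> f' g' h" "h x = h y" and K': "x \<in> K" "y \<in> K"
      using xy by (auto simp: \<theta>_def)
    \<comment> \<open>\<open>\<theta>\<close> contains the kernel of \<open>h\<close>, so \<open>c\<close> factors through \<open>h\<close>; outside the image of \<open>h\<close> any value will do.\<close>
    define c' where "c' z = (if z \<in> h ` K then c (inv_into K h z) else c x)" for z
    have c': "c' (h z) = c z" if z: "z \<in> K" for z
    proof -
      have "inv_into K h (h z) \<in> K" "h (inv_into K h (h z)) = h z"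
        using z by (auto intro: inv_into_into f_inv_into_f)
      then have "(inv_into K h (h z), z) \<in> \<theta>" using z W h(1) unfolding \<theta>_def by blast
      then show ?thesis using c z by (simp add: c'_def)
    qed
    have c'Z: "c' \<in> W \<rightarrow> Z"
      using funcset_mem[OF Z(2)] K'(1) inv_into_into[of _ h K] by (simp add: c'_def)
    have hW: "h \<in> K \<rightarrow> W" using cmorD(1)[OF smorD(1)[OF h(1)]] .
    have fac: "fmap K Z c (k z) = fmap W Z c' (\<omega> (h z))" if z: "z \<in> K" for z
    proof -
      have "fmap K Z c (k z) = fmap K Z (\<lambda>x. c' (h x)) (k z)"
        by (rule fun_cong[OF fmap_cong]) (simp add: c')
      also have "\<dots> = fmap W Z c' (fmap K W h (k z))"
        by (rule fmap_comp[symmetric, OF sK coalgD(1)[OF spanD(1)[OF W]] Z(1) hW c'Z kF[OF z]])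
      also have "\<dots> = fmap W Z c' (\<omega> (h z))" using cmorD(3)[OF smorD(1)[OF h(1)] z] by simp
      finally show ?thesis .
    qed
    show ?thesis using fac K' h(2) by simp
  qed
  have "span_congruence K k f g \<theta>" unfolding span_congruence_def using 1 2 3 4 5 by blast
  then obtain T t f' g' w where T: "span T t f' g'" "smor K k f g T t f' g' w" "w ` K = T"
    "\<forall>x y. (x, y) \<in> \<theta> \<longrightarrow> w x = w y"
    by (rule span_quotient[OF K])
  note cT = spanD(1)[OF T(1)]
  have "u x = v x" if S: "span S s f'' g''" and u: "smor S s f'' g'' T t f' g' u" and v: "smor S s f'' g'' T t f' g' v"
    and x: "x \<in> S" for S s f'' g'' u v x
  proof -
    \<comment> \<open>The equivalence generated by \<open>\<eta>\<close> is the kernel of the coequalizer of \<open>u\<close> and \<open>v\<close>.\<close>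
    define \<eta> where "\<eta> = {(y, y) |y. y \<in> T} \<union> {(u x, v x) |x. x \<in> S} \<union> {(v x, u x) |x. x \<in> S}"
    note uT = cmorD(1,2)[OF smorD(1)[OF u]] and vT = cmorD(1,2)[OF smorD(1)[OF v]]
    have a1: "\<eta> \<subseteq> T \<times> T" using uT vT by (auto simp: \<eta>_def)
    have a2: "sym \<eta>" by (auto simp: \<eta>_def sym_def)
    have a3: "(y, y) \<in> \<eta>" if "y \<in> T" for y using that by (simp add: \<eta>_def)
    have a4: "f' y = f' z \<and> g' y = g' z" if "(y, z) \<in> \<eta>" for y z
      using that smorD(2,3)[OF u] smorD(2,3)[OF v] by (auto simp: \<eta>_def)
    have a5: "fmap T Z c (t y) = fmap T Z c (t z)"
      if Z: "small Z" "c \<in> T \<rightarrow> Z" and c: "\<And>x y. (x, y) \<in> \<eta> \<Longrightarrow> c x = c y" and yz: "(y, z) \<in> \<eta>" for Z c y z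
    proof -
      have cuv: "fmap T Z c (t (u x)) = fmap T Z c (t (v x))" if x: "x \<in> S" for x
      proof -
        note ss = coalgD(1)[OF spanD(1)[OF S]] coalgD(1)[OF cT] Z(1)
        have "fmap T Z c (t (u x)) = fmap S Z (\<lambda>x. c (u x)) (s x)"
          using fmap_comp[OF ss uT(1) Z(2) coalgD(2)[OF spanD(1)[OF S] x]] cmorD(3)[OF smorD(1)[OF u] x] by simp
        also have "\<dots> = fmap S Z (\<lambda>x. c (v x)) (s x)"
          by (rule fun_cong[OF fmap_cong], rule c) (auto simp: \<eta>_def)
        also have "\<dots> = fmap T Z c (t (v x))"
          using fmap_comp[OF ss vT(1) Z(2) coalgD(2)[OF spanD(1)[OF S] x]] cmorD(3)[OF smorD(1)[OF v] x] by simp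
        finally show ?thesis .
      qed
      from yz show ?thesis by (auto simp: \<eta>_def cuv)
    qed
    have "span_congruence T t f' g' \<eta>" unfolding span_congruence_def using a1 a2 a3 a4 a5 by blast
    then obtain T' t' f3 g3 w' where T': "span T' t' f3 g3" "smor T t f' g' T' t' f3 g3 w'"
      "\<forall>x y. (x, y) \<in> \<eta> \<longrightarrow> w' x = w' y"
      by (rule span_quotient[OF T(1)])
    have ww: "smor K k f g T' t' f3 g3 (\<lambda>x. w' (w x))"
      by (rule smor_comp[OF T(2) T'(2) spanD(1)[OF K] cT spanD(1)[OF T'(1)]])
    obtain y z where yz: "y \<in> K" "z \<in> K" "w y = u x" "w z = v x"
      using uT(2)[OF x] vT(2)[OF x] T(3) by (metis imageE)
    have "w' (u x) = w' (v x)" using T'(3) x by (auto simp: \<eta>_def)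
    then have "w' (w y) = w' (w z)" using yz(3,4) by simp
    then have "\<exists>W \<omega> f' g' h. span W \<omega> f' g' \<and> smor K k f g W \<omega> f' g' h \<and> h y = h z"
      by (intro exI conjI) (rule T'(1), rule ww)
    then have "(y, z) \<in> \<theta>" using yz(1,2) unfolding \<theta>_def by blast
    then show "u x = v x" using T(4) yz by metis
  qed
  then have "subterminal T t f' g'" using T(1) by (simp add: subterminal_def)
  then show ?thesis using that T(2) by blast
qed

end

section \<open>Monomorphisms and their pullbacks\<close>

locale weak_pullback_functor = set_functor F for F :: "'u endo" +
  assumes wpp: "weakly_preserves_pullbacks F"
begin

text \<open>
  Elements of \<open>F A\<close> and \<open>F B\<close> are maps from a one-point set, so the weak pullback property of the image
  square can be used pointwise.
\<close>

lemma weak_pullback_lift: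
  assumes s: "small A" "small B" "small D" "small P" and f: "f \<in> A \<rightarrow> D" "g \<in> B \<rightarrow> D"
    and p: "p \<in> P \<rightarrow> A" "q \<in> P \<rightarrow> B" and comm: "\<And>z. z \<in> P \<Longrightarrow> f (p z) = g (q z)"
    and ex: "\<And>x y. x \<in> A \<Longrightarrow> y \<in> B \<Longrightarrow> f x = g y \<Longrightarrow> \<exists>z\<in>P. p z = x \<and> q z = y"
    and un: "\<And>z z'. z \<in> P \<Longrightarrow> z' \<in> P \<Longrightarrow> p z = p z' \<Longrightarrow> q z = q z' \<Longrightarrow> z = z'"
    and u: "u \<in> FO A" "v \<in> FO B" "fmap A D f u = fmap B D g v"
  shows "\<exists>w. w \<in> FO P \<and> fmap P A p w = u \<and> fmap P B q w = v"
proof -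
  let ?f = "(A, restrict f A, D)" and ?g = "(B, restrict g B, D)" and ?p = "(P, restrict p P, A)" and ?q = "(P, restrict q P, B)"
  have "is_pullback Sets ?f ?g ?p ?q"
    unfolding is_pullback_def
  proof (intro conjI allI impI)
    show "commuting_square Sets ?f ?g ?p ?q"
      using s f p comm by (auto simp: commuting_square_def Sets_def compose_def fun_eq_iff restrict_def)
    fix p' q' assume cs: "commuting_square Sets ?f ?g p' q'"
    then obtain W p1 q1 where pq: "p' = (W, p1, A)" "q' = (W, q1, B)" "p1 \<in> W \<rightarrow>\<^sub>E A" "q1 \<in> W \<rightarrow>\<^sub>E B" "small W"
      and e: "compose W (restrict f A) p1 = compose W (restrict g B) q1"
      by (cases p', cases q') (auto simp: commuting_square_def Sets_def)
    have "\<exists>z\<in>P. p z = p1 x \<and> q z = q1 x" if "x \<in> W" for x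
      using ex[OF PiE_mem[OF pq(3) that] PiE_mem[OF pq(4) that]] PiE_mem[OF pq(3) that] PiE_mem[OF pq(4) that]
        that fun_cong[OF e, of x] by (simp add: compose_def)
    then obtain h where h: "\<And>x. x \<in> W \<Longrightarrow> h x \<in> P \<and> p (h x) = p1 x \<and> q (h x) = q1 x" by metis
    show "\<exists>!h. h \<in> hom Sets (Dom Sets p') (Dom Sets ?p) \<and> ?p \<cdot>\<^bsub>Sets\<^esub> h = p' \<and> ?q \<cdot>\<^bsub>Sets\<^esub> h = q'"
    proof (rule ex1I[of _ "(W, restrict h W, P)"])
      show "(W, restrict h W, P) \<in> hom Sets (Dom Sets p') (Dom Sets ?p) \<and> ?p \<cdot>\<^bsub>Sets\<^esub> (W, restrict h W, P) = p' \<and> ?q \<cdot>\<^bsub>Sets\<^esub> (W, restrict h W, P) = q'"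
        using h pq s by (auto simp: Sets_def hom_def compose_def fun_eq_iff PiE_def extensional_def)
    next
      fix l assume l: "l \<in> hom Sets (Dom Sets p') (Dom Sets ?p) \<and> ?p \<cdot>\<^bsub>Sets\<^esub> l = p' \<and> ?q \<cdot>\<^bsub>Sets\<^esub> l = q'"
      then obtain l' where l': "l = (W, l', P)" "l' \<in> W \<rightarrow>\<^sub>E P" using pq by (auto simp: Sets_def hom_def)
      have "compose W (restrict p P) l' = p1" "compose W (restrict q P) l' = q1"
        using l pq l'(1) by (simp_all add: Sets_def)
      then have "p (l' x) = p1 x" "q (l' x) = q1 x" if "x \<in> W" for x
        using that l'(2) by (auto simp: compose_def)
      then have "l' x = h x" if "x \<in> W" for x
        using un[of "l' x" "h x"] h[OF that] l'(2) that by auto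
      then have "l' = restrict h W" using l'(2) by (auto simp: PiE_def extensional_def fun_eq_iff)
      then show "l = (W, restrict h W, P)" using l'(1) by simp
    qed
  qed
  then have wp: "is_weak_pullback Sets (amap F ?f) (amap F ?g) (amap F ?p) (amap F ?q)"
    using wpp unfolding weakly_preserves_pullbacks_def by blast
  note Ff = amap_eq[OF s(1,3) f(1)] and Fg = amap_eq[OF s(2,3) f(2)] and Fp = amap_eq[OF s(4,1) p(1)] and Fq = amap_eq[OF s(4,2) p(2)]
  \<comment> \<open>Any point will do.\<close>
  let ?o = "undefined :: 'u"
  let ?u = "({?o}, restrict (\<lambda>_. u) {?o}, FO A)" and ?v = "({?o}, restrict (\<lambda>_. v) {?o}, FO B)"
  have so: "small {?o}" unfolding small_def by (rule lt_universe_finite) simp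
  have "commuting_square Sets (amap F ?f) (amap F ?g) ?u ?v"
    using so small_F[OF s(1)] small_F[OF s(2)] small_F[OF s(3)] u Ff Fg
    by (auto simp: commuting_square_def Sets_def compose_def fun_eq_iff)
  then have "\<exists>h. h \<in> hom Sets (Dom Sets ?u) (Dom Sets (amap F ?p)) \<and> amap F ?p \<cdot>\<^bsub>Sets\<^esub> h = ?u \<and> amap F ?q \<cdot>\<^bsub>Sets\<^esub> h = ?v"
    using wp unfolding is_weak_pullback_def by blast
  moreover have "Dom Sets ?u = {?o}" "Dom Sets (amap F ?p) = FO P" using Fp(1) by (simp_all add: Sets_def)
  ultimately obtain h where h: "h \<in> hom Sets {?o} (FO P)" "amap F ?p \<cdot>\<^bsub>Sets\<^esub> h = ?u" "amap F ?q \<cdot>\<^bsub>Sets\<^esub> h = ?v"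
    by (elim exE conjE) simp
  obtain h' where h': "h = ({?o}, h', FO P)" "h' \<in> {?o} \<rightarrow>\<^sub>E FO P" using h(1) by (auto simp: Sets_def hom_def)
  have "compose {?o} (fmap P A p) h' = restrict (\<lambda>_. u) {?o}" "compose {?o} (fmap P B q) h' = restrict (\<lambda>_. v) {?o}"
    using h(2,3) by (simp_all add: h'(1) Fp(1) Fq(1) Sets_def)
  then have "compose {?o} (fmap P A p) h' ?o = u" "compose {?o} (fmap P B q) h' ?o = v" by simp_all
  then show ?thesis using h'(2) by (auto simp: compose_def)
qed

text \<open>
  For each \<open>z\<close> in the pullback, the elements \<open>a (p z)\<close> and \<open>b (q z)\<close> agree in \<open>F D\<close> because \<open>f\<close> and \<open>g\<close> are
  morphisms, so they lift to some element of \<open>F P\<close>, which is taken as the value of the structure map.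
  The lift need not be unique, so that the square need not be a pullback of coalgebras.
\<close>

lemma pullback_structure:
  assumes c: "coalg A a" "coalg B b" "coalg D d" and f: "cmor A a D d f" "cmor B b D d g"
    and P: "small P" and p: "p \<in> P \<rightarrow> A" "q \<in> P \<rightarrow> B" and comm: "\<And>z. z \<in> P \<Longrightarrow> f (p z) = g (q z)"
    and ex: "\<And>x y. x \<in> A \<Longrightarrow> y \<in> B \<Longrightarrow> f x = g y \<Longrightarrow> \<exists>z\<in>P. p z = x \<and> q z = y"
    and un: "\<And>z z'. z \<in> P \<Longrightarrow> z' \<in> P \<Longrightarrow> p z = p z' \<Longrightarrow> q z = q z' \<Longrightarrow> z = z'"
  obtains \<pi> where "coalg P \<pi>" "cmor P \<pi> A a p" "cmor P \<pi> B b q"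
proof -
  have "\<exists>w. w \<in> FO P \<and> fmap P A p w = a (p z) \<and> fmap P B q w = b (q z)" if z: "z \<in> P" for z
  proof (rule weak_pullback_lift[OF coalgD(1)[OF c(1)] coalgD(1)[OF c(2)] coalgD(1)[OF c(3)] P
        cmorD(1)[OF f(1)] cmorD(1)[OF f(2)] p comm ex un])
    have pz: "p z \<in> A" "q z \<in> B" using p z by auto
    show "a (p z) \<in> FO A" "b (q z) \<in> FO B" using coalgD(2)[OF c(1) pz(1)] coalgD(2)[OF c(2) pz(2)] .
    show "fmap A D f (a (p z)) = fmap B D g (b (q z))"
      using cmorD(3)[OF f(1) pz(1)] cmorD(3)[OF f(2) pz(2)] comm[OF z] by simp
  qed
  then obtain \<pi> where "\<And>z. z \<in> P \<Longrightarrow> \<pi> z \<in> FO P \<and> fmap P A p (\<pi> z) = a (p z) \<and> fmap P B q (\<pi> z) = b (q z)"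
    by metis
  then show ?thesis using that[of \<pi>] P p by (simp add: coalg_def cmor_def)
qed

text \<open>
  The kernel pair of the underlying function carries a coalgebra structure; its two projections are
  morphisms with the same composite, hence equal.
\<close>

lemma mono_inj:
  assumes c: "coalg A a" "coalg B b" and f: "cmor A a B b f" and m: "is_mono (SetF F) (coalg_ar A a B b f)"
  shows "inj_on f A"
proof -
  let ?R = "{(x, y). x \<in> A \<and> y \<in> A \<and> f x = f y}"
  define P where "P = pair_code ` ?R"
  define p where "p z = fst (inv pair_code z)" for z
  define q where "q z = snd (inv pair_code z)" for z
  have pq [simp]: "p (pair_code (x, y)) = x" "q (pair_code (x, y)) = y" for x y
    by (simp_all add: p_def q_def inv_f_f[OF inj_pair_code])
  have "lt_universe TYPE('u) (A \<times> A)" using coalgD(1)[OF c(1)] unfolding small_def by (intro lt_universe_Sigma)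
  then have "lt_universe TYPE('u) ?R" by (rule lt_universe_subset) auto
  then have P: "small P" unfolding P_def small_def by (rule lt_universe_image)
  obtain \<pi> where \<pi>: "coalg P \<pi>" "cmor P \<pi> A a p" "cmor P \<pi> A a q"
    by (rule pullback_structure[OF c(1,1,2) f f P, of p q]) (auto simp: P_def)
  have "coalg_ar A a B b f \<cdot>\<^bsub>SetF F\<^esub> coalg_ar P \<pi> A a p = coalg_ar A a B b f \<cdot>\<^bsub>SetF F\<^esub> coalg_ar P \<pi> A a q"
    unfolding coalg_ar_comp[OF cmorD(1)[OF \<pi>(2)]] coalg_ar_comp[OF cmorD(1)[OF \<pi>(3)]] coalg_ar_eq_iff by (auto simp: P_def)
  then have "coalg_ar P \<pi> A a p = coalg_ar P \<pi> A a q"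
    using m coalg_ar_Arr[OF \<pi>(1) c(1) \<pi>(2)] coalg_ar_Arr[OF \<pi>(1) c(1) \<pi>(3)] unfolding is_mono_def by simp
  then have "\<forall>z\<in>P. p z = q z" by (simp add: coalg_ar_eq_iff)
  then show ?thesis by (auto simp: P_def inj_on_def)
qed

text \<open>
  Since \<open>\<mu>\<close> is injective, the set-theoretic pullback is the preimage of its image. Here the projection
  to \<open>X\<close> is an inclusion, and as injective morphisms detect morphisms, mediating functions are
  morphisms.
\<close>

lemma mono_pullback:
  assumes m: "is_mono (SetF F) \<mu>" and \<phi>: "\<phi> \<in> Arr (SetF F)" and cod: "Cod (SetF F) \<phi> = Cod (SetF F) \<mu>"
  shows "\<exists>\<kappa> \<rho>. is_pullback (SetF F) \<phi> \<mu> \<kappa> \<rho>"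
proof -
  have \<mu>: "\<mu> \<in> Arr (SetF F)" using m by (simp add: is_mono_def)
  obtain X \<xi> where X: "Dom (SetF F) \<phi> = coalg_ob X \<xi>" "coalg X \<xi>" using SetF_ObjE SetF_Dom_Obj(1)[OF \<phi>] by metis
  obtain U \<upsilon> where U: "Dom (SetF F) \<mu> = coalg_ob U \<upsilon>" "coalg U \<upsilon>" using SetF_ObjE SetF_Dom_Obj(1)[OF \<mu>] by metis
  obtain Y \<eta> where Y: "Cod (SetF F) \<phi> = coalg_ob Y \<eta>" "coalg Y \<eta>" using SetF_ObjE SetF_Dom_Obj(2)[OF \<phi>] by metis
  obtain g where g: "\<phi> = coalg_ar X \<xi> Y \<eta> g" "cmor X \<xi> Y \<eta> g" using SetF_ArrE[OF \<phi> X(1) Y(1) X(2) Y(2)] .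
  obtain i where i: "\<mu> = coalg_ar U \<upsilon> Y \<eta> i" "cmor U \<upsilon> Y \<eta> i" using SetF_ArrE[OF \<mu> U(1) Y(1)[unfolded cod] U(2) Y(2)] .
  have inj: "inj_on i U" using mono_inj[OF U(2) Y(2) i(2)] m i(1) by simp
  let ?P = "{x \<in> X. g x \<in> i ` U}" and ?q = "\<lambda>x. inv_into U i (g x)"
  have P: "small ?P" using small_subset[OF coalgD(1)[OF X(2)]] by simp
  have iq: "i (?q x) = g x" "?q x \<in> U" if "x \<in> ?P" for x
    using that f_inv_into_f[of "g x" i U] inv_into_into[of "g x" i U] by auto
  obtain \<pi> where \<pi>: "coalg ?P \<pi>" "cmor ?P \<pi> X \<xi> (\<lambda>x. x)" "cmor ?P \<pi> U \<upsilon> ?q"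
  proof (rule pullback_structure[OF X(2) U(2) Y(2) g(2) i(2) P])
    show "(\<lambda>x. x) \<in> ?P \<rightarrow> X" "?q \<in> ?P \<rightarrow> U" using iq(2) by auto
    show "g z = i (?q z)" if "z \<in> ?P" for z using iq(1)[OF that] by simp
    show "\<exists>z\<in>?P. z = x \<and> ?q z = y" if "x \<in> X" "y \<in> U" "g x = i y" for x y
      using that inj by auto
  qed
  have "is_pullback (SetF F) \<phi> \<mu> (coalg_ar ?P \<pi> X \<xi> (\<lambda>x. x)) (coalg_ar ?P \<pi> U \<upsilon> ?q)"
    unfolding is_pullback_def
  proof (intro conjI allI impI)
    have "\<phi> \<cdot>\<^bsub>SetF F\<^esub> coalg_ar ?P \<pi> X \<xi> (\<lambda>x. x) = \<mu> \<cdot>\<^bsub>SetF F\<^esub> coalg_ar ?P \<pi> U \<upsilon> ?q"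
      unfolding g(1) i(1) coalg_ar_comp[OF cmorD(1)[OF \<pi>(2)]] coalg_ar_comp[OF cmorD(1)[OF \<pi>(3)]] coalg_ar_eq_iff using iq by simp
    then show "commuting_square (SetF F) \<phi> \<mu> (coalg_ar ?P \<pi> X \<xi> (\<lambda>x. x)) (coalg_ar ?P \<pi> U \<upsilon> ?q)"
      using \<phi> \<mu> X U cod coalg_ar_Arr[OF \<pi>(1) X(2) \<pi>(2)] coalg_ar_Arr[OF \<pi>(1) U(2) \<pi>(3)]
      by (simp add: commuting_square_def)
    fix \<alpha> \<beta> assume cs: "commuting_square (SetF F) \<phi> \<mu> \<alpha> \<beta>"
    then have ab: "\<alpha> \<in> Arr (SetF F)" "\<beta> \<in> Arr (SetF F)" "Dom (SetF F) \<beta> = Dom (SetF F) \<alpha>"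
      "Cod (SetF F) \<alpha> = coalg_ob X \<xi>" "Cod (SetF F) \<beta> = coalg_ob U \<upsilon>" and e: "\<phi> \<cdot>\<^bsub>SetF F\<^esub> \<alpha> = \<mu> \<cdot>\<^bsub>SetF F\<^esub> \<beta>"
      using X U by (auto simp: commuting_square_def)
    obtain W \<omega> where W: "Dom (SetF F) \<alpha> = coalg_ob W \<omega>" "coalg W \<omega>" using SetF_ObjE SetF_Dom_Obj(1)[OF ab(1)] by metis
    obtain p' where p': "\<alpha> = coalg_ar W \<omega> X \<xi> p'" "cmor W \<omega> X \<xi> p'" using SetF_ArrE[OF ab(1) W(1) ab(4) W(2) X(2)] .
    obtain q' where q': "\<beta> = coalg_ar W \<omega> U \<upsilon> q'" "cmor W \<omega> U \<upsilon> q'" using SetF_ArrE[OF ab(2) W(1)[folded ab(3)] ab(5) W(2) U(2)] .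
    have gi: "g (p' x) = i (q' x)" if "x \<in> W" for x
      using e that unfolding g(1) i(1) p'(1) q'(1) coalg_ar_comp[OF cmorD(1)[OF p'(2)]] coalg_ar_comp[OF cmorD(1)[OF q'(2)]] coalg_ar_eq_iff by simp
    have pP: "p' x \<in> ?P" "?q (p' x) = q' x" if x: "x \<in> W" for x
      using gi[OF x] cmorD(2)[OF p'(2) x] cmorD(2)[OF q'(2) x] inj by auto
    have h: "cmor W \<omega> ?P \<pi> p'"
      by (rule cmor_cancel_inj[OF \<pi>(2) _ \<pi>(1) X(2) W(2)]) (use pP p'(2) in \<open>auto simp: inj_on_def\<close>)
    show "\<exists>!h. h \<in> hom (SetF F) (Dom (SetF F) \<alpha>) (Dom (SetF F) (coalg_ar ?P \<pi> X \<xi> (\<lambda>x. x)))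
        \<and> coalg_ar ?P \<pi> X \<xi> (\<lambda>x. x) \<cdot>\<^bsub>SetF F\<^esub> h = \<alpha> \<and> coalg_ar ?P \<pi> U \<upsilon> ?q \<cdot>\<^bsub>SetF F\<^esub> h = \<beta>"
    proof (rule ex1I[of _ "coalg_ar W \<omega> ?P \<pi> p'"])
      show "coalg_ar W \<omega> ?P \<pi> p' \<in> hom (SetF F) (Dom (SetF F) \<alpha>) (Dom (SetF F) (coalg_ar ?P \<pi> X \<xi> (\<lambda>x. x)))
        \<and> coalg_ar ?P \<pi> X \<xi> (\<lambda>x. x) \<cdot>\<^bsub>SetF F\<^esub> coalg_ar W \<omega> ?P \<pi> p' = \<alpha> \<and> coalg_ar ?P \<pi> U \<upsilon> ?q \<cdot>\<^bsub>SetF F\<^esub> coalg_ar W \<omega> ?P \<pi> p' = \<beta>"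
        unfolding coalg_ar_comp[OF cmorD(1)[OF h]] p'(1) q'(1) coalg_ar_eq_iff
        using coalg_ar_Arr[OF W(2) \<pi>(1) h] pP(2) by (simp add: hom_def)
    next
      fix k assume k: "k \<in> hom (SetF F) (Dom (SetF F) \<alpha>) (Dom (SetF F) (coalg_ar ?P \<pi> X \<xi> (\<lambda>x. x)))
        \<and> coalg_ar ?P \<pi> X \<xi> (\<lambda>x. x) \<cdot>\<^bsub>SetF F\<^esub> k = \<alpha> \<and> coalg_ar ?P \<pi> U \<upsilon> ?q \<cdot>\<^bsub>SetF F\<^esub> k = \<beta>"
      then have kA: "k \<in> Arr (SetF F)" "Dom (SetF F) k = coalg_ob W \<omega>" "Cod (SetF F) k = coalg_ob ?P \<pi>" using W(1) by (auto simp: hom_def)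
      obtain l where l: "k = coalg_ar W \<omega> ?P \<pi> l" "cmor W \<omega> ?P \<pi> l" using SetF_ArrE[OF kA W(2) \<pi>(1)] .
      have "coalg_ar ?P \<pi> X \<xi> (\<lambda>x. x) \<cdot>\<^bsub>SetF F\<^esub> k = \<alpha>" using k by blast
      then show "k = coalg_ar W \<omega> ?P \<pi> p'"
        unfolding l(1) p'(1) coalg_ar_comp[OF cmorD(1)[OF l(2)]] coalg_ar_eq_iff by simp
    qed
  qed
  then show ?thesis by blast
qed

end

section \<open>Products of coalgebras\<close>

locale weak_pullback_pair = weak_pullback_functor F + coalgebra_pair F A B a b
  for F :: "'u endo" and A B :: "'u set" and a b :: "'u \<Rightarrow> 'u"
begin

lemma span_restrict:
  assumes "span W \<omega> f g" "subco W \<omega> S s"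
  shows "span S s f g" "smor S s f g W \<omega> f g (\<lambda>x. x)"
proof -
  have s: "coalg S s" "cmor S s W \<omega> (\<lambda>x. x)" using assms(2) by (auto simp: subco_def)
  note w = spanD[OF assms(1)]
  show "span S s f g"
    using cmor_comp[OF s(2) w(2) s(1) w(1) A] cmor_comp[OF s(2) w(3) s(1) w(1) B] s(1) by (simp add: span_def)
  show "smor S s f g W \<omega> f g (\<lambda>x. x)" using s by (simp add: smor_def)
qed

text \<open>
  Start from the coproduct of all spans with carrier inside the field of \<open>r\<close>. The resulting subterminal
  span receives a morphism from every span of cardinality at most \<open>r\<close>. An arbitrary span is covered
  by such spans, and the local morphisms agree on intersections since the target is subterminal.
\<close>

lemma terminal_span:
  assumes "bounded F"
  obtains T t f' g' where "subterminal T t f' g'"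
    "\<forall>W \<omega> f g. span W \<omega> f g \<longrightarrow> (\<exists>h. smor W \<omega> f g T t f' g' h)"
proof -
  obtain r :: "'u rel" where r: "Card_order r" "r <o |UNIV :: 'u set|"
    and bd: "\<And>A \<alpha> x. coalgebra F (A, \<alpha>) \<Longrightarrow> x \<in> A \<Longrightarrow> \<exists>S. subcoalgebra F (A, \<alpha>) S \<and> x \<in> S \<and> |S| \<le>o r"
    using assms unfolding bounded_def by blast
  let ?R = "Field r"
  have R: "lt_universe TYPE('u) ?R" using r card_of_Field_ordIso ordIso_ordLess_trans by blast
  define \<Sigma> where "\<Sigma> = {(S, s, f, g). S \<subseteq> ?R \<and> s \<in> S \<rightarrow>\<^sub>E FO S \<and> f \<in> S \<rightarrow>\<^sub>E A \<and> g \<in> S \<rightarrow>\<^sub>E B \<and> span S s f g}"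
  have "lt_universe TYPE('u) (SIGMA S:Pow ?R. (S \<rightarrow>\<^sub>E FO S) \<times> (S \<rightarrow>\<^sub>E A) \<times> (S \<rightarrow>\<^sub>E B))"
  proof (rule lt_universe_Sigma[OF lt_universe_Pow[OF R]])
    fix S assume "S \<in> Pow ?R"
    then have S: "lt_universe TYPE('u) S" using lt_universe_subset[OF R] by blast
    have "lt_universe TYPE('u) (FO S)" using S small_F[of S] by (simp add: small_def)
    moreover have "lt_universe TYPE('u) A" "lt_universe TYPE('u) B" using coalgD(1)[OF A] coalgD(1)[OF B] by (simp_all add: small_def)
    ultimately show "lt_universe TYPE('u) ((S \<rightarrow>\<^sub>E FO S) \<times> (S \<rightarrow>\<^sub>E A) \<times> (S \<rightarrow>\<^sub>E B))"
      by (intro lt_universe_Sigma lt_universe_PiE S)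
  qed
  then have sm: "lt_universe TYPE('u) \<Sigma>" by (rule lt_universe_subset) (auto simp: \<Sigma>_def)
  obtain K k fK gK where K: "span K k fK gK" "\<And>S s f g. (S, s, f, g) \<in> \<Sigma> \<Longrightarrow> \<exists>i. smor S s f g K k fK gK i"
    by (rule span_coproduct[OF sm]) (auto simp: \<Sigma>_def)
  obtain T t f' g' w where st: "subterminal T t f' g'" and T2: "smor K k fK gK T t f' g' w"
    using subterminal_span[OF K(1)] .
  note T = subterminalD(1)[OF st] T2 and un = subterminalD(2)[OF st]
  note cT = spanD(1)[OF T(1)] and cK = spanD(1)[OF K(1)]
  have small_ex: "\<exists>h. smor S s f g T t f' g' h" if S: "span S s f g" "|S| \<le>o r" for S s f g
  proof -
    have "|S| \<le>o |?R|" using S(2) r(1) card_of_Field_ordIso ordIso_symmetric ordLeq_ordIso_trans by blast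
    then obtain j where j: "inj_on j S" "j ` S \<subseteq> ?R" unfolding card_of_ordLeq[symmetric] by (elim exE conjE)
    let ?S = "j ` S" and ?i = "inv_into S j"
    note cS = spanD(1)[OF S(1)]
    have sS: "small ?S" using coalgD(1)[OF cS] unfolding small_def by (rule lt_universe_image)
    have jS: "j \<in> S \<rightarrow> ?S" by blast
    have ij: "?i (j x) = x" if "x \<in> S" for x using j(1) that by simp
    \<comment> \<open>The structure of \<open>S\<close> transported along \<open>j\<close> into the field of \<open>r\<close>; it has to be extensional to belong to \<open>\<Sigma>\<close>.\<close>
    let ?s = "restrict (\<lambda>y. fmap S ?S j (s (?i y))) ?S"
    have s: "?s \<in> ?S \<rightarrow>\<^sub>E FO ?S" using fmap_in[OF coalgD(1)[OF cS] sS jS] coalgD(2)[OF cS] ij by auto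
    have c: "coalg ?S ?s" using s sS by (auto simp: coalg_def)
    have cj: "cmor S s ?S ?s j" using jS ij by (simp add: cmor_def)
    have tr: "cmor ?S ?s Z z (restrict (\<lambda>y. h (?i y)) ?S)" if Z: "coalg Z z" "cmor S s Z z h" for Z z h
      unfolding cmor_def
    proof (intro conjI ballI)
      show hZ: "restrict (\<lambda>y. h (?i y)) ?S \<in> ?S \<rightarrow> Z" using cmorD(2)[OF Z(2)] ij by auto
      fix y assume "y \<in> ?S"
      then obtain x where x: "y = j x" "x \<in> S" by blast
      have "z (h x) = fmap S Z (\<lambda>x. restrict (\<lambda>y. h (?i y)) ?S (j x)) (s x)"
        unfolding cmorD(3)[OF Z(2) x(2)] by (rule fun_cong[OF fmap_cong]) (simp add: ij)
      also have "\<dots> = fmap ?S Z (restrict (\<lambda>y. h (?i y)) ?S) (fmap S ?S j (s x))"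
        by (rule fmap_comp[symmetric, OF coalgD(1)[OF cS] sS coalgD(1)[OF Z(1)] jS hZ coalgD(2)[OF cS x(2)]])
      finally show "z (restrict (\<lambda>y. h (?i y)) ?S y) = fmap ?S Z (restrict (\<lambda>y. h (?i y)) ?S) (?s y)"
        using x by (simp add: ij)
    qed
    let ?f = "restrict (\<lambda>y. f (?i y)) ?S" and ?g = "restrict (\<lambda>y. g (?i y)) ?S"
    have sp: "span ?S ?s ?f ?g" using c tr[OF A spanD(2)[OF S(1)]] tr[OF B spanD(3)[OF S(1)]] by (simp add: span_def)
    have "?f \<in> ?S \<rightarrow>\<^sub>E A" "?g \<in> ?S \<rightarrow>\<^sub>E B"
      unfolding PiE_def
      by (intro IntI restrict_extensional cmorD(1)[OF spanD(2)[OF sp]] cmorD(1)[OF spanD(3)[OF sp]])+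
    then have "(?S, ?s, ?f, ?g) \<in> \<Sigma>" using j(2) s sp by (simp add: \<Sigma>_def)
    then obtain i where i: "smor ?S ?s ?f ?g K k fK gK i" using K(2) by blast
    have sj: "smor S s f g ?S ?s ?f ?g j" using cj ij by (simp add: smor_def)
    show ?thesis using smor_comp[OF smor_comp[OF sj i cS c cK] T(2) cS cK cT] by blast
  qed
  have ex: "\<exists>h. smor W \<omega> f g T t f' g' h" if W: "span W \<omega> f g" for W \<omega> f g
  proof -
    note cW = spanD(1)[OF W]
    have "\<exists>S s h. c \<in> S \<and> subco W \<omega> S s \<and> smor S s f g T t f' g' h" if c: "c \<in> W" for c
    proof -
      have "coalgebra F (W, (W, restrict \<omega> W, FO W))" using cW coalgebra_iff by blast
      from bd[OF this c] obtain S where S: "subcoalgebra F (W, (W, restrict \<omega> W, FO W)) S" "c \<in> S" "|S| \<le>o r" by blast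
      then obtain s where "subco W \<omega> S s" using subcoalgebra_iff[OF cW] by blast
      then show ?thesis using small_ex[OF span_restrict(1)[OF W] S(3)] S(2) by blast
    qed
    then obtain S s h where S: "\<And>c. c \<in> W \<Longrightarrow> c \<in> S c" "\<And>c. c \<in> W \<Longrightarrow> subco W \<omega> (S c) (s c)"
      "\<And>c. c \<in> W \<Longrightarrow> smor (S c) (s c) f g T t f' g' (h c)" by metis
    \<comment> \<open>Glue: evaluate at each point the morphism of the subcoalgebra chosen for that point.\<close>
    define H where "H c = h c c" for c
    have H: "H d = h c d" if c: "c \<in> W" "d \<in> S c" for c d
    proof -
      have d: "d \<in> W" using S(2)[OF c(1)] c(2) by (auto simp: subco_def)
      have sc: "coalg (S c) (s c)" "cmor (S c) (s c) W \<omega> (\<lambda>x. x)" "S c \<subseteq> W" using S(2)[OF c(1)] by (auto simp: subco_def)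
      have sd: "coalg (S d) (s d)" "cmor (S d) (s d) W \<omega> (\<lambda>x. x)" using S(2)[OF d] by (auto simp: subco_def)
      let ?I = "S c \<inter> S d"
      have I: "small ?I" using small_subset[OF coalgD(1)[OF sc(1)]] by blast
      obtain \<iota> where \<iota>: "coalg ?I \<iota>" "cmor ?I \<iota> (S c) (s c) (\<lambda>x. x)" "cmor ?I \<iota> (S d) (s d) (\<lambda>x. x)"
        by (rule pullback_structure[OF sc(1) sd(1) cW sc(2) sd(2) I, of "\<lambda>x. x" "\<lambda>x. x"]) auto
      have "subco W \<omega> ?I \<iota>"
        using \<iota>(1) cmor_comp[OF \<iota>(2) sc(2) \<iota>(1) sc(1) cW] sc(3) by (auto simp: subco_def)
      then have spI: "span ?I \<iota> f g" using span_restrict[OF W] by blast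
      have "smor ?I \<iota> f g (S c) (s c) f g (\<lambda>x. x)" "smor ?I \<iota> f g (S d) (s d) f g (\<lambda>x. x)"
        using \<iota>(2,3) by (simp_all add: smor_def)
      then have "smor ?I \<iota> f g T t f' g' (h c)" "smor ?I \<iota> f g T t f' g' (h d)"
        using smor_comp[OF _ S(3)[OF c(1)] \<iota>(1) sc(1) cT] smor_comp[OF _ S(3)[OF d] \<iota>(1) sd(1) cT] by blast+
      then have "h c d = h d d" by (rule un[OF spI]) (use c(2) S(1)[OF d] in simp)
      then show ?thesis by (simp add: H_def)
    qed
    have "cmor W \<omega> T t H"
      unfolding cmor_def
    proof (intro conjI ballI)
      show HT: "H \<in> W \<rightarrow> T" unfolding H_def using cmorD(2)[OF smorD(1)[OF S(3)] S(1)] by blast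
      fix c assume c: "c \<in> W"
      have sc: "coalg (S c) (s c)" "cmor (S c) (s c) W \<omega> (\<lambda>x. x)" using S(2)[OF c] by (auto simp: subco_def)
      have "t (H c) = fmap (S c) T (h c) (s c c)" unfolding H_def by (rule cmorD(3)[OF smorD(1)[OF S(3)[OF c]] S(1)[OF c]])
      also have "\<dots> = fmap (S c) T (\<lambda>x. H x) (s c c)" by (rule fun_cong[OF fmap_cong]) (simp add: H[OF c])
      also have "\<dots> = fmap W T H (fmap (S c) W (\<lambda>x. x) (s c c))"
        by (rule fmap_comp[symmetric, OF coalgD(1)[OF sc(1)] coalgD(1)[OF cW] coalgD(1)[OF cT] cmorD(1)[OF sc(2)] HT coalgD(2)[OF sc(1) S(1)[OF c]]])
      also have "\<dots> = fmap W T H (\<omega> c)" using cmorD(3)[OF sc(2) S(1)[OF c]] by simp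
      finally show "t (H c) = fmap W T H (\<omega> c)" .
    qed
    moreover have "f' (H c) = f c \<and> g' (H c) = g c" if "c \<in> W" for c
      unfolding H_def using smorD(2,3)[OF S(3)[OF that] S(1)[OF that]] by blast
    ultimately show ?thesis unfolding smor_def by blast
  qed
  show ?thesis using that[OF st] ex by blast
qed

lemma product_exists:
  assumes "bounded F"
  shows "\<exists>P p q. is_product (SetF F) (coalg_ob A a) (coalg_ob B b) P p q"
proof -
  obtain T t f' g' where st: "subterminal T t f' g'"
    and ex: "\<forall>W \<omega> f g. span W \<omega> f g \<longrightarrow> (\<exists>h. smor W \<omega> f g T t f' g' h)"
    using terminal_span[OF assms] .
  note un = subterminalD(2)[OF st] and t = spanD[OF subterminalD(1)[OF st]]
  have "is_product (SetF F) (coalg_ob A a) (coalg_ob B b) (coalg_ob T t) (coalg_ar T t A a f') (coalg_ar T t B b g')"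
    unfolding is_product_def
  proof (intro conjI allI impI)
    show "coalg_ob T t \<in> Obj (SetF F)" by (rule coalg_ob_Obj[OF t(1)])
    show "coalg_ar T t A a f' \<in> hom (SetF F) (coalg_ob T t) (coalg_ob A a)" "coalg_ar T t B b g' \<in> hom (SetF F) (coalg_ob T t) (coalg_ob B b)"
      using coalg_ar_Arr[OF t(1) A t(2)] coalg_ar_Arr[OF t(1) B t(3)] by (simp_all add: hom_def)
    fix X \<phi> \<psi> assume h: "\<phi> \<in> hom (SetF F) X (coalg_ob A a) \<and> \<psi> \<in> hom (SetF F) X (coalg_ob B b)"
    then have pp: "\<phi> \<in> Arr (SetF F)" "Cod (SetF F) \<phi> = coalg_ob A a" "\<psi> \<in> Arr (SetF F)" "Cod (SetF F) \<psi> = coalg_ob B b"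
      and X: "Dom (SetF F) \<phi> = X" "Dom (SetF F) \<psi> = X" by (auto simp: hom_def)
    obtain W \<omega> where W: "X = coalg_ob W \<omega>" "coalg W \<omega>" using SetF_ObjE SetF_Dom_Obj(1)[OF pp(1)] X by metis
    obtain f where f: "\<phi> = coalg_ar W \<omega> A a f" "cmor W \<omega> A a f" using SetF_ArrE[OF pp(1) X(1)[unfolded W(1)] pp(2) W(2) A] .
    obtain g where g: "\<psi> = coalg_ar W \<omega> B b g" "cmor W \<omega> B b g" using SetF_ArrE[OF pp(3) X(2)[unfolded W(1)] pp(4) W(2) B] .
    have sp: "span W \<omega> f g" using W f g by (simp add: span_def)
    obtain h where h: "smor W \<omega> f g T t f' g' h" using ex sp by blast
    have smor_iff: "smor W \<omega> f g T t f' g' k \<longleftrightarrow> coalg_ar T t A a f' \<cdot>\<^bsub>SetF F\<^esub> coalg_ar W \<omega> T t k = \<phi> \<and> coalg_ar T t B b g' \<cdot>\<^bsub>SetF F\<^esub> coalg_ar W \<omega> T t k = \<psi>"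
      if "cmor W \<omega> T t k" for k
      unfolding coalg_ar_comp[OF cmorD(1)[OF that]] f(1) g(1) coalg_ar_eq_iff smor_def using that by auto
    show "\<exists>!h. h \<in> hom (SetF F) X (coalg_ob T t) \<and> coalg_ar T t A a f' \<cdot>\<^bsub>SetF F\<^esub> h = \<phi> \<and> coalg_ar T t B b g' \<cdot>\<^bsub>SetF F\<^esub> h = \<psi>"
    proof (rule ex1I[of _ "coalg_ar W \<omega> T t h"])
      show "coalg_ar W \<omega> T t h \<in> hom (SetF F) X (coalg_ob T t) \<and> coalg_ar T t A a f' \<cdot>\<^bsub>SetF F\<^esub> coalg_ar W \<omega> T t h = \<phi> \<and> coalg_ar T t B b g' \<cdot>\<^bsub>SetF F\<^esub> coalg_ar W \<omega> T t h = \<psi>"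
        using smor_iff[OF smorD(1)[OF h]] h coalg_ar_Arr[OF W(2) t(1) smorD(1)[OF h]] W(1) by (simp add: hom_def)
    next
      fix k assume k: "k \<in> hom (SetF F) X (coalg_ob T t) \<and> coalg_ar T t A a f' \<cdot>\<^bsub>SetF F\<^esub> k = \<phi> \<and> coalg_ar T t B b g' \<cdot>\<^bsub>SetF F\<^esub> k = \<psi>"
      then have kA: "k \<in> Arr (SetF F)" "Dom (SetF F) k = coalg_ob W \<omega>" "Cod (SetF F) k = coalg_ob T t" using W(1) by (auto simp: hom_def)
      obtain l where l: "k = coalg_ar W \<omega> T t l" "cmor W \<omega> T t l" using SetF_ArrE[OF kA W(2) t(1)] .
      then have "smor W \<omega> f g T t f' g' l" using smor_iff[OF l(2)] k by simp
      then have "l x = h x" if "x \<in> W" for x using un[OF sp _ h that] by blast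
      then show "k = coalg_ar W \<omega> T t h" unfolding l(1) coalg_ar_eq_iff by blast
    qed
  qed
  then show ?thesis by blast
qed

end

section \<open>Partial maps of coalgebras\<close>

theorem proposition1p3:
  fixes F :: "'u endo"
  assumes "set_universe TYPE('u)"
    and "is_functor Sets Sets F"
    and "nontrivial F"
    and "weakly_preserves_pullbacks F"
    and "bounded F \<or> accessible F"
  shows "P_category (Pfn (SetF F)) (pfn_box (SetF F)) (pfn_diag (SetF F))
           (pfn_proj0 (SetF F)) (pfn_proj1 (SetF F))"
proof -
  interpret F: weak_pullback_functor F
    using assms by unfold_locales
  have bounded: "bounded F"
    using assms(5) F.accessible_bounded by blast
  interpret S: category "SetF F"
    by (rule category_SetF[OF assms(2)])
  interpret S: partial_product_category "SetF F"
  proof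
    fix m f assume "is_mono (SetF F) m" "f \<in> Arr (SetF F)" "Cod (SetF F) f = Cod (SetF F) m"
    then show "\<exists>q r. is_pullback (SetF F) f m q r" by (rule F.mono_pullback)
  next
    fix X Y assume "X \<in> Obj (SetF F)" "Y \<in> Obj (SetF F)"
    then obtain A a B b where XY: "X = F.coalg_ob A a" "F.coalg A a" "Y = F.coalg_ob B b" "F.coalg B b"
      by (metis F.SetF_ObjE)
    interpret weak_pullback_pair F A B a b
      using XY by unfold_locales
    show "\<exists>P p q. is_product (SetF F) X Y P p q"
      unfolding XY(1,3) by (rule product_exists[OF bounded])
  qed
  show ?thesis by (rule S.P_category_Pfn)
qed

end
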